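(* Let $F:\mathbb{R}^n\rightrightarrows\mathbb{R}^m$ be a set-valued mapping with closed graph and let $(\bar x,\bar y)\in\operatorname{gph}F$. If both $\mathbb{R}^m$ and $\mathbb{R}^n$ are equipped with the Euclidean norm, then (i) $\mathrm{rad[SR]}_{Lip}F(\bar x\,|\,\bar y)\le\overline{\mathrm{rg}}^\circ[F](\bar x,\bar y)$; (ii) $\frac{1}{\sqrt2}\,\overline{\mathrm{rg}}^\circ[F](\bar x,\bar y)\le\mathrm{rad[SR]}_{ss}F(\bar x\,|\,\bar y)=\mathrm{rad[SR]}_{C^1}F(\bar x\,|\,\bar y)\le\overline{\mathrm{rg}}^\circ[F](\bar x,\bar y)$.
   Context: All norms on $\mathbb{R}^n$, $\mathbb{R}^m$ (and their duals) are Euclidean, $\|\cdot\|=\|\cdot\|_2$; starred vectors denote dual elements, identified with column vectors. Infima over the empty set are $+\infty$. Normal cones: For a set $A\subset\mathbb{R}^d$ and $z\in A$, $T_A(z)=\{w\mid \exists w_i\to w,\ t_i\searrow0,\ z+t_iw_i\in A\ \forall i\}$ and $N_A(z)=\{z^*\mid \langle z^*,w\rangle\le0\ \forall w\in T_A(z)\}$; $N_A(z)=\emptyset$ if $z\notin A$. For $w\in\mathbb{R}^d$, $\overline N_A(z;w)=\{z^*\mid\exists t_i\searrow0,\ w_i\to w,\ z_i^*\to z^*,\ z_i^*\in N_A(z+t_iw_i)\ \forall i\}$. $\operatorname{gph}F=\{(x,y)\mid y\in F(x)\}$. The primal-dual derivative of $F$ at $(\bar x,\bar y)$ is $\widehat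 DF(\bar x,\bar y)(u,v^* )=\{(u^*,v)\in\mathbb{R}^n\times\mathbb{R}^m\mid (u^*,-v^* )\in\overline N_{\operatorname{gph}F}((\bar x,\bar y);(u,v))\}$, and $$\overline{\mathrm{rg}}^\circ[F](\bar x,\bar y)=\inf\Big\{\sqrt{\|u^*\|_2^2+\|v\|_2^2-({u^*}^Tu)^2}\ \Big|\ (u^*,v)\in\widehat DF(\bar x,\bar y)(u,v^* ),\ {u^*}^Tu={v^*}^Tv,\ \|u\|_2=\|v^*\|_2=1\Big\}.$$ Metric subregularity: $G:\mathbb{R}^n\rightrightarrows\mathbb{R}^m$ is metrically subregular at $\bar x$ for $\bar y$ if $(\bar x,\bar y)\in\operatorname{gph}G$ and there are $\kappa\ge0$ and a neighborhood $U$ of $\bar x$ with $d(x,G^{-1}(\bar y))\le\kappa\, d(\bar y,G(x))$ for all $x\in U$, where $G^{-1}(y)=\{x\mid y\in G(x)\}$, $d(x,C)=\inf_{c\in C}\|x-c\|$ and $d(\cdot,\emptyset)=+\infty$. Radii: $\operatorname{lip}(h;\bar x)=\limsup_{x,x'\to\bar x,\,x\ne x'}\|h(x)-h(x')\|/\|x-x'\|$. Consider the classes of functions $h:\mathbb{R}^n\to\mathbb{R}^m$ with $h(\bar x)=0$: $\mathcal F_{Lip}$ (Lipschitz continuous around $\bar x$), $\mathcal F_{ss}$ (semismooth at $\bar x$), $\mathcal F_{C^1}$ ($C^1$ around $\bar x$). Here $h$ is semismooth at $\bar x$ if it is Lipschitz continuous around $\bar x$ and for every $u\in\mathbb{R}^n$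 the limit of $Vu'$, over $V\in\partial_Ch(\bar x+tu')$, $u'\to u$, $t\searrow0$, exists; $\partial_Ch(x)$ is the Clarke generalized Jacobian (the convex hull of all limits of $\nabla h(x_k)$, $x_k\to x$, $h$ differentiable at $x_k$). For $\mathcal P\in\{Lip,ss,C^1\}$, $$\mathrm{rad[SR]}_{\mathcal P}F(\bar x\,|\,\bar y)=\inf_{h\in\mathcal F_{\mathcal P}}\{\operatorname{lip}(h;\bar x)\mid F+h\text{ is not metrically subregular at }\bar x\text{ for }\bar y\}.$$ *)

theory Defs
  imports "HOL-Analysis.Analysis"
begin

definition tangent_cone :: "'a::euclidean_space set \<Rightarrow> 'a \<Rightarrow> 'a set" where
  "tangent_cone A z =
     {w. \<exists>ws t. ws \<longlonglongrightarrow> w \<and> t \<longlonglongrightarrow> (0::real) \<and> (\<forall>i::nat. t i > 0 \<and> z + t i *\<^sub>R ws i \<in> A)}"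

definition normal_cone :: "'a::euclidean_space set \<Rightarrow> 'a \<Rightarrow> 'a set" where
  "normal_cone A z = (if z \<in> A then {zstar. \<forall>w\<in>tangent_cone A z. zstar \<bullet> w \<le> 0} else {})"

definition dir_normal_cone :: "'a::euclidean_space set \<Rightarrow> 'a \<Rightarrow> 'a \<Rightarrow> 'a set" where
  "dir_normal_cone A z w =
     {zstar. \<exists>t ws zs. t \<longlonglongrightarrow> (0::real) \<and> ws \<longlonglongrightarrow> w \<and> zs \<longlonglongrightarrow> zstar \<and>
        (\<forall>i::nat. t i > 0 \<and> zs i \<in> normal_cone A (z + t i *\<^sub>R ws i))}"

definition gph :: "('a \<Rightarrow> 'b set) \<Rightarrow> ('a \<times> 'b) set" where
  "gph F = {(x, y). y \<in> F x}"

text \<open>The inner product and norm on the product type are the Euclidean ones, so the cones of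
  \<^term>\<open>gph F\<close> are those of a subset of the Euclidean space of dimension \<open>n + m\<close>.\<close>

definition primal_dual_deriv ::
    "(real^'n \<Rightarrow> (real^'m) set) \<Rightarrow> real^'n \<Rightarrow> real^'m \<Rightarrow> real^'n \<Rightarrow> real^'m \<Rightarrow> ((real^'n) \<times> (real^'m)) set" where
  "primal_dual_deriv F xbar ybar u vstar =
     {(ustar, v). (ustar, - vstar) \<in> dir_normal_cone (gph F) (xbar, ybar) (u, v)}"

definition rg_circ :: "(real^'n \<Rightarrow> (real^'m) set) \<Rightarrow> real^'n \<Rightarrow> real^'m \<Rightarrow> ereal" where
  "rg_circ F xbar ybar =
     Inf {ereal (sqrt ((norm ustar)\<^sup>2 + (norm v)\<^sup>2 - (ustar \<bullet> u)\<^sup>2)) | ustar v u vstar.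
            (ustar, v) \<in> primal_dual_deriv F xbar ybar u vstar \<and>
            ustar \<bullet> u = vstar \<bullet> v \<and> norm u = 1 \<and> norm vstar = 1}"

text \<open>Unlike \<^const>\<open>infdist\<close>, this distance to the empty set is \<open>\<infinity>\<close>.\<close>

definition set_edist :: "'a::metric_space \<Rightarrow> 'a set \<Rightarrow> ereal" where
  "set_edist x C = (INF c\<in>C. ereal (dist x c))"

text \<open>The convention \<open>0 * \<infinity> = 0\<close> of \<^typ>\<open>ereal\<close> is harmless here: since \<open>\<kappa>\<close> may be enlarged,
  requiring \<open>\<kappa> > 0\<close> would give the same property.\<close>

definition metrically_subregular ::
    "(real^'n \<Rightarrow> (real^'m) set) \<Rightarrow> real^'n \<Rightarrow> real^'m \<Rightarrow> bool" where
  "metrically_subregular G xbar ybar \<longleftrightarrow>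
     (xbar, ybar) \<in> gph G \<and>
     (\<exists>\<kappa>\<ge>0. \<exists>U. open U \<and> xbar \<in> U \<and>
        (\<forall>x\<in>U. set_edist x {x'. ybar \<in> G x'} \<le> ereal \<kappa> * set_edist ybar (G x)))"

definition lip_modulus :: "(real^'n \<Rightarrow> real^'m) \<Rightarrow> real^'n \<Rightarrow> ereal" where
  "lip_modulus h xbar =
     Limsup (at (xbar, xbar) within {(x, x'). x \<noteq> x'})
       (\<lambda>(x, x'). ereal (norm (h x - h x') / norm (x - x')))"

definition lipschitz_around :: "(real^'n \<Rightarrow> real^'m) \<Rightarrow> real^'n \<Rightarrow> bool" where
  "lipschitz_around h xbar \<longleftrightarrow> (\<exists>U L. open U \<and> xbar \<in> U \<and> L-lipschitz_on U h)"

definition clarke_jacobian :: "(real^'n \<Rightarrow> real^'m) \<Rightarrow> real^'n \<Rightarrow> (real^'n^'m) set" where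
  "clarke_jacobian h x =
     convex hull {V. \<exists>xs J. xs \<longlonglongrightarrow> x \<and> J \<longlonglongrightarrow> V \<and>
                       (\<forall>k::nat. (h has_derivative (\<lambda>d. J k *v d)) (at (xs k)))}"

definition semismooth_at :: "(real^'n \<Rightarrow> real^'m) \<Rightarrow> real^'n \<Rightarrow> bool" where
  "semismooth_at h xbar \<longleftrightarrow>
     lipschitz_around h xbar \<and>
     (\<forall>u. \<exists>l. \<forall>t us V.
        t \<longlonglongrightarrow> (0::real) \<and> us \<longlonglongrightarrow> u \<and>
        (\<forall>k::nat. t k > 0 \<and> V k \<in> clarke_jacobian h (xbar + t k *\<^sub>R us k))
        \<longrightarrow> (\<lambda>k. V k *v us k) \<longlonglongrightarrow> l)"

definition C1_around :: "(real^'n \<Rightarrow> real^'m) \<Rightarrow> real^'n \<Rightarrow> bool" where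
  "C1_around h xbar \<longleftrightarrow>
     (\<exists>U J. open U \<and> xbar \<in> U \<and>
        (\<forall>x\<in>U. (h has_derivative (\<lambda>d. J x *v d)) (at x)) \<and> continuous_on U J)"

definition F_Lip :: "real^'n \<Rightarrow> (real^'n \<Rightarrow> real^'m) set" where
  "F_Lip xbar = {h. h xbar = 0 \<and> lipschitz_around h xbar}"

definition F_ss :: "real^'n \<Rightarrow> (real^'n \<Rightarrow> real^'m) set" where
  "F_ss xbar = {h. h xbar = 0 \<and> semismooth_at h xbar}"

definition F_C1 :: "real^'n \<Rightarrow> (real^'n \<Rightarrow> real^'m) set" where
  "F_C1 xbar = {h. h xbar = 0 \<and> C1_around h xbar}"

text \<open>The first argument is the class of perturbations, as a function of the reference point.\<close>

definition rad_SR ::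
    "(real^'n \<Rightarrow> (real^'n \<Rightarrow> real^'m) set) \<Rightarrow> (real^'n \<Rightarrow> (real^'m) set) \<Rightarrow>
     real^'n \<Rightarrow> real^'m \<Rightarrow> ereal" where
  "rad_SR P F xbar ybar =
     Inf {lip_modulus h xbar | h.
            h \<in> P xbar \<and> \<not> metrically_subregular (\<lambda>x. {y + h x | y. y \<in> F x}) xbar ybar}"

end

theory Submission
  imports Defs
begin

text \<open>
  The corollary is an exact description of how large a perturbation must be in order to destroy
  subregularity, followed by an estimate of that size. Consider a directional normal
  \<open>(ustar, - vstar)\<close> of the graph in direction \<open>(u, v)\<close> with \<open>norm u = norm vstar = 1\<close>, and say that a
  linear map \<open>A\<close> fits it if \<open>A u = - v\<close> and the adjoint of \<open>A\<close> maps \<open>vstar\<close> to \<open>- ustar\<close>.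
  The radii for semismooth and for continuously differentiable perturbations are both equal to the
  infimum of the operator norms of fitting maps, taken over all such normals.

  \<^item> If \<open>A\<close> fits, then \<open>C1_perturbation_destroys_subregularity\<close> gives a \<open>C\<^sup>1\<close> function \<open>h\<close> with derivative \<open>A\<close> at
    the reference point for which \<open>F + h\<close> is not subregular. The normal is a limit of regular normals
    \<open>(p, - q)\<close> at graph points \<open>(a, b)\<close> that tend to the reference point in direction \<open>(u, v)\<close>. The two
    conditions on \<open>A\<close> say that \<open>A\<close> is correct to first order at each of them, so bumps of small slope
    suffice to make \<open>h a\<close> nearly equal to \<open>ybar - b\<close> while the adjoint of the derivative of \<open>h\<close> at \<open>a\<close>
    maps \<open>q\<close> exactly to \<open>- p\<close>. The normal inequality then keeps all solutions away from \<open>a\<close>,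
    at a distance that is large compared with the residual at \<open>a\<close>.

  \<^item> Conversely let \<open>F + h\<close> fail to be subregular, with \<open>h\<close> semismooth and Lipschitz modulus below \<open>L\<close>.
    Then \<open>semismooth_not_subregular_imp_critical_direction\<close> gives a normal and a fitting map of norm at
    most \<open>L\<close>. Near a point where the subregularity estimate fails one minimises the residual of \<open>F + h\<close>,
    with a quadratic penalty and with \<open>h\<close> replaced by its average \<open>g\<close> over a tiny ball. The average is
    differentiable, so the minimiser carries a regular normal \<open>(p, - w)\<close> in which \<open>p\<close> is nearly
    minus the adjoint of \<open>Dg\<close> applied to \<open>w\<close>. Since \<open>Dg\<close> is an average of derivatives of \<open>h\<close>,
    semismoothness forces \<open>Dg u\<close> to tend to the directional derivative of \<open>h\<close> along \<open>u\<close>, and the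
    latter is \<open>- v\<close> because the residuals are of smaller order. A limit of the maps \<open>Dg\<close> fits.

  That averages of derivatives are meaningful is Rademacher's theorem, which is proved first: on lines
  by a Vitali covering argument, then in every direction by Tonelli's theorem.

  It remains to compare fitting maps with \<open>rg_circ\<close>. A fitting map exists exactly when
  \<open>ustar \<bullet> u = vstar \<bullet> v\<close>. In this case there is one of rank at most two whose
  Frobenius norm is the square root in \<open>rg_circ\<close>, which gives the upper bounds; and every fitting map has norm
  at least \<open>max (norm ustar) (norm v)\<close>, which is at least that square root divided by \<open>sqrt 2\<close>.
\<close>

section \<open>Lipschitz functions on the line are differentiable almost everywhere\<close>

lemma lmeasurable_outer_open:
  fixes S :: "'a::euclidean_space set"
  assumes "S \<in> lmeasurable" "e > 0"
  obtains T where "open T" "S \<subseteq> T" "T \<in> lmeasurable" "measure lebesgue T < measure lebesgue S + e"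
proof -
  obtain T where T: "open T" "S \<subseteq> T" "T - S \<in> lmeasurable" "emeasure lebesgue (T - S) < ennreal e"
    using sets_lebesgue_outer_open[of S e] assms by (metis fmeasurableD)
  have "T = S \<union> (T - S)" using T by auto
  then have TM: "T \<in> lmeasurable" using T assms by (metis fmeasurable.Un)
  have "measure lebesgue (T - S) < e"
    using T(3,4) assms(2) by (simp add: emeasure_eq_measure2 ennreal_less_iff)
  moreover have "measure lebesgue (T - S) = measure lebesgue T - measure lebesgue S"
    using T TM assms by (simp add: measurable_measure_Diff fmeasurableD)
  ultimately show ?thesis using that T TM by force
qed

text \<open>
  The intervals on which the increment of \<open>f\<close> is at most \<open>a\<close> times the length form a Vitali
  cover of \<open>E\<close>. A disjoint subfamily covers \<open>E\<close> up to a null set; its image has measure at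
  most \<open>a\<close> times the total length, and the Lipschitz map \<open>f\<close> sends the uncovered null set to
  a null set.
\<close>

lemma Vitali_image_bound:
  fixes f :: "real \<Rightarrow> real"
  assumes "mono f" and lip: "L-lipschitz_on UNIV f"
    and "open G" "G \<in> lmeasurable" "E \<subseteq> G" "a > 0"
    and slope: "\<And>x d. \<lbrakk>x \<in> E; d > 0\<rbrakk> \<Longrightarrow>
      \<exists>p q. p \<le> x \<and> x \<le> q \<and> p < q \<and> q - p < d \<and> f q - f p < a * (q - p)"
  shows "\<exists>T\<in>lmeasurable. f ` E \<subseteq> T \<and> measure lebesgue T \<le> a * measure lebesgue G"
proof -
  let ?c = "\<lambda>i::real\<times>real. (fst i + snd i) / 2" and ?r = "\<lambda>i::real\<times>real. (snd i - fst i) / 2"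
  define K where "K = {(p,q). p < q \<and> {p..q} \<subseteq> G \<and> f q - f p < a * (q - p)}"
  have ball: "cball (?c i) (?r i) = {fst i..snd i}" for i
    by (simp add: cball_eq_atLeastAtMost field_simps)
  obtain C where C: "countable C" "C \<subseteq> K"
     "pairwise (\<lambda>i j. disjnt (cball (?c i) (?r i)) (cball (?c j) (?r j))) C"
     "negligible (E - (\<Union>i \<in> C. cball (?c i) (?r i)))"
  proof (rule Vitali_covering_theorem_cballs[of K ?r E ?c])
    show "0 < ?r i" if "i \<in> K" for i using that by (auto simp: K_def)
    show "\<exists>i. i \<in> K \<and> x \<in> cball (?c i) (?r i) \<and> ?r i < d" if "x \<in> E" "0 < d" for x d
    proof -
      obtain e where e: "e > 0" "ball x e \<subseteq> G"
        using \<open>open G\<close> \<open>E \<subseteq> G\<close> \<open>x \<in> E\<close> by (meson openE subsetD)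
      obtain p q where pq: "p \<le> x" "x \<le> q" "p < q" "q - p < min d e" "f q - f p < a * (q - p)"
        using slope[OF \<open>x \<in> E\<close>, of "min d e"] \<open>d > 0\<close> e by (meson min_less_iff_conj)
      have "{p..q} \<subseteq> ball x e" using pq by (auto simp: dist_real_def)
      with pq e have "(p,q) \<in> K" by (auto simp: K_def)
      with pq \<open>d > 0\<close> show ?thesis by (intro exI[of _ "(p,q)"]) (simp only: ball, auto)
    qed
  qed blast
  define N where "N = E - (\<Union>i\<in>C. {fst i..snd i})"
  define U where "U = (\<Union>i\<in>C. {f (fst i)..f (snd i)})"
  have "negligible N" using C(4) unfolding ball N_def .
  then have neg: "negligible (f ` N)"
  proof (rule negligible_locally_Lipschitz_image[OF order_refl])
    fix x show "\<exists>T B. open T \<and> x \<in> T \<and> (\<forall>y\<in>N \<inter> T. norm (f y - f x) \<le> B * norm (y - x))"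
      using lip by (intro exI[of _ UNIV] exI[of _ L]) (auto simp: lipschitz_on_def dist_norm)
  qed
  have fin: "measure lebesgue (\<Union>i\<in>I. {f (fst i)..f (snd i)}) \<le> a * measure lebesgue G"
    if "I \<subseteq> C" "finite I" for I
  proof -
    have IK: "fst i < snd i \<and> {fst i..snd i} \<subseteq> G \<and> f (snd i) - f (fst i) < a * (snd i - fst i)"
      if "i \<in> I" for i
    proof -
      have "i \<in> K" using that \<open>I \<subseteq> C\<close> C(2) by auto
      then show ?thesis by (cases i) (simp add: K_def)
    qed
    have "measure lebesgue (\<Union>i\<in>I. {f (fst i)..f (snd i)})
        \<le> (\<Sum>i\<in>I. measure lebesgue {f (fst i)..f (snd i)})"
      by (rule measure_UNION_le) (auto simp: \<open>finite I\<close>)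
    also have "\<dots> \<le> (\<Sum>i\<in>I. a * (snd i - fst i))"
      using IK \<open>mono f\<close> by (intro sum_mono) (force simp: monoD less_imp_le)
    also have "\<dots> = a * (\<Sum>i\<in>I. measure lebesgue {fst i..snd i})"
      using IK by (auto simp: sum_distrib_left less_imp_le intro!: sum.cong)
    also have "(\<Sum>i\<in>I. measure lebesgue {fst i..snd i}) = measure lebesgue (\<Union>i\<in>I. {fst i..snd i})"
    proof (rule measure_negligible_finite_Union_image[symmetric])
      show "pairwise (\<lambda>i j. negligible ({fst i..snd i} \<inter> {fst j..snd j})) I"
        using pairwise_subset[OF C(3) \<open>I \<subseteq> C\<close>] unfolding ball
        by (auto simp: pairwise_def disjnt_def)
    qed (use \<open>finite I\<close> in auto)
    also have "\<dots> \<le> measure lebesgue G"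
      using IK assms by (intro measure_mono_fmeasurable) (auto intro!: sets.finite_UN \<open>finite I\<close>)
    finally show ?thesis using \<open>a > 0\<close> by auto
  qed
  have U: "U \<in> lmeasurable" unfolding U_def
    by (rule fmeasurable_UN_bound[OF C(1) _ fin]) auto
  have mU: "measure lebesgue U \<le> a * measure lebesgue G" unfolding U_def
    by (rule measure_UN_bound[OF C(1) _ fin]) auto
  show ?thesis
  proof (intro bexI conjI)
    show "f ` E \<subseteq> f ` N \<union> U"
    proof
      fix y assume "y \<in> f ` E"
      then obtain x where x: "x \<in> E" "y = f x" by blast
      show "y \<in> f ` N \<union> U"
      proof (cases "x \<in> N")
        case False
        then obtain i where "i \<in> C" "fst i \<le> x" "x \<le> snd i" using x by (auto simp: N_def)
        then have "y \<in> U" unfolding U_def x using monoD[OF \<open>mono f\<close>] by auto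
        then show ?thesis ..
      qed (use x in blast)
    qed
    show "measure lebesgue (f ` N \<union> U) \<le> a * measure lebesgue G"
      using mU measure_Un_null_set[of U lebesgue "f ` N"] U neg
      by (simp add: Un_commute fmeasurableD negligible_iff_null_sets)
    show "f ` N \<union> U \<in> lmeasurable"
      using U neg by (simp add: fmeasurable.Un negligible_imp_measurable)
  qed
qed

text \<open>
  Slopes below \<open>a\<close> shrink outer measure by the factor \<open>a\<close>. Slopes above \<open>b\<close> of \<open>f\<close> are
  slopes below \<open>1/b\<close> of the inverse function, which therefore shrinks the image by \<open>1/b\<close>.
  Going there and back shrinks the outer measure of \<open>E\<close> by \<open>a/b < 1\<close>, so it is zero. The
  lower bound on the increments of \<open>f\<close> makes the inverse exist and be Lipschitz.
\<close>

lemma negligible_oscillating_slopes: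
  fixes f :: "real \<Rightarrow> real"
  assumes lip: "L-lipschitz_on UNIV f" and low: "\<And>p q. p \<le> q \<Longrightarrow> q - p \<le> f q - f p"
    and "0 < a" "a < b"
    and lower: "\<And>x d. \<lbrakk>x \<in> E; d > 0\<rbrakk> \<Longrightarrow>
      \<exists>p q. p \<le> x \<and> x \<le> q \<and> p < q \<and> q - p < d \<and> f q - f p < a * (q - p)"
    and upper: "\<And>x d. \<lbrakk>x \<in> E; d > 0\<rbrakk> \<Longrightarrow>
      \<exists>p q. p \<le> x \<and> x \<le> q \<and> p < q \<and> q - p < d \<and> f q - f p > b * (q - p)"
  shows "negligible E"
proof -
  have "negligible (E \<inter> cbox (-k) k)" for k :: real
  proof -
    define B where "B = E \<inter> cbox (-k) k"
    define S where "S = {measure lebesgue G |G. open G \<and> G \<in> lmeasurable \<and> B \<subseteq> G}"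
    \<comment> \<open>The number \<open>m\<close> is the outer measure of the bounded piece \<open>B\<close>.\<close>
    define m where "m = Inf S"
    have ne: "S \<noteq> {}" unfolding S_def B_def
      by (auto intro!: exI[of _ "box (-k-1) (k+1)"])
    have bdd: "bdd_below S" unfolding S_def by (auto intro!: bdd_belowI[of _ 0])
    have m0: "m \<ge> 0" unfolding m_def by (rule cInf_greatest[OF ne]) (auto simp: S_def)
    have outer: "m \<le> measure lebesgue T" if T: "T \<in> lmeasurable" "B \<subseteq> T" for T
    proof (rule field_le_epsilon)
      fix e :: real assume "e > 0"
      then obtain G where G: "open G" "T \<subseteq> G" "G \<in> lmeasurable" "measure lebesgue G < measure lebesgue T + e"
        using lmeasurable_outer_open[OF T(1) \<open>e > 0\<close>] by metis
      then have "measure lebesgue G \<in> S" unfolding S_def using T by blast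
      then have "m \<le> measure lebesgue G" unfolding m_def
        using bdd by (rule cInf_lower)
      with G show "m \<le> measure lebesgue T + e" by simp
    qed
    have mono: "mono f" by (rule monoI) (use low in force)
    have strict: "f p < f q" if "p < q" for p q using low[of p q] that by linarith
    have cont: "continuous_on UNIV f" using lip lipschitz_on_continuous_on by blast
    have surj: "\<exists>x. f x = y" for y
    proof -
      have 1: "f (- \<bar>y - f 0\<bar>) \<le> y" using low[of "- \<bar>y - f 0\<bar>" 0] by linarith
      have 2: "y \<le> f \<bar>y - f 0\<bar>" using low[of 0 "\<bar>y - f 0\<bar>"] by linarith
      from IVT'[OF 1 2 _ continuous_on_subset[OF cont subset_UNIV]] show ?thesis by auto
    qed
    have inj: "inj f" by (metis strict injI linorder_less_linear order_less_irrefl)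
    define g where "g = inv f"
    have fg: "f (g y) = y" for y unfolding g_def using surj by (metis f_inv_into_f rangeI)
    have gf: "g (f x) = x" for x unfolding g_def using inj by simp
    have gmono: "mono g" by (rule monoI) (metis fg strict not_le order.asym order_less_le_trans)
    have glip: "1-lipschitz_on UNIV g"
    proof (rule lipschitz_onI)
      fix x y show "dist (g x) (g y) \<le> 1 * dist x y"
        using low[of "g x" "g y"] low[of "g y" "g x"] unfolding fg dist_real_def
        by (cases "g x \<le> g y") auto
    qed simp
    have "b > 0" using assms by linarith
    have est: "m \<le> (a * (m + e) + e) / b" if "e > 0" for e
    proof -
      obtain G where G: "open G" "G \<in> lmeasurable" "B \<subseteq> G" "measure lebesgue G < m + e"
      proof -
        have "Inf S < m + e" using \<open>e > 0\<close> by (simp add: m_def)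
        from cInf_lessD[OF ne this] show ?thesis using that unfolding S_def by blast
      qed
      obtain T where T: "T \<in> lmeasurable" "f ` B \<subseteq> T" "measure lebesgue T \<le> a * measure lebesgue G"
        using Vitali_image_bound[OF mono lip G(1,2,3) \<open>a > 0\<close>] lower unfolding B_def by auto
      obtain T' where T': "open T'" "T \<subseteq> T'" "T' \<in> lmeasurable" "measure lebesgue T' < measure lebesgue T + e"
        using lmeasurable_outer_open[OF T(1) \<open>e > 0\<close>] by metis
      have "\<exists>V\<in>lmeasurable. g ` (f ` B) \<subseteq> V \<and> measure lebesgue V \<le> (1/b) * measure lebesgue T'"
      proof (rule Vitali_image_bound[OF gmono glip T'(1,3)])
        fix y d :: real assume "y \<in> f ` B" "d > 0"
        then obtain x where x: "x \<in> E" "y = f x" by (auto simp: B_def)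
        have L0: "L \<ge> 0" using lip lipschitz_on_nonneg by blast
        obtain p q where pq: "p \<le> x" "x \<le> q" "p < q" "q - p < d / (L+1)" "f q - f p > b * (q - p)"
          using upper[OF x(1), of "d/(L+1)"] L0 \<open>d > 0\<close> by auto
        have "f q - f p \<le> L * (q - p)"
          using lipschitz_onD[OF lip, of q p] pq strict[of p q] by (simp add: dist_real_def)
        also have "\<dots> \<le> (L+1) * (q-p)" using pq by (simp add: algebra_simps)
        also have "\<dots> < d" using pq L0 by (simp add: field_simps)
        finally have "f q - f p < d" .
        then show "\<exists>p q. p \<le> y \<and> y \<le> q \<and> p < q \<and> q - p < d \<and> g q - g p < 1/b * (q - p)"
          using pq strict \<open>b > 0\<close> x monoD[OF mono]
          by (intro exI[of _ "f p"] exI[of _ "f q"]) (auto simp: gf field_simps)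
      qed (use T T' \<open>b > 0\<close> in auto)
      then obtain V where V: "V \<in> lmeasurable" "B \<subseteq> V" "measure lebesgue V \<le> (1/b) * measure lebesgue T'"
        by (auto simp: image_image gf)
      have "a * measure lebesgue G \<le> a * (m + e)"
        using G(4) \<open>a > 0\<close> by (intro mult_left_mono) linarith+
      then have "measure lebesgue T' \<le> a * (m + e) + e"
        using T(3) T'(4) by linarith
      then have "measure lebesgue V \<le> (a * (m + e) + e) / b"
        using V(3) \<open>b > 0\<close> by (simp add: field_simps)
      with outer[OF V(1,2)] show ?thesis by linarith
    qed
    have "m \<le> 0"
    proof (rule ccontr)
      assume "\<not> m \<le> 0"
      then have "m > 0" by simp
      define e where "e = (b - a) * m / (2 * (a + 1))"
      have e: "e > 0" using \<open>m > 0\<close> assms by (simp add: e_def)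
      have "e * (a + 1) = (b - a) * m / 2" using assms(3) by (simp add: e_def field_simps)
      then have "m * b \<le> a * m + (b - a) * m / 2" using est[OF e] \<open>b > 0\<close> by (simp add: field_simps)
      moreover have "(b - a) * m > 0" using \<open>m > 0\<close> assms by simp
      moreover have "(b - a) * m = m * b - a * m" by (simp add: algebra_simps)
      ultimately show False by linarith
    qed
    then have "m = 0" using m0 by simp
    show "negligible B" unfolding negligible_outer_le
    proof (intro allI impI)
      fix e :: real assume "e > 0"
      then have "Inf S < e" using \<open>m = 0\<close> by (simp add: m_def)
      from cInf_lessD[OF ne this] obtain G where "G \<in> lmeasurable" "B \<subseteq> G" "measure lebesgue G < e"
        unfolding S_def by blast
      then show "\<exists>T. B \<subseteq> T \<and> T \<in> lmeasurable \<and> measure lebesgue T \<le> e"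
        using less_imp_le by blast
    qed
  qed
  then have "negligible (\<Union>k::nat. E \<inter> cbox (- real k) (real k))"
    by (intro negligible_countable_Union) auto
  moreover have "E \<subseteq> (\<Union>k::nat. E \<inter> cbox (- real k) (real k))"
  proof
    fix x assume "x \<in> E"
    obtain k :: nat where "\<bar>x\<bar> \<le> real k" using real_arch_simple by blast
    with \<open>x \<in> E\<close> show "x \<in> (\<Union>k::nat. E \<inter> cbox (- real k) (real k))" by (auto intro!: exI[of _ k])
  qed
  ultimately show ?thesis using negligible_subset by blast
qed

text \<open>
  Where the difference quotient does not converge, two rationals separate its lower from its
  upper limit; there are countably many such pairs, and each yields a null set by the
  oscillation lemma.
\<close>

lemma Lipschitz_real_quotient_converges:
  fixes f :: "real \<Rightarrow> real"
  assumes lip: "L-lipschitz_on UNIV f"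
  shows "negligible {x. \<nexists>l. ((\<lambda>s. (f (x + s) - f x) / s) \<longlongrightarrow> l) (at 0)}"
proof -
  \<comment> \<open>Adding a linear function makes all slopes at least 1, as the oscillation lemma
    requires.\<close>
  define F where "F = (\<lambda>x. f x + (L + 1) * x)"
  have L0: "L \<ge> 0" using lip lipschitz_on_nonneg by blast
  have fL: "\<bar>f p - f q\<bar> \<le> L * \<bar>p - q\<bar>" for p q
    using lipschitz_onD[OF lip, of p q] by (simp add: dist_real_def)
  have low: "q - p \<le> F q - F p" if "p \<le> q" for p q
    using fL[of p q] that by (simp add: F_def algebra_simps)
  have FL: "(2*L+1)-lipschitz_on UNIV F"
  proof (rule lipschitz_onI)
    fix x y
    have "\<bar>F x - F y\<bar> = \<bar>(f x - f y) + (L+1) * (x - y)\<bar>" by (simp add: F_def algebra_simps)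
    also have "\<dots> \<le> L * \<bar>x - y\<bar> + (L+1) * \<bar>x - y\<bar>"
      using fL[of x y] abs_triangle_ineq[of "f x - f y" "(L+1) * (x-y)"] L0 by (simp add: abs_mult)
    finally show "dist (F x) (F y) \<le> (2 * L + 1) * dist x y" by (simp add: dist_real_def algebra_simps)
  qed (use L0 in simp)
  define Q where "Q = (\<lambda>x s. (F (x + s) - F x) / s)"
  define lo where "lo = (\<lambda>a x. \<forall>d>0. \<exists>p q. p \<le> x \<and> x \<le> q \<and> p < q \<and> q - p < d \<and> F q - F p < a * (q - p))"
  define hi where "hi = (\<lambda>b x. \<forall>d>0. \<exists>p q. p \<le> x \<and> x \<le> q \<and> p < q \<and> q - p < d \<and> F q - F p > b * (q - p))"
  have "negligible (\<Union>(a,b)\<in>{(a,b). a \<in> \<rat> \<and> b \<in> \<rat> \<and> 0 < a \<and> a < b}. {x. lo a x \<and> hi b x})"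
  proof (rule negligible_countable_Union, safe)
    have "{(a,b). a \<in> \<rat> \<and> b \<in> \<rat> \<and> 0 < a \<and> a < b} \<subseteq> (\<rat>::real set) \<times> (\<rat>::real set)" by auto
    then show "countable ((\<lambda>x. case x of (a, b) \<Rightarrow> {x. lo a x \<and> hi b x}) ` {(a,b). a \<in> \<rat> \<and> b \<in> \<rat> \<and> 0 < a \<and> a < b})"
      using countable_rat by (meson countable_SIGMA countable_image countable_subset)
    fix a b :: real assume "0 < a" "a < b"
    show "negligible {x. lo a x \<and> hi b x}"
      by (rule negligible_oscillating_slopes[OF FL low \<open>0 < a\<close> \<open>a < b\<close>]) (auto simp: lo_def hi_def)
  qed
  moreover have "{x. \<nexists>l. ((\<lambda>s. (f (x + s) - f x) / s) \<longlongrightarrow> l) (at 0)} \<subseteq>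
    (\<Union>(a,b)\<in>{(a,b). a \<in> \<rat> \<and> b \<in> \<rat> \<and> 0 < a \<and> a < b}. {x. lo a x \<and> hi b x})"
  proof
    fix x assume x: "x \<in> {x. \<nexists>l. ((\<lambda>s. (f (x + s) - f x) / s) \<longlongrightarrow> l) (at 0)}"
    define l u where "l = Liminf (at 0) (\<lambda>s. ereal (Q x s))" and "u = Limsup (at 0) (\<lambda>s. ereal (Q x s))"
    have ev: "\<forall>\<^sub>F s in at 0. 1 \<le> Q x s \<and> Q x s \<le> 2*L+1"
      unfolding eventually_at_filter
    proof (intro always_eventually allI impI)
      fix s :: real assume "s \<noteq> 0"
      have "\<bar>F (x+s) - F x\<bar> \<le> (2*L+1) * \<bar>s\<bar>"
        using lipschitz_onD[OF FL, of "x+s" x] by (simp add: dist_real_def)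
      then show "1 \<le> Q x s \<and> Q x s \<le> 2*L+1"
        using low[of x "x+s"] low[of "x+s" x] \<open>s \<noteq> 0\<close> unfolding Q_def
        by (cases "s > 0") (auto simp: field_simps)
    qed
    have l1: "1 \<le> l" unfolding l_def
      by (rule Liminf_bounded) (use ev in \<open>auto elim: eventually_mono\<close>)
    have u1: "u \<le> ereal (2*L+1)" unfolding u_def
      by (rule Limsup_bounded) (use ev in \<open>auto elim: eventually_mono\<close>)
    have lu: "l \<le> u" unfolding l_def u_def by (rule Liminf_le_Limsup) simp
    have "l \<noteq> u"
    proof
      assume eq: "l = u"
      then obtain c where c: "l = ereal c" using l1 u1 by (cases l) auto
      have "((\<lambda>s. ereal (Q x s)) \<longlongrightarrow> ereal c) (at 0)"
        using eq c unfolding l_def u_def by (intro Liminf_eq_Limsup) auto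
      then have "(Q x \<longlongrightarrow> c) (at 0)" by simp
      then have "((\<lambda>s. Q x s - (L+1)) \<longlongrightarrow> c - (L+1)) (at 0)" by (intro tendsto_intros)
      moreover have "\<forall>\<^sub>F s in at 0. Q x s - (L+1) = (f (x + s) - f x) / s"
        unfolding eventually_at_filter
        by (intro always_eventually) (auto simp: Q_def F_def field_simps)
      ultimately have "((\<lambda>s. (f (x + s) - f x) / s) \<longlongrightarrow> c - (L+1)) (at 0)"
        by (rule Lim_transform_eventually)
      with x show False by auto
    qed
    with lu have "l < u" by simp
    then obtain a where a: "l < ereal (of_rat a)" "ereal (of_rat a) < u"
      using ereal_dense3 by blast
    then obtain b where b: "ereal (of_rat a) < ereal (of_rat b)" "ereal (of_rat b) < u"
      using ereal_dense3 by blast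
    have fl: "\<exists>\<^sub>F s in at 0. Q x s < of_rat a"
    proof (rule ccontr)
      assume "\<not> ?thesis"
      then have "ereal (of_rat a) \<le> l" unfolding l_def not_frequently
        by (intro Liminf_bounded) (auto elim: eventually_mono)
      with a show False by simp
    qed
    have fu: "\<exists>\<^sub>F s in at 0. Q x s > of_rat b"
    proof (rule ccontr)
      assume "\<not> ?thesis"
      then have "u \<le> ereal (of_rat b)" unfolding u_def not_frequently
        by (intro Limsup_bounded) (auto elim: eventually_mono)
      with b show False by simp
    qed
    have straddle: "\<exists>p q. p \<le> x \<and> x \<le> q \<and> p < q \<and> q - p < d \<and> F q - F p = Q x s * (q - p)"
      if "s \<noteq> 0" "\<bar>s\<bar> < d" for s d
    proof (cases "s > 0")
      case True
      with that show ?thesis unfolding Q_def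
        by (intro exI[of _ x] exI[of _ "x+s"]) simp
    next
      case False
      with that show ?thesis unfolding Q_def
        by (intro exI[of _ "x+s"] exI[of _ x]) (simp add: field_simps)
    qed
    have "lo (of_rat a) x" unfolding lo_def
    proof (intro allI impI)
      fix d :: real assume "d > 0"
      then obtain s where s: "s \<noteq> 0" "\<bar>s\<bar> < d" "Q x s < of_rat a"
        using fl unfolding frequently_at by (auto simp: dist_real_def)
      obtain p q where pq: "p \<le> x" "x \<le> q" "p < q" "q - p < d" "F q - F p = Q x s * (q - p)"
        using straddle[OF s(1,2)] by blast
      have "Q x s * (q - p) < of_rat a * (q - p)" using s(3) pq(3) by (intro mult_strict_right_mono) auto
      with pq show "\<exists>p q. p \<le> x \<and> x \<le> q \<and> p < q \<and> q - p < d \<and> F q - F p < of_rat a * (q - p)"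
        by (intro exI[of _ p] exI[of _ q]) simp
    qed
    moreover have "hi (of_rat b) x" unfolding hi_def
    proof (intro allI impI)
      fix d :: real assume "d > 0"
      then obtain s where s: "s \<noteq> 0" "\<bar>s\<bar> < d" "Q x s > of_rat b"
        using fu unfolding frequently_at by (auto simp: dist_real_def)
      obtain p q where pq: "p \<le> x" "x \<le> q" "p < q" "q - p < d" "F q - F p = Q x s * (q - p)"
        using straddle[OF s(1,2)] by blast
      have "of_rat b * (q - p) < Q x s * (q - p)" using s(3) pq(3) by (intro mult_strict_right_mono) auto
      with pq show "\<exists>p q. p \<le> x \<and> x \<le> q \<and> p < q \<and> q - p < d \<and> F q - F p > of_rat b * (q - p)"
        by (intro exI[of _ p] exI[of _ q]) simp
    qed
    moreover have "(0::real) < of_rat a" "of_rat a < (of_rat b :: real)"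
    proof -
      have "1 < ereal (of_rat a)" using l1 a(1) by (rule le_less_trans)
      then have "1 < (of_rat a :: real)" by simp
      then show "(0::real) < of_rat a" by linarith
    qed (use b in simp)
    ultimately show "x \<in> (\<Union>(a,b)\<in>{(a,b). a \<in> \<rat> \<and> b \<in> \<rat> \<and> 0 < a \<and> a < b}. {x. lo a x \<and> hi b x})"
      by (intro UN_I[of "(of_rat a, of_rat b)"]) auto
  qed
  ultimately show ?thesis by (rule negligible_subset)
qed

section \<open>Rademacher's theorem\<close>

text \<open>
  The Cauchy form exhibits the set of convergence of a family of continuous functions as a
  countable intersection of countable unions of closed sets; this is how its measurability
  is obtained.
\<close>

lemma tendsto_at_0_iff_Cauchy:
  fixes q :: "real \<Rightarrow> real"
  shows "(\<exists>l. (q \<longlongrightarrow> l) (at 0)) \<longleftrightarrow>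
    (\<forall>k::nat. \<exists>j::nat. \<forall>s t. s \<noteq> 0 \<and> t \<noteq> 0 \<and> \<bar>s\<bar> < inverse (real (Suc j)) \<and> \<bar>t\<bar> < inverse (real (Suc j))
      \<longrightarrow> dist (q s) (q t) \<le> inverse (real (Suc k)))" (is "?L \<longleftrightarrow> ?R")
proof
  assume ?L
  then obtain l where l: "(q \<longlongrightarrow> l) (at 0)" by blast
  show ?R
  proof
    fix k :: nat
    have "\<forall>\<^sub>F s in at 0. dist (q s) l < inverse (real (Suc k)) / 2"
      using l by (rule tendstoD) simp
    then obtain d where d: "d > 0" "\<And>s. s \<noteq> 0 \<Longrightarrow> \<bar>s\<bar> < d \<Longrightarrow> dist (q s) l < inverse (real (Suc k)) / 2"
      unfolding eventually_at by (auto simp: dist_real_def)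
    obtain j where j: "inverse (real (Suc j)) < d" using reals_Archimedean d(1) by blast
    show "\<exists>j::nat. \<forall>s t. s \<noteq> 0 \<and> t \<noteq> 0 \<and> \<bar>s\<bar> < inverse (real (Suc j)) \<and> \<bar>t\<bar> < inverse (real (Suc j))
      \<longrightarrow> dist (q s) (q t) \<le> inverse (real (Suc k))"
    proof (intro exI allI impI)
      fix s t assume st: "s \<noteq> 0 \<and> t \<noteq> 0 \<and> \<bar>s\<bar> < inverse (real (Suc j)) \<and> \<bar>t\<bar> < inverse (real (Suc j))"
      then have "dist (q s) l < inverse (real (Suc k)) / 2" "dist (q t) l < inverse (real (Suc k)) / 2"
        using j d(2)[of s] d(2)[of t] by linarith+
      then show "dist (q s) (q t) \<le> inverse (real (Suc k))"
        using dist_triangle2[of "q s" "q t" l] by linarith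
    qed
  qed
next
  assume R: ?R
  let ?s = "\<lambda>n::nat. inverse (real (Suc n))"
  have "Cauchy (\<lambda>n. q (inverse (real (Suc (Suc n)))))" (is "Cauchy ?q")
    unfolding Cauchy_def
  proof (intro allI impI)
    fix e :: real assume "e > 0"
    then obtain k where k: "?s k < e" using reals_Archimedean by blast
    obtain j where j: "\<And>s t. s \<noteq> 0 \<and> t \<noteq> 0 \<and> \<bar>s\<bar> < ?s j \<and> \<bar>t\<bar> < ?s j \<Longrightarrow> dist (q s) (q t) \<le> ?s k"
      using R by metis
    show "\<exists>M. \<forall>m\<ge>M. \<forall>n\<ge>M. dist (?q m) (?q n) < e"
    proof (intro exI[of _ j] allI impI)
      fix m n assume "m \<ge> j" "n \<ge> j"
      then have "dist (?q m) (?q n) \<le> ?s k" by (intro j) auto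
      with k show "dist (?q m) (?q n) < e" by simp
    qed
  qed
  then obtain l where l: "?q \<longlonglongrightarrow> l" using Cauchy_convergent convergentD by blast
  show ?L
  proof (intro exI tendstoI)
    fix e :: real assume "e > 0"
    then obtain k where k: "?s k < e" using reals_Archimedean by blast
    obtain j where j: "\<And>s t. s \<noteq> 0 \<and> t \<noteq> 0 \<and> \<bar>s\<bar> < ?s j \<and> \<bar>t\<bar> < ?s j \<Longrightarrow> dist (q s) (q t) \<le> ?s k"
      using R by metis
    show "\<forall>\<^sub>F s in at 0. dist (q s) l < e"
      unfolding eventually_at
    proof (intro exI conjI ballI impI)
      show "?s j > 0" by simp
      fix s :: real assume s: "s \<noteq> 0 \<and> dist s 0 < ?s j"
      have "(\<lambda>n. dist (q s) (?q n)) \<longlonglongrightarrow> dist (q s) l" by (intro tendsto_intros l)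
      then have "dist (q s) l \<le> ?s k"
      proof (rule LIMSEQ_le_const2)
        show "\<exists>N. \<forall>n\<ge>N. dist (q s) (?q n) \<le> ?s k"
          using s by (intro exI[of _ j] allI impI j) (auto simp: dist_real_def)
      qed
      with k show "dist (q s) l < e" by simp
    qed
  qed
qed

text \<open>
  At \<open>s = 0\<close> the value is 0, so the Lipschitz bound on quotients holds for all \<open>s\<close>.
\<close>

definition dquot :: "('a::euclidean_space \<Rightarrow> real) \<Rightarrow> 'a \<Rightarrow> 'a \<Rightarrow> real \<Rightarrow> real" where
  "dquot h d x s = (h (x + s *\<^sub>R d) - h x) / s"

lemma abs_dquot_le:
  assumes "L-lipschitz_on UNIV h" shows "\<bar>dquot h d x s\<bar> \<le> L * norm d"
proof (cases "s = 0")
  case False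
  have "\<bar>h (x + s *\<^sub>R d) - h x\<bar> \<le> L * (\<bar>s\<bar> * norm d)"
    using lipschitz_onD[OF assms, of "x + s *\<^sub>R d" x] by (simp add: dist_norm dist_real_def)
  with False show ?thesis unfolding dquot_def by (simp add: abs_divide field_simps)
next
  case True
  then show ?thesis using lipschitz_on_nonneg[OF assms] by (simp add: dquot_def)
qed

text \<open>
  Every line parallel to \<open>d\<close> meets the exceptional set in a null set. Rather than rotating
  coordinates, one averages the translates of the exceptional set along \<open>d\<close>: by Tonelli and
  translation invariance this average is the measure of the set itself.
\<close>

lemma AE_dquot_converges:
  fixes h :: "'a::euclidean_space \<Rightarrow> real"
  assumes lip: "L-lipschitz_on UNIV h"
  shows "AE x in lborel. \<exists>l. (dquot h d x \<longlongrightarrow> l) (at 0)"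
proof -
  define N where "N = {x. \<nexists>l. (dquot h d x \<longlongrightarrow> l) (at 0)}"
  have cont: "continuous_on UNIV h" using lip lipschitz_on_continuous_on by blast
  have contq: "continuous_on UNIV (\<lambda>x. dquot h d x s)" for s
    unfolding dquot_def
    by (cases "s = 0") (auto intro!: continuous_intros continuous_on_compose2[OF cont])
  have "{x. \<exists>l. (dquot h d x \<longlongrightarrow> l) (at 0)} =
     (\<Inter>k::nat. \<Union>j::nat. \<Inter>(s,t)\<in>{(s,t). s \<noteq> 0 \<and> t \<noteq> 0 \<and> \<bar>s\<bar> < inverse (real (Suc j)) \<and> \<bar>t\<bar> < inverse (real (Suc j))}.
       {x. dist (dquot h d x s) (dquot h d x t) \<le> inverse (real (Suc k))})"
    unfolding tendsto_at_0_iff_Cauchy by blast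
  also have "\<dots> \<in> sets borel"
  proof (rule sets.countable_INT'', simp, simp, rule sets.countable_UN'', simp,
      intro borel_closed closed_INT ballI)
    fix k j :: nat and st :: "real \<times> real"
    show "closed (case st of (s, t) \<Rightarrow> {x. dist (dquot h d x s) (dquot h d x t) \<le> inverse (real (Suc k))})"
      by (cases st) (auto intro!: closed_Collect_le continuous_intros contq)
  qed
  finally have "UNIV - N \<in> sets borel" unfolding N_def by (simp add: Compl_eq_Diff_UNIV[symmetric] Collect_neg_eq[symmetric])
  then have N[measurable]: "N \<in> sets borel" by (metis Diff_Diff_Int Int_UNIV_left sets.compl_sets space_borel)
  have line: "(\<integral>\<^sup>+ s. indicator {0..1} s * indicator N (x + s *\<^sub>R d) \<partial>lborel) = 0" for x
  proof -
    have "(L * norm d)-lipschitz_on UNIV (\<lambda>s::real. h (x + s *\<^sub>R d))"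
    proof (rule lipschitz_onI)
      fix s t :: real
      have "dist (h (x + s *\<^sub>R d)) (h (x + t *\<^sub>R d)) \<le> L * dist (x + s *\<^sub>R d) (x + t *\<^sub>R d)"
        using lipschitz_onD[OF lip] by blast
      also have "dist (x + s *\<^sub>R d) (x + t *\<^sub>R d) = norm d * dist s t"
        by (simp add: dist_norm dist_real_def flip: scaleR_left_diff_distrib)
      finally show "dist (h (x + s *\<^sub>R d)) (h (x + t *\<^sub>R d)) \<le> L * norm d * dist s t"
        by (simp add: mult.assoc)
    qed (simp add: lipschitz_on_nonneg[OF lip])
    from Lipschitz_real_quotient_converges[OF this]
    have "negligible {s. x + s *\<^sub>R d \<in> N}"
      unfolding N_def dquot_def by (simp add: scaleR_left_distrib add.assoc)
    moreover have "{s. x + s *\<^sub>R d \<in> N} \<in> sets borel" by measurable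
    ultimately have "{s. x + s *\<^sub>R d \<in> N} \<in> null_sets lborel"
      by (simp add: negligible_iff_null_sets null_sets_completion_iff)
    then have "AE s in lborel. s \<notin> {s. x + s *\<^sub>R d \<in> N}" by (rule AE_not_in)
    then have "(\<integral>\<^sup>+ s. indicator {0..1} s * indicator N (x + s *\<^sub>R d) \<partial>lborel) = (\<integral>\<^sup>+ (s::real). 0 \<partial>lborel)"
      by (intro nn_integral_cong_AE) (auto elim!: eventually_mono)
    then show ?thesis by simp
  qed
  have trans: "(\<integral>\<^sup>+ x. indicator N (x + c) \<partial>lborel) = emeasure lborel N" for c :: 'a
  proof -
    have "emeasure lborel N = emeasure (distr lborel borel ((+) c)) N" by (simp add: lborel_distr_plus)
    also have "\<dots> = (\<integral>\<^sup>+ x. indicator N x \<partial>(distr lborel borel ((+) c)))" by simp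
    also have "\<dots> = (\<integral>\<^sup>+ x. indicator N (c + x) \<partial>lborel)" by (subst nn_integral_distr) auto
    finally show ?thesis by (simp add: add.commute)
  qed
  have "0 = (\<integral>\<^sup>+ x. (\<integral>\<^sup>+ (s::real). indicator {0..1} s * indicator N (x + s *\<^sub>R d) \<partial>lborel) \<partial>lborel)"
    by (simp add: line)
  also have "\<dots> = (\<integral>\<^sup>+ (s::real). (\<integral>\<^sup>+ x. indicator {0..1} s * indicator N (x + s *\<^sub>R d) \<partial>lborel) \<partial>lborel)"
    by (rule lborel_pair.Fubini') measurable
  also have "\<dots> = (\<integral>\<^sup>+ (s::real). indicator {0..1} s * emeasure lborel N \<partial>lborel)"
    by (simp add: nn_integral_cmult trans)
  also have "\<dots> = emeasure lborel N"
    by (subst nn_integral_multc) auto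
  finally have "N \<in> null_sets lborel" by (simp add: null_sets_def)
  then have "AE x in lborel. x \<notin> N" by (rule AE_not_in)
  then show ?thesis by (auto simp: N_def elim: eventually_mono)
qed

text \<open>
  After scaling, \<open>1 + f\<close> is a nonnegative density, and its measure agrees with Lebesgue
  measure on all boxes. The two measures are then equal, and so are their densities.
\<close>

lemma AE_zero_if_box_integrals_zero:
  fixes f :: "'a::euclidean_space \<Rightarrow> real"
  assumes [measurable]: "f \<in> borel_measurable borel" and bound: "AE x in lborel. \<bar>f x\<bar> \<le> C"
    and zero: "\<And>l u. (\<integral>x. indicator (box l u) x * f x \<partial>lborel) = 0"
  shows "AE x in lborel. f x = 0"
proof -
  define K where "K = \<bar>C\<bar> + 1"
  have K: "K > 0" by (simp add: K_def)
  have bK: "AE x in lborel. \<bar>f x\<bar> \<le> K" using bound by (auto simp: K_def elim!: eventually_mono)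
  \<comment> \<open>Division by \<open>K\<close> keeps the density nonnegative.\<close>
  define g where "g = (\<lambda>x. ennreal (1 + f x / K))"
  have [measurable]: "g \<in> borel_measurable borel" unfolding g_def by measurable
  have "lborel = density lborel g"
  proof (rule lborel_eqI)
    fix l u :: 'a assume lu: "\<And>b. b \<in> Basis \<Longrightarrow> l \<bullet> b \<le> u \<bullet> b"
    have fin: "emeasure lborel (box l u) < \<infinity>" by (simp add: emeasure_lborel_box_eq)
    have int1: "integrable lborel (indicator (box l u) :: 'a \<Rightarrow> real)"
      using fin by (simp add: integrable_indicator_iff)
    have int2: "integrable lborel (\<lambda>x. indicator (box l u) x * f x)"
    proof (rule Bochner_Integration.integrable_bound)
      show "integrable lborel (\<lambda>x. K * indicator (box l u) x :: real)" using int1 by simp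
      show "AE x in lborel. norm (indicator (box l u) x * f x) \<le> norm (K * indicator (box l u) x :: real)"
        using bK K by (auto elim!: eventually_mono split: split_indicator)
    qed measurable
    have "emeasure (density lborel g) (box l u) = (\<integral>\<^sup>+x. g x * indicator (box l u) x \<partial>lborel)"
      by (rule emeasure_density) auto
    also have "\<dots> = (\<integral>\<^sup>+x. ennreal (indicator (box l u) x + indicator (box l u) x * f x / K) \<partial>lborel)"
      by (intro nn_integral_cong) (auto simp: g_def split: split_indicator)
    also have "\<dots> = ennreal (\<integral>x. indicator (box l u) x + indicator (box l u) x * f x / K \<partial>lborel)"
    proof (rule nn_integral_eq_integral)
      show "AE x in lborel. 0 \<le> indicator (box l u) x + indicator (box l u) x * f x / K"
        using bK by eventually_elim (use K in \<open>auto simp: field_simps split: split_indicator\<close>)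
    qed (use int1 int2 in auto)
    also have "(\<integral>x. indicator (box l u) x + indicator (box l u) x * f x / K \<partial>lborel) = measure lborel (box l u)"
      using int1 int2 zero[of l u] by simp
    also have "ennreal (measure lborel (box l u)) = (\<Prod>b\<in>Basis. (u - l) \<bullet> b)"
      using lu by (simp add: measure_lborel_box_eq inner_diff_left)
    finally show "emeasure (density lborel g) (box l u) = (\<Prod>b\<in>Basis. (u - l) \<bullet> b)" .
  qed simp
  then have "density lborel (\<lambda>_. 1) = density lborel g" by (metis density_1)
  then have "AE x in lborel. 1 = g x"
    by (rule sigma_finite_measure.density_unique[rotated -1]) (auto intro: sigma_finite_lborel)
  with bK show ?thesis
  proof eventually_elim
    case (elim x)
    have "0 \<le> 1 + f x / K" using elim(1) K by (simp add: field_simps)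
    with elim(2) have "1 + f x / K = 1" unfolding g_def by (metis ennreal_eq_1)
    then show "f x = 0" using K by simp
  qed
qed

text \<open>
  Taking the limit along a fixed sequence makes this Borel measurable in \<open>x\<close>, whether or not
  the directional derivative exists everywhere.
\<close>

definition dderiv :: "('a::euclidean_space \<Rightarrow> real) \<Rightarrow> 'a \<Rightarrow> 'a \<Rightarrow> real" where
  "dderiv h d x = lim (\<lambda>n. dquot h d x (inverse (real (Suc n))))"

lemma dquot_tendsto_at_0_imp_dderiv:
  assumes "(dquot h d x \<longlongrightarrow> l) (at 0)"
  shows "(\<lambda>n. dquot h d x (inverse (real (Suc n)))) \<longlonglongrightarrow> l" "dderiv h d x = l"
proof -
  have "filterlim (\<lambda>n. inverse (real (Suc n))) (at 0) sequentially"
    unfolding filterlim_at using LIMSEQ_inverse_real_of_nat by auto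
  with assms show *: "(\<lambda>n. dquot h d x (inverse (real (Suc n)))) \<longlonglongrightarrow> l"
    by (rule filterlim_compose)
  then show "dderiv h d x = l" unfolding dderiv_def by (rule limI)
qed

lemma dquot_scaleR: "c \<noteq> 0 \<Longrightarrow> dquot h (c *\<^sub>R d) x s = c * dquot h d x (c * s)"
  by (simp add: dquot_def mult.commute)

lemma AE_dderiv:
  assumes lip: "L-lipschitz_on UNIV h"
  shows "AE x in lborel. (dquot h d x \<longlongrightarrow> dderiv h d x) (at 0)"
  using AE_dquot_converges[OF lip, of d]
  by eventually_elim (use dquot_tendsto_at_0_imp_dderiv in force)

lemma AE_dderiv_scaleR:
  assumes lip: "L-lipschitz_on UNIV h"
  shows "AE x in lborel. dderiv h (c *\<^sub>R d) x = c * dderiv h d x"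
  using AE_dderiv[OF lip, of d]
proof eventually_elim
  case (elim x)
  show ?case
  proof (cases "c = 0")
    case True
    then have "dquot h (c *\<^sub>R d) x = (\<lambda>_. 0)" by (simp add: dquot_def fun_eq_iff)
    then have "(dquot h (c *\<^sub>R d) x \<longlongrightarrow> 0) (at 0)" by simp
    with True show ?thesis by (simp add: dquot_tendsto_at_0_imp_dderiv)
  next
    case False
    have "filterlim (\<lambda>s. c * s) (at 0) (at 0)"
      unfolding filterlim_at using False
      by (auto intro!: tendsto_eq_intros simp: eventually_at_filter)
    with elim have "((\<lambda>s. dquot h d x (c * s)) \<longlongrightarrow> dderiv h d x) (at 0)" by (rule filterlim_compose)
    then have "((\<lambda>s. c * dquot h d x (c * s)) \<longlongrightarrow> c * dderiv h d x) (at 0)" by (intro tendsto_intros)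
    then have "(dquot h (c *\<^sub>R d) x \<longlongrightarrow> c * dderiv h d x) (at 0)"
      unfolding dquot_scaleR[OF False, abs_def] .
    then show ?thesis by (rule dquot_tendsto_at_0_imp_dderiv)
  qed
qed

text \<open>
  The increment of \<open>h\<close> along \<open>d + e\<close> is an increment along \<open>d\<close> plus an increment along \<open>e\<close>
  at a point shifted by \<open>s d\<close>. Integrated over a box, the shift can be moved to the box,
  where it is negligible as \<open>s\<close> tends to 0; hence the defect of additivity has integral zero
  over every box.
\<close>

lemma AE_dderiv_add:
  fixes h :: "'a::euclidean_space \<Rightarrow> real"
  assumes lip: "L-lipschitz_on UNIV h"
  shows "AE x in lborel. dderiv h (d + e) x = dderiv h d x + dderiv h e x"
proof -
  have cont: "continuous_on UNIV h" using lip lipschitz_on_continuous_on by blast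
  have [measurable]: "h \<in> borel_measurable borel" using cont by (rule borel_measurable_continuous_onI)
  have L0: "L \<ge> 0" using lip lipschitz_on_nonneg by blast
  define \<sigma> where "\<sigma> = (\<lambda>n. inverse (real (Suc n)))"
  have \<sigma>0: "\<sigma> n > 0" "\<sigma> n \<le> 1" for n unfolding \<sigma>_def by (auto simp: field_simps)
  have \<sigma>lim: "\<sigma> \<longlonglongrightarrow> 0" unfolding \<sigma>_def by (rule LIMSEQ_inverse_real_of_nat)
  have [measurable]: "(\<lambda>x. dquot h v x s) \<in> borel_measurable borel" for v s
    unfolding dquot_def by measurable
  have [measurable]: "(\<lambda>x. dderiv h v x) \<in> borel_measurable borel" for v
    unfolding dderiv_def by measurable
  define R where "R = (\<lambda>n x. dquot h (d+e) x (\<sigma> n) - dquot h d x (\<sigma> n) - dquot h e x (\<sigma> n))"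
  define f where "f = (\<lambda>x. dderiv h (d+e) x - dderiv h d x - dderiv h e x)"
  define C where "C = L * norm (d+e) + L * norm d + L * norm e"
  have RC: "\<bar>R n x\<bar> \<le> C" for n x
    using abs_dquot_le[OF lip, of "d+e" x "\<sigma> n"] abs_dquot_le[OF lip, of d x "\<sigma> n"]
      abs_dquot_le[OF lip, of e x "\<sigma> n"] unfolding R_def C_def by linarith
  have [measurable]: "R n \<in> borel_measurable borel" for n unfolding R_def by measurable
  have fm[measurable]: "f \<in> borel_measurable borel" unfolding f_def by measurable
  have Rlim: "AE x in lborel. (\<lambda>n. R n x) \<longlonglongrightarrow> f x"
    using AE_dderiv[OF lip, of d] AE_dderiv[OF lip, of e] AE_dderiv[OF lip, of "d+e"]
  proof eventually_elim
    case (elim x)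
    show ?case unfolding R_def f_def \<sigma>_def
      by (intro tendsto_diff dquot_tendsto_at_0_imp_dderiv(1) elim)
  qed
  have fC: "AE x in lborel. \<bar>f x\<bar> \<le> C"
    using Rlim
  proof eventually_elim
    case (elim x)
    then have "(\<lambda>n. \<bar>R n x\<bar>) \<longlonglongrightarrow> \<bar>f x\<bar>" by (rule tendsto_rabs)
    then show ?case by (rule LIMSEQ_le_const2) (use RC in auto)
  qed
  have "AE x in lborel. f x = 0"
  proof (rule AE_zero_if_box_integrals_zero[OF fm fC])
    fix l u :: 'a
    let ?Q = "box l u"
    let ?I = "\<lambda>x. indicator ?Q x :: real"
    have int1: "integrable lborel ?I"
      by (simp add: integrable_indicator_iff emeasure_lborel_box_eq)
    have lim1: "(\<lambda>n. \<integral>x. ?I x * R n x \<partial>lborel) \<longlonglongrightarrow> (\<integral>x. ?I x * f x \<partial>lborel)"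
    proof (rule integral_dominated_convergence[where w = "\<lambda>x. C * ?I x"])
      show "AE x in lborel. (\<lambda>n. ?I x * R n x) \<longlonglongrightarrow> ?I x * f x"
        using Rlim by eventually_elim (intro tendsto_intros)
      show "AE x in lborel. norm (?I x * R n x) \<le> C * ?I x" for n
        using RC by (intro always_eventually) (auto split: split_indicator)
    qed (use int1 in auto)
    obtain r where r: "r > 0" "?Q \<subseteq> ball 0 r"
      using bounded_box[of l u] bounded_subset_ballD by blast
    let ?J = "\<lambda>x::'a. indicator (cball 0 (r + norm d)) x :: real"
    have intJ: "integrable lborel ?J"
      using emeasure_bounded_finite[OF bounded_cball, of "0::'a" "r + norm d"]
      by (simp add: integrable_indicator_iff)
    have I1: "?I (x - \<sigma> n *\<^sub>R d) \<le> ?J x" for x n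
    proof -
      have "norm x \<le> r + norm d" if "x - \<sigma> n *\<^sub>R d \<in> ?Q"
      proof -
        have "norm (x - \<sigma> n *\<^sub>R d) \<le> r" using that r by auto
        moreover have "norm (\<sigma> n *\<^sub>R d) \<le> norm d"
          using \<sigma>0[of n] by (simp add: mult_left_le_one_le)
        ultimately show ?thesis using norm_triangle_sub[of x "\<sigma> n *\<^sub>R d"] by linarith
      qed
      then show ?thesis by (auto split: split_indicator)
    qed
    have I2: "?I x \<le> ?J x" for x
    proof -
      have "norm x \<le> r + norm d" if "x \<in> ?Q"
      proof -
        have "norm x < r" using that r by auto
        then show ?thesis by (simp add: add_increasing2)
      qed
      then show ?thesis by (auto split: split_indicator)
    qed
    have ind: "0 \<le> ?I x" for x by (simp split: split_indicator)
    have IJ: "\<bar>?I (x - \<sigma> n *\<^sub>R d) - ?I x\<bar> \<le> ?J x" for x n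
      using I1[of x n] I2[of x] ind[of x] ind[of "x - \<sigma> n *\<^sub>R d"] by linarith
    \<comment> \<open>Translation invariance moves the shift by \<open>d\<close> from the quotient to the indicator of
      the box.\<close>
    have eq: "(\<integral>x. ?I x * R n x \<partial>lborel) = (\<integral>x. (?I (x - \<sigma> n *\<^sub>R d) - ?I x) * dquot h e x (\<sigma> n) \<partial>lborel)" for n
    proof -
      let ?g = "\<lambda>x. ?I (x - \<sigma> n *\<^sub>R d) * dquot h e x (\<sigma> n)"
      have ig: "integrable lborel ?g"
      proof (rule Bochner_Integration.integrable_bound)
        show "integrable lborel (\<lambda>x. (L * norm e) * ?J x)" using intJ by simp
        show "AE x in lborel. norm (?g x) \<le> norm ((L * norm e) * ?J x)"
        proof (intro always_eventually allI)
          fix x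
          have "norm (?I (x - \<sigma> n *\<^sub>R d)) \<le> ?J x" using I1[of x n] ind by simp
          then have "norm (?g x) \<le> ?J x * (L * norm e)"
            using abs_dquot_le[OF lip, of e x "\<sigma> n"] unfolding norm_mult
            by (intro mult_mono) auto
          then show "norm (?g x) \<le> norm ((L * norm e) * ?J x)"
            using L0 by (simp add: mult.commute)
        qed
      qed measurable
      have iq: "integrable lborel (\<lambda>x. ?I x * dquot h v x (\<sigma> n))" for v
      proof (rule Bochner_Integration.integrable_bound)
        show "integrable lborel (\<lambda>x. (L * norm v) * ?I x)" using int1 by simp
        show "AE x in lborel. norm (?I x * dquot h v x (\<sigma> n)) \<le> norm ((L * norm v) * ?I x)"
          using abs_dquot_le[OF lip, of v _ "\<sigma> n"] L0
          by (intro always_eventually) (auto split: split_indicator)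
      qed measurable
      have shift: "(\<integral>x. ?g x \<partial>lborel) = (\<integral>x. ?I x * dquot h e (x + \<sigma> n *\<^sub>R d) (\<sigma> n) \<partial>lborel)"
        and ishift: "integrable lborel (\<lambda>x. ?I x * dquot h e (x + \<sigma> n *\<^sub>R d) (\<sigma> n))"
      proof -
        have "(\<integral>x. ?g x \<partial>lborel) = (\<integral>x. ?g x \<partial>(distr lborel borel ((+) (\<sigma> n *\<^sub>R d))))"
          by (simp add: lborel_distr_plus)
        also have "\<dots> = (\<integral>x. ?g (\<sigma> n *\<^sub>R d + x) \<partial>lborel)"
          by (rule integral_distr) measurable
        finally show "(\<integral>x. ?g x \<partial>lborel) = (\<integral>x. ?I x * dquot h e (x + \<sigma> n *\<^sub>R d) (\<sigma> n) \<partial>lborel)"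
          by (simp add: add.commute)
        have "integrable (distr lborel borel ((+) (\<sigma> n *\<^sub>R d))) ?g"
          using ig by (simp add: lborel_distr_plus)
        then have "integrable lborel (\<lambda>x. ?g (\<sigma> n *\<^sub>R d + x))"
          by (subst (asm) integrable_distr_eq) measurable
        then show "integrable lborel (\<lambda>x. ?I x * dquot h e (x + \<sigma> n *\<^sub>R d) (\<sigma> n))"
          by (simp add: add.commute)
      qed
      have "?I x * R n x = ?I x * dquot h e (x + \<sigma> n *\<^sub>R d) (\<sigma> n) - ?I x * dquot h e x (\<sigma> n)" for x
        unfolding R_def dquot_def using \<sigma>0[of n] by (simp add: field_simps scaleR_right_distrib)
      then have "(\<integral>x. ?I x * R n x \<partial>lborel) = (\<integral>x. ?g x \<partial>lborel) - (\<integral>x. ?I x * dquot h e x (\<sigma> n) \<partial>lborel)"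
        using ishift iq shift by simp
      also have "\<dots> = (\<integral>x. ?g x - ?I x * dquot h e x (\<sigma> n) \<partial>lborel)"
        using ig iq by simp
      finally show ?thesis by (simp add: left_diff_distrib)
    qed
    have "AE x in lborel. x \<notin> frontier ?Q"
      using negligible_convex_frontier[OF convex_box(2), of l u]
      by (intro AE_not_in) (auto simp: negligible_iff_null_sets null_sets_completion_iff)
    then have Ilim: "AE x in lborel. (\<lambda>n. ?I (x - \<sigma> n *\<^sub>R d) - ?I x) \<longlonglongrightarrow> 0"
    proof eventually_elim
      case (elim x)
      have xl: "(\<lambda>n. x - \<sigma> n *\<^sub>R d) \<longlonglongrightarrow> x"
        using \<sigma>lim by (auto intro!: tendsto_eq_intros)
      consider "x \<in> ?Q" | "x \<in> - closure ?Q"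
        using elim by (auto simp: frontier_def interior_open[OF open_box])
      then have "\<forall>\<^sub>F n in sequentially. ?I (x - \<sigma> n *\<^sub>R d) - ?I x = 0"
      proof cases
        case 1
        then have "\<forall>\<^sub>F n in sequentially. x - \<sigma> n *\<^sub>R d \<in> ?Q"
          using topological_tendstoD[OF xl open_box] by blast
        with 1 show ?thesis by (auto elim: eventually_mono)
      next
        case 2
        then have "\<forall>\<^sub>F n in sequentially. x - \<sigma> n *\<^sub>R d \<in> - closure ?Q"
          using topological_tendstoD[OF xl, of "- closure ?Q"] by auto
        then show ?thesis
          by (rule eventually_mono) (use 2 closure_subset[of ?Q] in \<open>auto split: split_indicator\<close>)
      qed
      then show ?case by (rule tendsto_eventually)
    qed
    have "(\<lambda>n. \<integral>x. (?I (x - \<sigma> n *\<^sub>R d) - ?I x) * dquot h e x (\<sigma> n) \<partial>lborel) \<longlonglongrightarrow> (\<integral>x. 0 \<partial>(lborel :: 'a measure))"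
    proof (rule integral_dominated_convergence[where w = "\<lambda>x. ?J x * (L * norm e)"])
      show "AE x in lborel. (\<lambda>n. (?I (x - \<sigma> n *\<^sub>R d) - ?I x) * dquot h e x (\<sigma> n)) \<longlonglongrightarrow> 0"
        using Ilim
      proof eventually_elim
        case (elim x)
        have "\<forall>n. norm (dquot h e x (\<sigma> n)) \<le> L * norm e" using abs_dquot_le[OF lip] by auto
        then show ?case
          by (intro Lim_null_comparison[OF _ tendsto_mult_left_zero[OF tendsto_rabs_zero[OF elim], of "L * norm e"]])
             (auto simp: abs_mult intro!: always_eventually mult_left_mono)
      qed
      show "AE x in lborel. norm ((?I (x - \<sigma> n *\<^sub>R d) - ?I x) * dquot h e x (\<sigma> n)) \<le> ?J x * (L * norm e)" for n
        using IJ abs_dquot_le[OF lip] unfolding norm_mult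
        by (intro always_eventually allI mult_mono) auto
    qed (use intJ in \<open>measurable, auto\<close>)
    then have "(\<lambda>n. \<integral>x. ?I x * R n x \<partial>lborel) \<longlonglongrightarrow> 0" unfolding eq by simp
    with lim1 show "(\<integral>x. ?I x * f x \<partial>lborel) = 0" by (rule LIMSEQ_unique)
  qed
  then show ?thesis by eventually_elim (simp add: f_def)
qed

lemma AE_dderiv_eq_gradient:
  fixes h :: "'a::euclidean_space \<Rightarrow> real"
  assumes lip: "L-lipschitz_on UNIV h"
  shows "AE x in lborel. dderiv h d x = (\<Sum>b\<in>Basis. (d \<bullet> b) * dderiv h b x)"
proof -
  have "AE x in lborel. dderiv h (\<Sum>b\<in>B. (d \<bullet> b) *\<^sub>R b) x = (\<Sum>b\<in>B. (d \<bullet> b) * dderiv h b x)"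
    if "finite B" for B :: "'a set" using that
  proof (induction B)
    case empty
    then show ?case using AE_dderiv_scaleR[OF lip, of 0 0] by simp
  next
    case (insert b B)
    from insert.IH AE_dderiv_scaleR[OF lip, of "d \<bullet> b" b]
      AE_dderiv_add[OF lip, of "(d \<bullet> b) *\<^sub>R b" "\<Sum>b\<in>B. (d \<bullet> b) *\<^sub>R b"]
    show ?case by eventually_elim (use insert.hyps in simp)
  qed
  from this[OF finite_Basis] show ?thesis by (simp add: euclidean_representation)
qed

text \<open>
  A Lipschitz function changes little between nearby directions, so linear directional
  derivatives along a dense set control, through a finite net of the unit sphere, all
  directions uniformly.
\<close>

lemma differentiable_if_dense_linear_dquot:
  fixes h :: "'a::euclidean_space \<Rightarrow> real"
  assumes lip: "L-lipschitz_on UNIV h"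
    and dense: "\<And>X. open X \<Longrightarrow> X \<noteq> {} \<Longrightarrow> \<exists>w\<in>W. w \<in> X"
    and lim: "\<And>w. w \<in> W \<Longrightarrow> (dquot h w x \<longlongrightarrow> c \<bullet> w) (at 0)"
  shows "(h has_derivative (\<lambda>d. c \<bullet> d)) (at x)"
proof -
  have L0: "L \<ge> 0" using lip lipschitz_on_nonneg by blast
  show ?thesis unfolding has_derivative_at_alt
  proof (intro conjI allI impI)
    show "bounded_linear ((\<bullet>) c)" by (rule bounded_linear_inner_right)
    fix e :: real assume "e > 0"
    define \<eta> where "\<eta> = e / (L + norm c + 1)"
    have \<eta>: "\<eta> > 0" "\<eta> * (L + norm c + 1) = e"
    proof -
      have "L + norm c + 1 > 0" using L0 norm_ge_zero[of c] by linarith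
      then show "\<eta> > 0" "\<eta> * (L + norm c + 1) = e" using \<open>e > 0\<close> unfolding \<eta>_def by auto
    qed
    have "sphere 0 1 \<subseteq> (\<Union>w\<in>W. ball w \<eta>)"
    proof
      fix v :: 'a
      obtain w where "w \<in> W" "w \<in> ball v \<eta>" using dense[of "ball v \<eta>"] \<eta> by auto
      then show "v \<in> (\<Union>w\<in>W. ball w \<eta>)" by (auto simp: dist_commute)
    qed
    then obtain W0 where W0: "W0 \<subseteq> W" "finite W0" "sphere 0 1 \<subseteq> (\<Union>w\<in>W0. ball w \<eta>)"
      using compactE_image[OF compact_sphere, of W "\<lambda>w. ball w \<eta>" 0 1] by auto
    have "\<forall>w\<in>W0. \<forall>\<^sub>F s in at 0. dist (dquot h w x s) (c \<bullet> w) < \<eta>"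
      using lim W0 \<eta> by (blast intro: tendstoD)
    then have "\<forall>\<^sub>F s in at 0. \<forall>w\<in>W0. dist (dquot h w x s) (c \<bullet> w) < \<eta>"
      using W0 by (simp add: eventually_ball_finite)
    then obtain \<delta> where \<delta>: "\<delta> > 0" "\<And>s w. s \<noteq> 0 \<Longrightarrow> \<bar>s\<bar> < \<delta> \<Longrightarrow> w \<in> W0 \<Longrightarrow> dist (dquot h w x s) (c \<bullet> w) < \<eta>"
      unfolding eventually_at by (auto simp: dist_real_def)
    show "\<exists>\<delta>>0. \<forall>y. norm (y - x) < \<delta> \<longrightarrow> norm (h y - h x - c \<bullet> (y - x)) \<le> e * norm (y - x)"
    proof (intro exI[of _ \<delta>] conjI allI impI \<delta>(1))
      fix y assume y: "norm (y - x) < \<delta>"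
      show "norm (h y - h x - c \<bullet> (y - x)) \<le> e * norm (y - x)"
      proof (cases "y = x")
        case False
        define s where "s = norm (y - x)"
        define v where "v = (y - x) /\<^sub>R s"
        have s: "s > 0" "s < \<delta>" using False y by (auto simp: s_def)
        have "norm v = 1" using s by (simp add: v_def s_def)
        then obtain w where w: "w \<in> W0" "norm (v - w) < \<eta>"
          using W0(3) by (fastforce simp: dist_norm norm_minus_commute)
        have yv: "y = x + s *\<^sub>R v" using s by (simp add: v_def)
        have "\<bar>(h (x + s *\<^sub>R w) - h x) / s - c \<bullet> w\<bar> < \<eta>"
          using \<delta>(2)[of s w] s w by (simp add: dquot_def dist_real_def)
        then have 1: "\<bar>h (x + s *\<^sub>R w) - h x - s * (c \<bullet> w)\<bar> \<le> \<eta> * s"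
          using s by (simp add: abs_le_iff abs_less_iff field_simps)
        have "\<bar>h y - h (x + s *\<^sub>R w)\<bar> \<le> L * norm (s *\<^sub>R (v - w))"
          using lipschitz_onD[OF lip, of y "x + s *\<^sub>R w"]
          by (simp add: yv dist_norm dist_real_def scaleR_diff_right)
        also have "\<dots> \<le> L * (s * \<eta>)" using s w L0 by (auto intro!: mult_left_mono)
        finally have 2: "\<bar>h y - h (x + s *\<^sub>R w)\<bar> \<le> L * (s * \<eta>)" .
        have "\<bar>c \<bullet> w - c \<bullet> v\<bar> \<le> norm c * norm (w - v)"
          using Cauchy_Schwarz_ineq2[of c "w - v"] by (simp add: inner_diff_right)
        also have "\<dots> \<le> norm c * \<eta>" using w by (intro mult_left_mono) (auto simp: norm_minus_commute)
        finally have "s * \<bar>c \<bullet> w - c \<bullet> v\<bar> \<le> s * (norm c * \<eta>)" using s by simp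
        then have 3: "\<bar>s * (c \<bullet> w) - c \<bullet> (y - x)\<bar> \<le> s * (norm c * \<eta>)"
          using s by (simp add: yv abs_mult flip: right_diff_distrib)
        have "\<bar>h y - h x - c \<bullet> (y - x)\<bar> \<le> \<eta> * s + L * (s * \<eta>) + s * (norm c * \<eta>)"
          using 1 2 3 by linarith
        also have "\<dots> = e * s" unfolding \<eta>(2)[symmetric] by (simp add: algebra_simps)
        finally show ?thesis by (simp add: s_def)
      qed simp
    qed
  qed
qed

text \<open>
  For each component, the directional derivatives along a countable dense set of directions
  exist and are given by one gradient outside a single null set.
\<close>

theorem Rademacher:
  fixes h :: "'a::euclidean_space \<Rightarrow> 'b::euclidean_space"
  assumes lip: "L-lipschitz_on UNIV h"
  shows "AE x in lborel. h differentiable (at x)"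
proof -
  have scalar: "AE x in lborel. f differentiable (at x)" if f: "L-lipschitz_on UNIV f" for f :: "'a \<Rightarrow> real"
  proof -
    obtain W :: "'a set" where W: "countable W" "\<And>X. open X \<Longrightarrow> X \<noteq> {} \<Longrightarrow> \<exists>w\<in>W. w \<in> X"
      by (erule countable_dense_setE)
    have "AE x in lborel. \<forall>w\<in>W. (dquot f w x \<longlongrightarrow> dderiv f w x) (at 0) \<and>
        dderiv f w x = (\<Sum>b\<in>Basis. (w \<bullet> b) * dderiv f b x)"
      using W(1) AE_dderiv[OF f] AE_dderiv_eq_gradient[OF f] by (intro AE_ball_countable') auto
    then show ?thesis
    proof eventually_elim
      case (elim x)
      define c where "c = (\<Sum>b\<in>Basis. dderiv f b x *\<^sub>R b)"
      have "(\<Sum>b\<in>Basis. (w \<bullet> b) * dderiv f b x) = c \<bullet> w" for w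
        unfolding c_def inner_sum_left
        by (intro sum.cong refl) (simp add: inner_commute mult.commute)
      with elim have "(f has_derivative (\<lambda>d. c \<bullet> d)) (at x)"
        by (intro differentiable_if_dense_linear_dquot[OF f W(2)]) auto
      then show ?case unfolding differentiable_def by blast
    qed
  qed
  have "L-lipschitz_on UNIV (\<lambda>x. h x \<bullet> b)" if "b \<in> Basis" for b
  proof (rule lipschitz_onI)
    fix x y
    have "\<bar>(h x - h y) \<bullet> b\<bar> \<le> norm (h x - h y)" using that by (rule Basis_le_norm)
    also have "\<dots> \<le> L * dist x y" using lipschitz_onD[OF lip, of x y] by (simp add: dist_norm)
    finally show "dist (h x \<bullet> b) (h y \<bullet> b) \<le> L * dist x y" by (simp add: dist_real_def inner_diff_left)
  qed (rule lipschitz_on_nonneg[OF lip])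
  then have "AE x in lborel. \<forall>b\<in>Basis. (\<lambda>x. h x \<bullet> b) differentiable (at x)"
    using scalar by (intro AE_ball_countable') (auto simp: countable_finite)
  then show ?thesis by (simp add: differentiable_componentwise_within[of h])
qed

section \<open>Averages of a Lipschitz map over small balls\<close>

lemma has_derivative_shift_iff:
  fixes k :: "'a::real_normed_vector \<Rightarrow> 'b::real_normed_vector"
  shows "((\<lambda>y. k (x + y)) has_derivative D) (at y) \<longleftrightarrow> (k has_derivative D) (at (x + y))"
proof
  assume "(k has_derivative D) (at (x + y))"
  moreover have "((+) x has_derivative (\<lambda>d. d)) (at y)"
    using has_derivative_add[OF has_derivative_const[of x] has_derivative_ident, of "at y"] by simp
  ultimately show "((\<lambda>y. k (x + y)) has_derivative D) (at y)"
    using has_derivative_compose[of "\<lambda>y. x + y" "\<lambda>d. d" y UNIV k D] by blast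
next
  assume A: "((\<lambda>y. k (x + y)) has_derivative D) (at y)"
  have "((\<lambda>z. z - x) has_derivative (\<lambda>d. d)) (at (x + y))" by (auto intro!: derivative_eq_intros)
  from has_derivative_compose[OF this, of "\<lambda>y. k (x + y)" D] A
  show "(k has_derivative D) (at (x + y))" by simp
qed

lemma has_derivative_seq_quotient:
  assumes "(k has_derivative D) (at z)"
  shows "(\<lambda>n. (k (z + inverse (real (Suc n)) *\<^sub>R d) - k z) /\<^sub>R inverse (real (Suc n))) \<longlonglongrightarrow> D d"
proof -
  have "((\<lambda>s. (k (z + s *\<^sub>R d) - k z) /\<^sub>R s) \<longlongrightarrow> D d) (at 0)"
  proof -
    interpret bounded_linear D using assms by (rule has_derivative_bounded_linear)
    have "((\<lambda>s. k (z + s *\<^sub>R d)) has_derivative (\<lambda>s. D (s *\<^sub>R d))) (at 0)"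
    proof (rule has_derivative_compose[of "\<lambda>s. z + s *\<^sub>R d"])
      show "((\<lambda>s. z + s *\<^sub>R d) has_derivative (\<lambda>s. s *\<^sub>R d)) (at 0)"
        by (auto intro!: derivative_eq_intros)
      show "(k has_derivative D) (at (z + 0 *\<^sub>R d))" using assms by simp
    qed
    then have "((\<lambda>s. k (z + s *\<^sub>R d)) has_vector_derivative D d) (at 0)"
      by (simp add: has_vector_derivative_def scaleR)
    then have "((\<lambda>s. (k (z + s *\<^sub>R d) - k z - s *\<^sub>R D d) /\<^sub>R norm s) \<longlongrightarrow> 0) (at 0)"
      by (simp add: has_vector_derivative_def has_derivative_def)
    then have "((\<lambda>s. norm ((k (z + s *\<^sub>R d) - k z - s *\<^sub>R D d) /\<^sub>R norm s)) \<longlongrightarrow> 0) (at 0)"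
      by (rule tendsto_norm_zero)
    moreover have "\<forall>\<^sub>F s in at 0. norm ((k (z + s *\<^sub>R d) - k z - s *\<^sub>R D d) /\<^sub>R norm s)
        = norm ((k (z + s *\<^sub>R d) - k z) /\<^sub>R s - D d)"
      unfolding eventually_at_filter
    proof (intro always_eventually allI impI)
      fix s :: real assume "s \<noteq> 0"
      then have "(k (z + s *\<^sub>R d) - k z) /\<^sub>R s - D d = (k (z + s *\<^sub>R d) - k z - s *\<^sub>R D d) /\<^sub>R s"
        by (simp add: scaleR_diff_right)
      then show "norm ((k (z + s *\<^sub>R d) - k z - s *\<^sub>R D d) /\<^sub>R norm s)
        = norm ((k (z + s *\<^sub>R d) - k z) /\<^sub>R s - D d)" by simp
    qed
    ultimately have "((\<lambda>s. norm ((k (z + s *\<^sub>R d) - k z) /\<^sub>R s - D d)) \<longlongrightarrow> 0) (at 0)"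
      by (rule Lim_transform_eventually)
    then have "((\<lambda>s. (k (z + s *\<^sub>R d) - k z) /\<^sub>R s - D d) \<longlongrightarrow> 0) (at 0)"
      by (rule tendsto_norm_zero_cancel)
    then show ?thesis by (rule LIM_zero_cancel)
  qed
  moreover have "filterlim (\<lambda>n. inverse (real (Suc n))) (at 0) sequentially"
    unfolding filterlim_at using LIMSEQ_inverse_real_of_nat by auto
  ultimately show ?thesis by (rule filterlim_compose)
qed

lemma norm_derivative_le_Lipschitz:
  assumes lip: "L-lipschitz_on UNIV k" and "(k has_derivative D) (at z)"
  shows "norm (D d) \<le> L * norm d"
proof -
  have "(\<lambda>n. norm ((k (z + inverse (real (Suc n)) *\<^sub>R d) - k z) /\<^sub>R inverse (real (Suc n)))) \<longlonglongrightarrow> norm (D d)"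
    by (intro tendsto_norm has_derivative_seq_quotient assms)
  then show ?thesis
  proof (rule LIMSEQ_le_const2, intro exI allI impI)
    fix n :: nat
    have "norm (k (z + inverse (real (Suc n)) *\<^sub>R d) - k z) \<le> L * (inverse (real (Suc n)) * norm d)"
      using lipschitz_onD[OF lip, of "z + inverse (real (Suc n)) *\<^sub>R d" z] by (simp add: dist_norm)
    then show "norm ((k (z + inverse (real (Suc n)) *\<^sub>R d) - k z) /\<^sub>R inverse (real (Suc n))) \<le> L * norm d"
      unfolding norm_scaleR by (simp add: field_simps del: of_nat_Suc)
  qed
qed

definition seqderiv :: "('a::real_normed_vector \<Rightarrow> 'b::real_normed_vector) \<Rightarrow> 'a \<Rightarrow> 'a \<Rightarrow> 'b" where
  "seqderiv k d z = lim (\<lambda>n. (k (z + inverse (real (Suc n)) *\<^sub>R d) - k z) /\<^sub>R inverse (real (Suc n)))"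

lemma seqderiv_eq: "(k has_derivative D) (at z) \<Longrightarrow> seqderiv k d z = D d"
  unfolding seqderiv_def by (intro limI has_derivative_seq_quotient)

text \<open>
  Every closed ball that contains \<open>D' d\<close> for all derivatives \<open>D'\<close> of \<open>k\<close> near \<open>x\<close> also
  contains \<open>D d\<close>. This is membership in a closed convex hull, in the form that averages
  satisfy by the norm inequality for integrals.
\<close>

definition derivative_hull :: "('a::real_normed_vector \<Rightarrow> 'b::real_normed_vector) \<Rightarrow> real \<Rightarrow> 'a \<Rightarrow> ('a \<Rightarrow> 'b) \<Rightarrow> bool" where
  "derivative_hull k \<epsilon> x D \<longleftrightarrow> (\<forall>d l \<delta>.
     (\<forall>z D'. dist z x \<le> \<epsilon> \<and> (k has_derivative D') (at z) \<longrightarrow> norm (D' d - l) \<le> \<delta>) \<longrightarrow> norm (D d - l) \<le> \<delta>)"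

text \<open>
  The map \<open>g\<close> is the mean of \<open>k\<close> over balls of radius \<open>\<epsilon>\<close>. By Rademacher's theorem and
  dominated convergence it is differentiable at every point, and its derivative there is the
  mean of the derivatives of \<open>k\<close>.
\<close>

lemma average_differentiable:
  fixes k :: "'a::euclidean_space \<Rightarrow> 'b::euclidean_space"
  assumes lip: "L-lipschitz_on UNIV k" and "\<epsilon> > 0"
  shows "\<exists>g. (\<forall>x. norm (g x - k x) \<le> L * \<epsilon>) \<and>
    (\<forall>x. \<exists>D. (g has_derivative D) (at x) \<and> derivative_hull k \<epsilon> x D)"
proof -
  have L0: "L \<ge> 0" using lip lipschitz_on_nonneg by blast
  have cont: "continuous_on UNIV k" using lip lipschitz_on_continuous_on by blast
  have km[measurable]: "k \<in> borel_measurable borel" using cont by (rule borel_measurable_continuous_onI)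
  have [measurable]: "seqderiv k d \<in> borel_measurable borel" for d
    unfolding seqderiv_def by measurable
  define B where "B = cball (0::'a) \<epsilon>"
  define \<mu> where "\<mu> = measure lborel B"
  have B[measurable]: "B \<in> sets borel" by (simp add: B_def)
  have finB: "emeasure lborel B < \<infinity>" unfolding B_def by (rule emeasure_bounded_finite) simp
  have \<mu>: "\<mu> > 0" unfolding \<mu>_def B_def using content_cball_pos[OF \<open>\<epsilon> > 0\<close>, of "0::'a"] by simp
  let ?I = "\<lambda>y. indicator B y :: real"
  have intI: "integrable lborel ?I" using finB by (simp add: integrable_indicator_iff)
  have int: "integrable lborel (\<lambda>y. ?I y *\<^sub>R \<phi> y)"
    if [measurable]: "\<phi> \<in> borel_measurable borel" and b: "AE y in lborel. y \<in> B \<longrightarrow> norm (\<phi> y) \<le> K" for \<phi> :: "'a \<Rightarrow> 'b" and K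
  proof (rule Bochner_Integration.integrable_bound)
    show "integrable lborel (\<lambda>y. K * ?I y)" using intI by simp
    show "AE y in lborel. norm (?I y *\<^sub>R \<phi> y) \<le> norm (K * ?I y)"
      using b by eventually_elim (auto split: split_indicator)
  qed measurable
  have avg: "norm ((\<integral>y. ?I y *\<^sub>R \<phi> y \<partial>lborel) /\<^sub>R \<mu> - l) \<le> \<delta>"
    if m[measurable]: "\<phi> \<in> borel_measurable borel" and b: "AE y in lborel. y \<in> B \<longrightarrow> norm (\<phi> y - l) \<le> \<delta>"
    for \<phi> :: "'a \<Rightarrow> 'b" and l \<delta>
  proof -
    have i1: "integrable lborel (\<lambda>y. ?I y *\<^sub>R (\<phi> y - l))" using b by (intro int) measurable
    have i2: "integrable lborel (\<lambda>y. ?I y *\<^sub>R l)" by (intro int[of _ "norm l"]) auto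
    have "(\<integral>y. ?I y *\<^sub>R (\<phi> y - l) \<partial>lborel) + (\<integral>y. ?I y *\<^sub>R l \<partial>lborel) = (\<integral>y. ?I y *\<^sub>R \<phi> y \<partial>lborel)"
      by (subst Bochner_Integration.integral_add[OF i1 i2, symmetric]) (simp add: scaleR_diff_right)
    moreover have "(\<integral>y. ?I y *\<^sub>R l \<partial>lborel) = \<mu> *\<^sub>R l" using intI by (simp add: \<mu>_def)
    ultimately have "(\<integral>y. ?I y *\<^sub>R \<phi> y \<partial>lborel) = (\<integral>y. ?I y *\<^sub>R (\<phi> y - l) \<partial>lborel) + \<mu> *\<^sub>R l"
      by simp
    then have "(\<integral>y. ?I y *\<^sub>R \<phi> y \<partial>lborel) /\<^sub>R \<mu> - l = (\<integral>y. ?I y *\<^sub>R (\<phi> y - l) \<partial>lborel) /\<^sub>R \<mu>"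
      using \<mu> by (simp only: scaleR_right_distrib) simp
    then have "norm ((\<integral>y. ?I y *\<^sub>R \<phi> y \<partial>lborel) /\<^sub>R \<mu> - l) = norm (\<integral>y. ?I y *\<^sub>R (\<phi> y - l) \<partial>lborel) / \<mu>"
      using \<mu> by (simp add: divide_inverse mult.commute)
    also have "norm (\<integral>y. ?I y *\<^sub>R (\<phi> y - l) \<partial>lborel) \<le> (\<integral>y. \<delta> * ?I y \<partial>lborel)"
    proof (rule order_trans[OF integral_norm_bound], rule integral_mono_AE)
      show "AE y in lborel. norm (?I y *\<^sub>R (\<phi> y - l)) \<le> \<delta> * ?I y"
        using b by eventually_elim (auto split: split_indicator)
    qed (use integrable_norm[OF i1] intI in simp_all)
    also have "\<dots> = \<delta> * \<mu>" using intI by (simp add: \<mu>_def)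
    finally show ?thesis using \<mu> by (simp add: divide_right_mono)
  qed
  define g where "g = (\<lambda>x. (\<integral>y. ?I y *\<^sub>R k (x + y) \<partial>lborel) /\<^sub>R \<mu>)"
  define D where "D = (\<lambda>x d. (\<integral>y. ?I y *\<^sub>R seqderiv k d (x + y) \<partial>lborel) /\<^sub>R \<mu>)"
  \<comment> \<open>Rademacher's theorem is applied to the translate, so that the null set is one of
    increments \<open>y\<close>.\<close>
  have AEd: "AE y in lborel. k differentiable (at (x + y))" for x
  proof -
    have "L-lipschitz_on UNIV (\<lambda>y. k (x + y))"
    proof (rule lipschitz_onI)
      fix y z show "dist (k (x + y)) (k (x + z)) \<le> L * dist y z"
        using lipschitz_onD[OF lip, of "x + y" "x + z"] by simp
    qed (rule L0)
    from Rademacher[OF this] show ?thesis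
      by eventually_elim (auto simp: differentiable_def has_derivative_shift_iff)
  qed
  have AEb: "AE y in lborel. y \<in> B \<longrightarrow> norm (seqderiv k d (x + y)) \<le> L * norm d" for x d
    using AEd[of x]
    by eventually_elim (auto simp: differentiable_def seqderiv_eq norm_derivative_le_Lipschitz[OF lip])
  have close: "norm (g x - k x) \<le> L * \<epsilon>" for x
    unfolding g_def
  proof (rule avg)
    show "AE y in lborel. y \<in> B \<longrightarrow> norm (k (x + y) - k x) \<le> L * \<epsilon>"
    proof (intro always_eventually allI impI)
      fix y assume "y \<in> B"
      have "norm (k (x + y) - k x) \<le> L * norm y"
        using lipschitz_onD[OF lip, of "x + y" x] by (simp add: dist_norm)
      also have "\<dots> \<le> L * \<epsilon>" using \<open>y \<in> B\<close> L0 by (intro mult_left_mono) (auto simp: B_def)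
      finally show "norm (k (x + y) - k x) \<le> L * \<epsilon>" .
    qed
  qed measurable
  have dint: "integrable lborel (\<lambda>y. ?I y *\<^sub>R seqderiv k d (x + y))" for x d
    using AEb[of d x] by (intro int) measurable
  have kint: "integrable lborel (\<lambda>y. ?I y *\<^sub>R k (x + y))" for x
  proof (rule int)
    have "norm (k (x + y)) \<le> norm (k x) + L * \<epsilon>" if "y \<in> B" for y
    proof -
      have "norm (k (x + y) - k x) \<le> L * norm y"
        using lipschitz_onD[OF lip, of "x + y" x] by (simp add: dist_norm)
      also have "\<dots> \<le> L * \<epsilon>" using that L0 by (intro mult_left_mono) (auto simp: B_def)
      finally show ?thesis using norm_triangle_sub[of "k (x + y)" "k x"] by linarith
    qed
    then show "AE y in lborel. y \<in> B \<longrightarrow> norm (k (x + y)) \<le> norm (k x) + L * \<epsilon>" by simp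
  qed measurable
  have der: "(g has_derivative D x) (at x)" for x
    unfolding has_derivative_at_within
  proof (intro conjI)
    show "bounded_linear (D x)"
    proof (rule bounded_linear_intro[where K = L])
      fix d e
      have "(\<integral>y. ?I y *\<^sub>R seqderiv k (d + e) (x + y) \<partial>lborel)
          = (\<integral>y. ?I y *\<^sub>R seqderiv k d (x + y) + ?I y *\<^sub>R seqderiv k e (x + y) \<partial>lborel)"
      proof (rule integral_cong_AE)
        show "AE y in lborel. ?I y *\<^sub>R seqderiv k (d + e) (x + y) = ?I y *\<^sub>R seqderiv k d (x + y) + ?I y *\<^sub>R seqderiv k e (x + y)"
          using AEd[of x]
        proof eventually_elim
          case (elim y)
          then obtain D' where D': "(k has_derivative D') (at (x + y))" by (auto simp: differentiable_def)
          have "D' (d + e) = D' d + D' e"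
            using has_derivative_bounded_linear[OF D'] by (simp add: linear_simps)
          then show ?case by (simp add: seqderiv_eq[OF D'] scaleR_right_distrib)
        qed
      qed measurable
      then show "D x (d + e) = D x d + D x e"
        unfolding D_def using dint by (simp add: scaleR_right_distrib)
    next
      fix r d
      have "(\<integral>y. ?I y *\<^sub>R seqderiv k (r *\<^sub>R d) (x + y) \<partial>lborel)
          = (\<integral>y. r *\<^sub>R (?I y *\<^sub>R seqderiv k d (x + y)) \<partial>lborel)"
      proof (rule integral_cong_AE)
        show "AE y in lborel. ?I y *\<^sub>R seqderiv k (r *\<^sub>R d) (x + y) = r *\<^sub>R (?I y *\<^sub>R seqderiv k d (x + y))"
          using AEd[of x]
        proof eventually_elim
          case (elim y)
          then obtain D' where D': "(k has_derivative D') (at (x + y))" by (auto simp: differentiable_def)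
          have "D' (r *\<^sub>R d) = r *\<^sub>R D' d"
            using has_derivative_bounded_linear[OF D'] by (simp add: linear_simps)
          then show ?case by (simp add: seqderiv_eq[OF D'])
        qed
      qed measurable
      also have "\<dots> = r *\<^sub>R (\<integral>y. ?I y *\<^sub>R seqderiv k d (x + y) \<partial>lborel)"
        using dint by (intro integral_scaleR_right)
      finally show "D x (r *\<^sub>R d) = r *\<^sub>R D x d" unfolding D_def by (simp add: mult.commute)
    next
      fix d
      have "norm (D x d - 0) \<le> L * norm d" unfolding D_def
        by (rule avg) (use AEb in auto)
      then show "norm (D x d) \<le> norm d * L" by (simp add: mult.commute)
    qed
    show "((\<lambda>y. (g y - g x - D x (y - x)) /\<^sub>R norm (y - x)) \<longlongrightarrow> 0) (at x)"
      unfolding tendsto_at_iff_sequentially comp_def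
    proof (intro allI impI)
      fix X assume X: "\<forall>i. X i \<in> UNIV - {x}" "X \<longlonglongrightarrow> x"
      define \<phi> where "\<phi> = (\<lambda>i y. (k (X i + y) - k (x + y) - seqderiv k (X i - x) (x + y)) /\<^sub>R norm (X i - x))"
      have [measurable]: "\<phi> i \<in> borel_measurable borel" for i unfolding \<phi>_def by measurable
      have eq: "(g (X i) - g x - D x (X i - x)) /\<^sub>R norm (X i - x) = (\<integral>y. ?I y *\<^sub>R \<phi> i y \<partial>lborel) /\<^sub>R \<mu>" for i
      proof -
        have "?I y *\<^sub>R \<phi> i y = (?I y *\<^sub>R k (X i + y) - ?I y *\<^sub>R k (x + y) - ?I y *\<^sub>R seqderiv k (X i - x) (x + y)) /\<^sub>R norm (X i - x)" for y
          unfolding \<phi>_def by (simp add: scaleR_diff_right mult.commute)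
        then have "(\<integral>y. ?I y *\<^sub>R \<phi> i y \<partial>lborel) = ((\<integral>y. ?I y *\<^sub>R k (X i + y) \<partial>lborel) - (\<integral>y. ?I y *\<^sub>R k (x + y) \<partial>lborel)
            - (\<integral>y. ?I y *\<^sub>R seqderiv k (X i - x) (x + y) \<partial>lborel)) /\<^sub>R norm (X i - x)"
          using kint dint by simp
        then show ?thesis unfolding g_def D_def by (simp add: scaleR_diff_right mult.commute)
      qed
      have "(\<lambda>i. \<integral>y. ?I y *\<^sub>R \<phi> i y \<partial>lborel) \<longlonglongrightarrow> (\<integral>y. 0 \<partial>(lborel :: 'a measure))"
      proof (rule integral_dominated_convergence[where w = "\<lambda>y. 2 * L * ?I y"])
        show "AE y in lborel. (\<lambda>i. ?I y *\<^sub>R \<phi> i y) \<longlonglongrightarrow> 0"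
          using AEd[of x]
        proof eventually_elim
          case (elim y)
          then obtain D' where D': "(k has_derivative D') (at (x + y))" by (auto simp: differentiable_def)
          have Xy: "(\<lambda>i. X i + y) \<longlonglongrightarrow> x + y" by (intro tendsto_intros X)
          have "((\<lambda>z. (k z - k (x + y) - D' (z - (x + y))) /\<^sub>R norm (z - (x + y))) \<longlongrightarrow> 0) (at (x + y))"
            using D' unfolding has_derivative_def by simp
          then have "(\<lambda>i. (k (X i + y) - k (x + y) - D' (X i + y - (x + y))) /\<^sub>R norm (X i + y - (x + y))) \<longlonglongrightarrow> 0"
            unfolding tendsto_at_iff_sequentially comp_def using X Xy
            by (elim allE[of _ "\<lambda>i. X i + y"]) auto
          then have "(\<lambda>i. \<phi> i y) \<longlonglongrightarrow> 0" unfolding \<phi>_def seqderiv_eq[OF D'] by simp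
          then have "(\<lambda>i. ?I y *\<^sub>R \<phi> i y) \<longlonglongrightarrow> ?I y *\<^sub>R 0" by (intro tendsto_intros)
          then show ?case by simp
        qed
        show "AE y in lborel. norm (?I y *\<^sub>R \<phi> i y) \<le> 2 * L * ?I y" for i
          using AEb[of "X i - x" x]
        proof eventually_elim
          case (elim y)
          show ?case
          proof (cases "y \<in> B")
            case True
            have n: "norm (X i - x) > 0" using X by simp
            have "norm (k (X i + y) - k (x + y)) \<le> L * norm (X i - x)"
              using lipschitz_onD[OF lip, of "X i + y" "x + y"] by (simp add: dist_norm)
            then have "norm (k (X i + y) - k (x + y) - seqderiv k (X i - x) (x + y)) \<le> 2 * L * norm (X i - x)"
              using elim True norm_triangle_ineq4[of "k (X i + y) - k (x + y)" "seqderiv k (X i - x) (x + y)"]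
              by linarith
            then have "norm (\<phi> i y) \<le> 2 * L" using n unfolding \<phi>_def norm_scaleR by (simp add: field_simps)
            then show ?thesis using True by simp
          qed simp
        qed
        show "(\<lambda>y::'a. 0::'b) \<in> borel_measurable lborel" by simp
        show "(\<lambda>y. ?I y *\<^sub>R \<phi> i y) \<in> borel_measurable lborel" for i by measurable
        show "integrable lborel (\<lambda>y. 2 * L * ?I y)" using intI by simp
      qed
      then have "(\<lambda>i. (\<integral>y. ?I y *\<^sub>R \<phi> i y \<partial>lborel) /\<^sub>R \<mu>) \<longlonglongrightarrow> 0 /\<^sub>R \<mu>"
        by (intro tendsto_intros) simp
      then show "(\<lambda>i. (g (X i) - g x - D x (X i - x)) /\<^sub>R norm (X i - x)) \<longlonglongrightarrow> 0"
        unfolding eq by simp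
    qed
  qed
  have "norm (D x d - l) \<le> \<delta>"
    if b: "\<And>z D'. dist z x \<le> \<epsilon> \<Longrightarrow> (k has_derivative D') (at z) \<Longrightarrow> norm (D' d - l) \<le> \<delta>" for x d l \<delta>
    unfolding D_def
  proof (rule avg)
    show "AE y in lborel. y \<in> B \<longrightarrow> norm (seqderiv k d (x + y) - l) \<le> \<delta>"
      using AEd[of x]
    proof eventually_elim
      case (elim y)
      then obtain D' where D': "(k has_derivative D') (at (x + y))" by (auto simp: differentiable_def)
      show ?case using b[OF _ D'] seqderiv_eq[OF D'] by (auto simp: B_def dist_norm)
    qed
  qed measurable
  with close der show ?thesis unfolding derivative_hull_def by (intro exI[of _ g]) blast
qed

section \<open>Subregularity, normal cones, Lipschitz moduli and smooth maps\<close>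

lemma set_edist_nonneg: "0 \<le> set_edist x C"
  unfolding set_edist_def by (rule INF_greatest) simp

text \<open>
  Failure of subregularity in terms of points only: \<open>D\<close> stands for a lower bound of the
  distance from \<open>x\<close> to the solution set, and \<open>y\<close> for a point that nearly realises the
  residual at \<open>x\<close>.
\<close>

lemma not_metrically_subregular_iff:
  assumes "(xbar, ybar) \<in> gph G"
  shows "\<not> metrically_subregular G xbar ybar \<longleftrightarrow>
    (\<forall>\<kappa>>0. \<forall>r>0. \<exists>x y D. dist x xbar < r \<and> y \<in> G x \<and> \<kappa> * dist y ybar < D \<and>
      (\<forall>s. ybar \<in> G s \<longrightarrow> D \<le> dist x s))" (is "?L \<longleftrightarrow> ?R")
proof
  assume L: ?L
  show ?R
  proof (intro allI impI)
    fix \<kappa> r :: real assume "\<kappa> > 0" "r > 0"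
    then obtain x where x: "x \<in> ball xbar r"
      "\<not> set_edist x {x'. ybar \<in> G x'} \<le> ereal \<kappa> * set_edist ybar (G x)"
      using L assms unfolding metrically_subregular_def
      by (metis centre_in_ball less_imp_le open_ball)
    have "set_edist x {x'. ybar \<in> G x'} \<le> ereal (dist x xbar)"
      unfolding set_edist_def using assms by (intro INF_lower) (simp add: gph_def)
    then obtain D where D: "set_edist x {x'. ybar \<in> G x'} = ereal D"
      using set_edist_nonneg[of x "{x'. ybar \<in> G x'}"]
      by (cases "set_edist x {x'. ybar \<in> G x'}") auto
    have "set_edist ybar (G x) < ereal (D / \<kappa>)"
      using x(2) D \<open>\<kappa> > 0\<close> set_edist_nonneg[of ybar "G x"]
      by (cases "set_edist ybar (G x)") (auto simp: field_simps)
    then obtain y where y: "y \<in> G x" "dist ybar y < D / \<kappa>"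
      unfolding set_edist_def by (auto simp: INF_less_iff)
    show "\<exists>x y D. dist x xbar < r \<and> y \<in> G x \<and> \<kappa> * dist y ybar < D \<and>
      (\<forall>s. ybar \<in> G s \<longrightarrow> D \<le> dist x s)"
    proof (intro exI conjI allI impI)
      show "dist x xbar < r" using x by (simp add: dist_commute)
      show "y \<in> G x" by fact
      show "\<kappa> * dist y ybar < D" using y \<open>\<kappa> > 0\<close> by (simp add: field_simps dist_commute)
      fix s assume "ybar \<in> G s"
      then have "ereal D \<le> ereal (dist x s)"
        unfolding D[symmetric] set_edist_def by (intro INF_lower) simp
      then show "D \<le> dist x s" by simp
    qed
  qed
next
  assume R: ?R
  show ?L
  proof
    assume "metrically_subregular G xbar ybar"
    then obtain \<kappa> U where \<kappa>: "\<kappa> \<ge> 0" and U: "open U" "xbar \<in> U"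
      and le: "\<And>x. x \<in> U \<Longrightarrow> set_edist x {x'. ybar \<in> G x'} \<le> ereal \<kappa> * set_edist ybar (G x)"
      unfolding metrically_subregular_def by blast
    obtain r where r: "r > 0" "ball xbar r \<subseteq> U" using U openE by blast
    obtain x y D where *: "dist x xbar < r" "y \<in> G x" "(\<kappa> + 1) * dist y ybar < D"
      "\<And>s. ybar \<in> G s \<Longrightarrow> D \<le> dist x s"
      using R[rule_format, of "\<kappa> + 1" r] \<kappa> r by auto
    have "ereal D \<le> set_edist x {x'. ybar \<in> G x'}"
      unfolding set_edist_def by (rule INF_greatest) (use *(4) in auto)
    also have "\<dots> \<le> ereal \<kappa> * set_edist ybar (G x)"
      using * r by (intro le) (auto simp: dist_commute)
    also have "\<dots> \<le> ereal \<kappa> * ereal (dist ybar y)"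
      using \<kappa> *(2) unfolding set_edist_def by (intro ereal_mult_left_mono INF_lower) auto
    finally have "D \<le> \<kappa> * dist y ybar" by (simp add: dist_commute)
    also have "\<dots> \<le> (\<kappa> + 1) * dist y ybar" by (simp add: mult_right_mono)
    finally show False using *(3) by simp
  qed
qed

text \<open>
  In finite dimensions the polar of the tangent cone consists of regular normals: otherwise
  the directions of a violating sequence would accumulate at a tangent vector that \<open>zs\<close> does
  not separate.
\<close>

lemma normal_cone_Frechet_ineq:
  fixes z :: "'a::euclidean_space"
  assumes "zs \<in> normal_cone A z" "\<epsilon> > 0"
  shows "\<exists>\<delta>>0. \<forall>z'\<in>A. norm (z' - z) \<le> \<delta> \<longrightarrow> zs \<bullet> (z' - z) \<le> \<epsilon> * norm (z' - z)"
proof (rule ccontr)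
  assume "\<not> ?thesis"
  then have "\<exists>z'. z' \<in> A \<and> norm (z' - z) \<le> inverse (real (Suc n)) \<and> zs \<bullet> (z' - z) > \<epsilon> * norm (z' - z)" for n
    by (metis inverse_positive_iff_positive not_le of_nat_0_less_iff zero_less_Suc)
  then obtain Z where Z: "\<And>n. Z n \<in> A" "\<And>n. norm (Z n - z) \<le> inverse (real (Suc n))"
    "\<And>n. zs \<bullet> (Z n - z) > \<epsilon> * norm (Z n - z)" by metis
  define t where "t n = norm (Z n - z)" for n
  have tpos: "t n > 0" for n using Z(3)[of n] by (auto simp: t_def)
  define W where "W n = (Z n - z) /\<^sub>R t n" for n
  have "W n \<in> sphere 0 1" for n using tpos[of n] by (simp add: W_def t_def)
  then obtain w r where w: "w \<in> sphere 0 1" "strict_mono (r :: nat \<Rightarrow> nat)" "(W \<circ> r) \<longlonglongrightarrow> w"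
    using compact_sphere[of 0 1] unfolding compact_def by metis
  have "t \<longlonglongrightarrow> 0"
    by (rule Lim_null_comparison[OF _ LIMSEQ_inverse_real_of_nat])
       (use Z(2) in \<open>auto simp: t_def\<close>)
  then have t0: "(t \<circ> r) \<longlonglongrightarrow> 0" using w(2) by (rule LIMSEQ_subseq_LIMSEQ)
  have "z + t n *\<^sub>R W n = Z n" for n using tpos[of n] by (simp add: W_def)
  then have "w \<in> tangent_cone A z" unfolding tangent_cone_def
    using w(3) t0 tpos Z(1) by (intro CollectI exI[of _ "W \<circ> r"] exI[of _ "t \<circ> r"]) simp
  then have le: "zs \<bullet> w \<le> 0" using assms(1) by (auto simp: normal_cone_def split: if_splits)
  have "zs \<bullet> W n \<ge> \<epsilon>" for n
  proof -
    have "zs \<bullet> W n = (zs \<bullet> (Z n - z)) / t n" by (simp add: W_def divide_inverse mult.commute)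
    then show ?thesis using Z(3)[of n] tpos[of n] unfolding t_def[symmetric] by (simp add: pos_le_divide_eq)
  qed
  moreover have "(\<lambda>n. zs \<bullet> (W \<circ> r) n) \<longlonglongrightarrow> zs \<bullet> w" by (intro tendsto_intros w)
  ultimately have "\<epsilon> \<le> zs \<bullet> w" by (intro LIMSEQ_le_const) auto
  with le \<open>\<epsilon> > 0\<close> show False by simp
qed

lemma normal_cone_local_minimum:
  fixes f :: "'a::euclidean_space \<Rightarrow> real"
  assumes der: "(f has_derivative (\<lambda>d. c \<bullet> d)) (at z)" and "z \<in> A" "\<delta> > 0"
    and min: "\<And>z'. z' \<in> A \<Longrightarrow> dist z' z < \<delta> \<Longrightarrow> f z \<le> f z'"
  shows "- c \<in> normal_cone A z"
proof -
  have "c \<bullet> w \<ge> 0" if "w \<in> tangent_cone A z" for w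
  proof -
    obtain ws t where w: "ws \<longlonglongrightarrow> w" "t \<longlonglongrightarrow> (0::real)" "\<And>i. t i > 0" "\<And>i. z + t i *\<^sub>R ws i \<in> A"
      using \<open>w \<in> tangent_cone A z\<close> unfolding tangent_cone_def by blast
    have zl: "(\<lambda>i. z + t i *\<^sub>R ws i) \<longlonglongrightarrow> z"
      by (rule tendsto_eq_intros w refl)+ simp
    have low: "c \<bullet> w + e * norm w \<ge> 0" if "e > 0" for e
    proof -
      obtain d where d: "d > 0" "\<And>y. norm (y - z) < d \<Longrightarrow> norm (f y - f z - c \<bullet> (y - z)) \<le> e * norm (y - z)"
        using der \<open>e > 0\<close> unfolding has_derivative_at_alt by blast
      have "\<forall>\<^sub>F i in sequentially. dist (z + t i *\<^sub>R ws i) z < min d \<delta>"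
        using tendstoD[OF zl, of "min d \<delta>"] d \<open>\<delta> > 0\<close> by simp
      then have "\<forall>\<^sub>F i in sequentially. 0 \<le> c \<bullet> ws i + e * norm (ws i)"
      proof eventually_elim
        case (elim i)
        then have "f z \<le> f (z + t i *\<^sub>R ws i)" using w(4) by (intro min) auto
        moreover have "\<bar>f (z + t i *\<^sub>R ws i) - f z - c \<bullet> (t i *\<^sub>R ws i)\<bar> \<le> e * norm (t i *\<^sub>R ws i)"
          using d(2)[of "z + t i *\<^sub>R ws i"] elim by (simp add: dist_norm)
        ultimately have "0 \<le> t i * (c \<bullet> ws i + e * norm (ws i))"
          using w(3)[of i] by (simp add: algebra_simps)
        then show ?case using w(3)[of i] by (simp add: zero_le_mult_iff)
      qed
      moreover have "(\<lambda>i. c \<bullet> ws i + e * norm (ws i)) \<longlonglongrightarrow> c \<bullet> w + e * norm w"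
        by (intro tendsto_intros w)
      ultimately show ?thesis by (intro tendsto_lowerbound) auto
    qed
    show "c \<bullet> w \<ge> 0"
    proof (rule ccontr)
      assume "\<not> c \<bullet> w \<ge> 0"
      then have neg: "c \<bullet> w < 0" by simp
      define e where "e = - (c \<bullet> w) / (2 * (norm w + 1))"
      have "norm w + 1 > 0" using norm_ge_zero[of w] by linarith
      then have e: "e > 0" "e * (norm w + 1) = - (c \<bullet> w) / 2" using neg by (auto simp: e_def field_simps)
      then have "e * norm w \<le> - (c \<bullet> w) / 2" by (simp add: algebra_simps)
      with low[OF e(1)] neg show False by linarith
    qed
  qed
  with \<open>z \<in> A\<close> show ?thesis by (auto simp: normal_cone_def)
qed

lemma lip_modulus_leI:
  fixes h :: "real^'n \<Rightarrow> real^'m"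
  assumes "r > 0" and "\<And>x x'. x \<in> ball xbar r \<Longrightarrow> x' \<in> ball xbar r \<Longrightarrow> norm (h x - h x') \<le> L * norm (x - x')"
  shows "lip_modulus h xbar \<le> ereal L"
  unfolding lip_modulus_def
proof (rule Limsup_bounded)
  show "\<forall>\<^sub>F p in at (xbar, xbar) within {(x, x'). x \<noteq> x'}.
    (case p of (x, x') \<Rightarrow> ereal (norm (h x - h x') / norm (x - x'))) \<le> ereal L"
    unfolding eventually_at
  proof (intro exI conjI ballI impI)
    fix p :: "(real^'n) \<times> (real^'n)"
    assume p: "p \<in> {(x, x'). x \<noteq> x'}" and d: "p \<noteq> (xbar, xbar) \<and> dist p (xbar, xbar) < r"
    obtain x x' where px: "p = (x, x')" by (cases p)
    have "dist x xbar < r" "dist x' xbar < r"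
      using d dist_fst_le[of p "(xbar,xbar)"] dist_snd_le[of p "(xbar,xbar)"] unfolding px by auto
    then have "norm (h x - h x') \<le> L * norm (x - x')"
      by (intro assms(2)) (auto simp: dist_commute)
    moreover have "norm (x - x') > 0" using p px by simp
    ultimately show "(case p of (x, x') \<Rightarrow> ereal (norm (h x - h x') / norm (x - x'))) \<le> ereal L"
      unfolding px by (simp add: field_simps)
  qed fact
qed

lemma lip_modulus_lessD:
  fixes h :: "real^'n \<Rightarrow> real^'m"
  assumes "lip_modulus h xbar < ereal L"
  shows "\<exists>r>0. \<forall>x\<in>ball xbar r. \<forall>x'\<in>ball xbar r. norm (h x - h x') \<le> L * norm (x - x')"
proof -
  have "\<forall>\<^sub>F p in at (xbar, xbar) within {(x, x'). x \<noteq> x'}.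
    (case p of (x, x') \<Rightarrow> ereal (norm (h x - h x') / norm (x - x'))) < ereal L"
    using assms unfolding lip_modulus_def by (rule Limsup_lessD)
  then obtain d where d: "d > 0" "\<And>x x'. x \<noteq> x' \<Longrightarrow> dist (x, x') (xbar, xbar) < d \<Longrightarrow>
     norm (h x - h x') / norm (x - x') < L"
    unfolding eventually_at by (fastforce simp: case_prod_beta)
  show ?thesis
  proof (intro exI[of _ "d/2"] conjI ballI)
    fix x x' assume xx: "x \<in> ball xbar (d/2)" "x' \<in> ball xbar (d/2)"
    show "norm (h x - h x') \<le> L * norm (x - x')"
    proof (cases "x = x'")
      case False
      have "dist (x, x') (xbar, xbar) \<le> dist x xbar + dist x' xbar"
        unfolding dist_Pair_Pair by (rule sqrt_sum_squares_le_sum) auto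
      also have "\<dots> < d" using xx by (simp add: dist_commute)
      finally have "norm (h x - h x') / norm (x - x') < L" using d(2) False by blast
      moreover have "norm (x - x') > 0" using False by simp
      ultimately show ?thesis by (simp add: field_simps)
    qed simp
  qed (use d in simp)
qed

lemma bounded_bilinear_matrix_vector_mult:
  "bounded_bilinear (\<lambda>(A :: real^'n^'m) v. A *v v)"
proof (rule bounded_bilinear.intro)
  show "\<exists>K. \<forall>(A :: real^'n^'m) v. norm (A *v v) \<le> norm A * norm v * K"
  proof (intro exI allI)
    fix A :: "real^'n^'m" and v :: "real^'n"
    have "onorm ((*v) A) \<le> real CARD('m) * real CARD('n) * norm A"
    proof (rule onorm_le_matrix_component)
      fix i j show "\<bar>A $ i $ j\<bar> \<le> norm A"
        using component_le_norm_cart[of "A $ i" j] Finite_Cartesian_Product.norm_nth_le[of A i] by linarith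
    qed
    then have "onorm ((*v) A) * norm v \<le> real CARD('m) * real CARD('n) * norm A * norm v"
      by (rule mult_right_mono) simp
    moreover have "norm (A *v v) \<le> onorm ((*v) A) * norm v"
      by (rule onorm) simp
    ultimately show "norm (A *v v) \<le> norm A * norm v * (real CARD('m) * real CARD('n))"
      by (simp add: mult_ac)
  qed
qed (simp_all add: matrix_vector_mult_add_rdistrib matrix_vector_right_distrib
      matrix_vector_mult_scaleR scaleR_matrix_vector_assoc)

text \<open>
  Where \<open>h\<close> is continuously differentiable, the Clarke Jacobian is the single matrix \<open>J x\<close>,
  so the limit in the definition of semismoothness is that of a convergent sequence of
  matrices.
\<close>

lemma C1_around_imp_semismooth_at:
  fixes h :: "real^'n \<Rightarrow> real^'m"
  assumes "C1_around h xbar"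
  shows "semismooth_at h xbar"
proof -
  interpret mv: bounded_bilinear "\<lambda>(A :: real^'n^'m) v. A *v v"
    by (rule bounded_bilinear_matrix_vector_mult)
  obtain U J where U: "open U" "xbar \<in> U"
    and der: "\<And>x. x \<in> U \<Longrightarrow> (h has_derivative (\<lambda>d. J x *v d)) (at x)" and cont: "continuous_on U J"
    using assms unfolding C1_around_def by blast
  have lip: "lipschitz_around h xbar"
  proof -
    obtain r where r: "r > 0" "cball xbar r \<subseteq> U" using U open_contains_cball by blast
    have "compact (J ` cball xbar r)"
      using cont r by (intro compact_continuous_image) (auto intro: continuous_on_subset)
    then obtain M where M: "\<And>x. x \<in> cball xbar r \<Longrightarrow> norm (J x) \<le> M"
      using compact_imp_bounded bounded_iff by (metis imageI)
    obtain K where K: "K > 0" "\<And>(A :: real^'n^'m) v. norm (A *v v) \<le> norm A * norm v * K"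
      using mv.pos_bounded by blast
    have M0: "M \<ge> 0" using order_trans[OF norm_ge_zero M[of xbar]] r by simp
    have "norm (h x - h y) \<le> (M * K) * norm (x - y)" if "x \<in> ball xbar r" "y \<in> ball xbar r" for x y
    proof (rule differentiable_bound[OF convex_ball _ _ that(1,2)])
      fix z assume z: "z \<in> ball xbar r"
      then have zU: "z \<in> U" "z \<in> cball xbar r" using r by auto
      show "(h has_derivative (\<lambda>d. J z *v d)) (at z within ball xbar r)"
        using der[OF zU(1)] by (rule has_derivative_at_withinI)
      show "onorm ((*v) (J z)) \<le> M * K"
      proof (rule onorm_le)
        fix v
        have "norm (J z *v v) \<le> norm (J z) * norm v * K" by (rule K)
        also have "\<dots> \<le> M * norm v * K" using M[OF zU(2)] K by (intro mult_right_mono) auto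
        finally show "norm (J z *v v) \<le> M * K * norm v" by (simp add: mult_ac)
      qed
    qed
    then show ?thesis unfolding lipschitz_around_def
      using r K M0 by (intro exI[of _ "ball xbar r"] exI[of _ "M * K"]) (auto intro!: lipschitz_onI simp: dist_norm)
  qed
  have clarke: "V = J x" if "x \<in> U" "V \<in> clarke_jacobian h x" for x V
  proof -
    let ?S = "{V. \<exists>xs J. xs \<longlonglongrightarrow> x \<and> J \<longlonglongrightarrow> V \<and> (\<forall>k::nat. (h has_derivative (\<lambda>d. J k *v d)) (at (xs k)))}"
    have "?S \<subseteq> {J x}"
    proof safe
      fix V xs Jk assume *: "xs \<longlonglongrightarrow> x" "Jk \<longlonglongrightarrow> V" "\<forall>k::nat. (h has_derivative (\<lambda>d. Jk k *v d)) (at (xs k))"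
      have "\<forall>\<^sub>F k in sequentially. xs k \<in> U" using topological_tendstoD[OF *(1) U(1) \<open>x \<in> U\<close>] .
      then have "\<forall>\<^sub>F k in sequentially. J (xs k) = Jk k"
      proof eventually_elim
        case (elim k)
        have "(\<lambda>d. Jk k *v d) = (\<lambda>d. J (xs k) *v d)"
          using has_derivative_unique[OF *(3)[rule_format] der[OF elim]] .
        then show ?case by (metis matrix_eq)
      qed
      moreover have "(\<lambda>k. J (xs k)) \<longlonglongrightarrow> J x"
        using cont \<open>x \<in> U\<close> U(1) *(1) continuous_on_eq_continuous_at isCont_tendsto_compose by blast
      ultimately have "Jk \<longlonglongrightarrow> J x" using Lim_transform_eventually by blast
      with *(2) show "V = J x" by (rule LIMSEQ_unique)
    qed
    then have "clarke_jacobian h x \<subseteq> convex hull {J x}" unfolding clarke_jacobian_def by (rule hull_mono)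
    with that show ?thesis by auto
  qed
  show ?thesis unfolding semismooth_at_def
  proof (intro conjI lip allI exI impI)
    fix u t us V
    assume A: "t \<longlonglongrightarrow> (0::real) \<and> us \<longlonglongrightarrow> u \<and>
        (\<forall>k::nat. t k > 0 \<and> V k \<in> clarke_jacobian h (xbar + t k *\<^sub>R us k))"
    then have xl: "(\<lambda>k. xbar + t k *\<^sub>R us k) \<longlonglongrightarrow> xbar" by (auto intro!: tendsto_eq_intros)
    have "\<forall>\<^sub>F k in sequentially. xbar + t k *\<^sub>R us k \<in> U" using topological_tendstoD[OF xl U] .
    then have "\<forall>\<^sub>F k in sequentially. J (xbar + t k *\<^sub>R us k) = V k"
      by eventually_elim (metis A clarke)
    moreover have "(\<lambda>k. J (xbar + t k *\<^sub>R us k)) \<longlonglongrightarrow> J xbar"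
      using cont U xl continuous_on_eq_continuous_at isCont_tendsto_compose by blast
    ultimately have "V \<longlonglongrightarrow> J xbar" using Lim_transform_eventually by blast
    then show "(\<lambda>k. V k *v us k) \<longlonglongrightarrow> J xbar *v u" using A by (intro mv.tendsto) auto
  qed
qed

section \<open>Prescribing values and derivatives on disjoint balls\<close>

text \<open>
  The square of the positive part is the simplest \<open>C\<^sup>1\<close> function that vanishes exactly on a
  half line.
\<close>

definition pos_square :: "real \<Rightarrow> real" where
  "pos_square r = (max 0 r)\<^sup>2"

lemma DERIV_pos_square: "(pos_square has_real_derivative 2 * max 0 r) (at r)"
proof (cases r "0::real" rule: linorder_cases)
  case less
  have "((\<lambda>_. 0) has_real_derivative 2 * max 0 r) (at r)" using less by simp
  then show ?thesis
    by (rule has_field_derivative_transform_within_open[where S = "{..<0}"]) (use less in \<open>auto simp: pos_square_def\<close>)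
next
  case greater
  have "((\<lambda>r. r\<^sup>2) has_real_derivative 2 * max 0 r) (at r)"
    using greater by (auto intro!: derivative_eq_intros)
  then show ?thesis
    by (rule has_field_derivative_transform_within_open[where S = "{0<..}"]) (use greater in \<open>auto simp: pos_square_def\<close>)
next
  case equal
  have "((\<lambda>h. pos_square h / h) \<longlongrightarrow> 0) (at 0)"
  proof (rule Lim_null_comparison)
    show "\<forall>\<^sub>F h in at 0. norm (pos_square h / h) \<le> \<bar>h\<bar>"
      unfolding eventually_at_filter
      by (intro always_eventually) (auto simp: pos_square_def max_def power2_eq_square)
    show "((\<lambda>h::real. \<bar>h\<bar>) \<longlongrightarrow> 0) (at 0)" by (auto intro!: tendsto_eq_intros)
  qed
  then show ?thesis using equal by (simp add: has_field_derivative_iff pos_square_def)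
qed

text \<open>
  Applied twice, the square of the positive part produces a bump that is constant near the
  centre. Flatness matters: multiplying an affine map by this bump does not alter the map
  near the centre.
\<close>

lemma flat_bump_exists:
  "\<exists>(\<phi> :: 'a::euclidean_space \<Rightarrow> real) \<phi>'. (\<forall>x. (\<phi> has_derivative \<phi>' x) (at x)) \<and>
     (\<forall>d. continuous_on UNIV (\<lambda>x. \<phi>' x d)) \<and> (\<forall>x. 0 \<le> \<phi> x \<and> \<phi> x \<le> 1) \<and>
     (\<forall>x. norm x \<le> 1/2 \<longrightarrow> \<phi> x = 1) \<and> (\<forall>x. norm x \<ge> 1 \<longrightarrow> \<phi> x = 0) \<and>
     (\<forall>x d. norm x \<ge> 1 \<longrightarrow> \<phi>' x d = 0) \<and> (\<forall>x d. \<bar>\<phi>' x d\<bar> \<le> 16 * norm d)"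
proof -
  define \<phi> :: "'a \<Rightarrow> real" where "\<phi> = (\<lambda>x. pos_square (1 - 4 * pos_square (x \<bullet> x - 1/2)))"
  define \<phi>' :: "'a \<Rightarrow> 'a \<Rightarrow> real" where
    "\<phi>' = (\<lambda>x d. 2 * max 0 (1 - 4 * pos_square (x \<bullet> x - 1/2)) * (- (4 * (2 * max 0 (x \<bullet> x - 1/2) * (2 * (x \<bullet> d))))))"
  have der: "(\<phi> has_derivative \<phi>' x) (at x)" for x
  proof -
    have 1: "((\<lambda>x. x \<bullet> x - 1/2) has_derivative (\<lambda>d. 2 * (x \<bullet> d))) (at x)"
      by (auto intro!: derivative_eq_intros simp: inner_commute)
    have 2: "((\<lambda>x. pos_square (x \<bullet> x - 1/2)) has_derivative (\<lambda>d. 2 * max 0 (x \<bullet> x - 1/2) * (2 * (x \<bullet> d)))) (at x)"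
      using has_derivative_compose[OF 1 DERIV_pos_square[THEN has_field_derivative_imp_has_derivative]] .
    have 3: "((\<lambda>x. 1 - 4 * pos_square (x \<bullet> x - 1/2)) has_derivative (\<lambda>d. - (4 * (2 * max 0 (x \<bullet> x - 1/2) * (2 * (x \<bullet> d)))))) (at x)"
      by (rule has_derivative_eq_rhs[OF has_derivative_diff[OF has_derivative_const has_derivative_mult_right[OF 2]]]) simp
    show ?thesis unfolding \<phi>_def \<phi>'_def
      using has_derivative_compose[OF 3 DERIV_pos_square[THEN has_field_derivative_imp_has_derivative]] .
  qed
  have cps: "continuous_on UNIV pos_square"
    unfolding pos_square_def by (intro continuous_intros)
  have cont: "continuous_on UNIV (\<lambda>x. \<phi>' x d)" for d
    unfolding \<phi>'_def by (intro continuous_intros continuous_on_compose2[OF cps]) auto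
  have out: "1 - 4 * pos_square (x \<bullet> x - 1/2) \<le> 0" if "norm x \<ge> 1" for x :: 'a
  proof -
    have "x \<bullet> x \<ge> 1" using that by (simp add: dot_square_norm one_le_power)
    then have "(x \<bullet> x - 1/2)\<^sup>2 \<ge> (1/2)\<^sup>2" by (intro power_mono) auto
    then show ?thesis using \<open>x \<bullet> x \<ge> 1\<close> by (simp add: pos_square_def power2_eq_square)
  qed
  have ps0: "pos_square r \<ge> 0" for r by (simp add: pos_square_def)
  have b: "\<bar>\<phi>' x d\<bar> \<le> 16 * norm d" for x d
  proof (cases "norm x \<ge> 1")
    case True
    then show ?thesis using out[OF True] by (simp add: \<phi>'_def)
  next
    case False
    have "\<bar>x \<bullet> d\<bar> \<le> norm x * norm d" by (rule Cauchy_Schwarz_ineq2)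
    also have "\<dots> \<le> 1 * norm d" using False by (intro mult_right_mono) auto
    finally have 1: "\<bar>x \<bullet> d\<bar> \<le> norm d" by simp
    have "x \<bullet> x \<le> 1" using False by (simp add: dot_square_norm power_le_one)
    then have 2: "\<bar>max 0 (x \<bullet> x - 1/2)\<bar> \<le> 1/2" by (simp add: max_def)
    have 3: "\<bar>max 0 (1 - 4 * pos_square (x \<bullet> x - 1/2))\<bar> \<le> 1" using ps0 by simp
    have "\<bar>\<phi>' x d\<bar> = 32 * (\<bar>max 0 (1 - 4 * pos_square (x \<bullet> x - 1/2))\<bar> * (\<bar>max 0 (x \<bullet> x - 1/2)\<bar> * \<bar>x \<bullet> d\<bar>))"
      unfolding \<phi>'_def by (simp only: abs_mult abs_minus_cancel) simp
    also have "\<dots> \<le> 32 * (1 * (1/2 * norm d))"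
      using 1 2 3 by (intro mult_left_mono mult_mono) auto
    finally show ?thesis by simp
  qed
  show ?thesis
  proof (intro exI conjI allI impI)
    show "(\<phi> has_derivative \<phi>' x) (at x)" for x by (rule der)
    show "continuous_on UNIV (\<lambda>x. \<phi>' x d)" for d by (rule cont)
    show "0 \<le> \<phi> x" for x by (simp add: \<phi>_def ps0)
    show "\<phi> x \<le> 1" for x
      unfolding \<phi>_def using ps0[of "x \<bullet> x - 1/2"]
      by (subst pos_square_def) (intro power_le_one, auto)
    show "\<phi> x = 1" if "norm x \<le> 1/2" for x
    proof -
      have "x \<bullet> x \<le> (1/2)\<^sup>2" unfolding dot_square_norm using that by (intro power_mono) auto
      then have "x \<bullet> x \<le> 1/2" by (simp add: power2_eq_square)
      then show ?thesis by (simp add: \<phi>_def pos_square_def)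
    qed
    show "\<phi> x = 0" if "norm x \<ge> 1" for x using out[OF that] by (simp add: \<phi>_def pos_square_def[of "1 - _"])
    show "\<phi>' x d = 0" if "norm x \<ge> 1" for x d using out[OF that] by (simp add: \<phi>'_def)
    show "\<bar>\<phi>' x d\<bar> \<le> 16 * norm d" for x d by (rule b)
  qed
qed

text \<open>
  Each affine map is cut off by a rescaled bump. The slope of the bump is of order
  \<open>1 / \<rho> i\<close>, so the bound \<open>\<rho> i * (1/2)^i\<close> on the value makes the derivatives summable,
  uniformly in the point. Hence the sum is \<open>C\<^sup>1\<close> even where the balls accumulate.
\<close>

lemma C1_interpolation:
  fixes a :: "nat \<Rightarrow> 'a::euclidean_space" and c :: "nat \<Rightarrow> 'b::euclidean_space"
  assumes \<rho>: "\<And>i. \<rho> i > 0"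
    and disj: "\<And>i j. i \<noteq> j \<Longrightarrow> ball (a i) (\<rho> i) \<inter> ball (a j) (\<rho> j) = {}"
    and c: "\<And>i. norm (c i) \<le> \<rho> i * (1/2)^i"
    and lin: "\<And>i. linear (M i)" and M: "\<And>i d. norm (M i d) \<le> (1/2)^i * norm d"
  shows "\<exists>(g :: 'a \<Rightarrow> 'b) g'. (\<forall>x. (g has_derivative g' x) (at x)) \<and>
     (\<forall>d. continuous_on UNIV (\<lambda>x. g' x d)) \<and>
     (\<forall>i x. norm (x - a i) \<le> \<rho> i / 2 \<longrightarrow> g x = c i + M i (x - a i)) \<and>
     (\<forall>x. x \<notin> (\<Union>i. ball (a i) (\<rho> i)) \<longrightarrow> g x = 0 \<and> (\<forall>d. g' x d = 0))"
proof -
  obtain \<phi> :: "'a \<Rightarrow> real" and \<phi>' where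
    \<phi>: "\<And>x. (\<phi> has_derivative \<phi>' x) (at x)" "\<And>d. continuous_on UNIV (\<lambda>x. \<phi>' x d)"
      "\<And>x. 0 \<le> \<phi> x" "\<And>x. \<phi> x \<le> 1" "\<And>x. norm x \<le> 1/2 \<Longrightarrow> \<phi> x = 1" "\<And>x. norm x \<ge> 1 \<Longrightarrow> \<phi> x = 0"
      "\<And>x d. norm x \<ge> 1 \<Longrightarrow> \<phi>' x d = 0" "\<And>x d. \<bar>\<phi>' x d\<bar> \<le> 16 * norm d"
    using flat_bump_exists by blast
  have bl: "bounded_linear (M i)" for i using lin[of i] by (rule linear_conv_bounded_linear[THEN iffD1])
  define s where "s i x = (x - a i) /\<^sub>R \<rho> i" for i x
  define f where "f i x = \<phi> (s i x) *\<^sub>R (c i + M i (x - a i))" for i x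
  define f' where "f' i x d = \<phi> (s i x) *\<^sub>R M i d + \<phi>' (s i x) (d /\<^sub>R \<rho> i) *\<^sub>R (c i + M i (x - a i))" for i x d
  have ns: "norm (s i x) = norm (x - a i) / \<rho> i" for i x
    using \<rho>[of i] by (simp add: s_def divide_inverse mult.commute)
  have out: "f i x = 0" "f' i x d = 0" if "x \<notin> ball (a i) (\<rho> i)" for i x d
  proof -
    have "norm (x - a i) \<ge> \<rho> i" using that by (simp add: dist_norm norm_minus_commute)
    then have "norm (s i x) \<ge> 1" using \<rho>[of i] by (simp add: ns)
    then show "f i x = 0" "f' i x d = 0" by (simp_all add: f_def f'_def \<phi>)
  qed
  have fder: "(f i has_derivative f' i x) (at x)" for i x
  proof -
    have s: "(s i has_derivative (\<lambda>d. d /\<^sub>R \<rho> i)) (at x)"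
      unfolding s_def by (auto intro!: derivative_eq_intros)
    have 1: "((\<lambda>x. \<phi> (s i x)) has_derivative (\<lambda>d. \<phi>' (s i x) (d /\<^sub>R \<rho> i))) (at x)"
      using has_derivative_compose[OF s \<phi>(1)] .
    have 2: "((\<lambda>x. c i + M i (x - a i)) has_derivative M i) (at x)"
      by (auto intro!: derivative_eq_intros bounded_linear.has_derivative[OF bl])
    show ?thesis unfolding f_def f'_def by (rule has_derivative_scaleR[OF 1 2])
  qed
  have f'b: "norm (f' i x d) \<le> 33 * (1/2)^i * norm d" for i x d
  proof (cases "x \<in> ball (a i) (\<rho> i)")
    case True
    then have xa: "norm (x - a i) \<le> \<rho> i" by (simp add: dist_norm norm_minus_commute)
    have "norm (c i + M i (x - a i)) \<le> \<rho> i * (1/2)^i + (1/2)^i * norm (x - a i)"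
      using c[of i] M[of i "x - a i"] norm_triangle_ineq[of "c i" "M i (x - a i)"] by linarith
    also have "\<dots> \<le> \<rho> i * (1/2)^i + (1/2)^i * \<rho> i" using xa by simp
    finally have 1: "norm (c i + M i (x - a i)) \<le> 2 * \<rho> i * (1/2)^i" by simp
    have "\<bar>\<phi>' (s i x) (d /\<^sub>R \<rho> i)\<bar> \<le> 16 * (norm d / \<rho> i)"
      using \<phi>(8)[of "s i x" "d /\<^sub>R \<rho> i"] \<rho>[of i] by (simp add: divide_inverse mult.commute)
    then have "norm (\<phi>' (s i x) (d /\<^sub>R \<rho> i) *\<^sub>R (c i + M i (x - a i))) \<le> (16 * (norm d / \<rho> i)) * (2 * \<rho> i * (1/2)^i)"
      unfolding norm_scaleR by (intro mult_mono 1) (use \<rho>[of i] in auto)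
    also have "\<dots> = 32 * (1/2)^i * norm d" using \<rho>[of i] by simp
    finally have 2: "norm (\<phi>' (s i x) (d /\<^sub>R \<rho> i) *\<^sub>R (c i + M i (x - a i))) \<le> 32 * (1/2)^i * norm d" .
    have "norm (\<phi> (s i x) *\<^sub>R M i d) \<le> 1 * ((1/2)^i * norm d)"
      unfolding norm_scaleR using \<phi>(3,4)[of "s i x"] M[of i d] by (intro mult_mono) auto
    with 2 show ?thesis unfolding f'_def
      using norm_triangle_ineq[of "\<phi> (s i x) *\<^sub>R M i d" "\<phi>' (s i x) (d /\<^sub>R \<rho> i) *\<^sub>R (c i + M i (x - a i))"]
      by linarith
  qed (simp add: out)
  have summ: "summable (\<lambda>i. 33 * (1/2)^i * r)" for r :: real
    by (intro summable_mult2 summable_mult summable_geometric) simp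
  have sf': "summable (\<lambda>i. f' i x d)" for x d
    by (rule summable_comparison_test'[OF summ[of "norm d"], of 0]) (use f'b in auto)
  define g' where "g' x d = (\<Sum>i. f' i x d)" for x d
  \<comment> \<open>At every point at most one term of the series is nonzero.\<close>
  have single: "f j x = 0" "f' j x d = 0" if "x \<in> ball (a i) (\<rho> i)" "j \<noteq> i" for i j x d
    using disj[of i j] that by (auto intro!: out)
  have fsums: "\<exists>l. (\<lambda>i. f i x) sums l" for x
  proof (cases "\<exists>i. x \<in> ball (a i) (\<rho> i)")
    case True
    then obtain i where i: "x \<in> ball (a i) (\<rho> i)" by blast
    have "(\<lambda>j. if j = i then f j x else 0) sums f i x" by (rule sums_single)
    moreover have "(\<lambda>j. if j = i then f j x else 0) = (\<lambda>j. f j x)" using single(1)[OF i] by (auto simp: fun_eq_iff)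
    ultimately have "(\<lambda>j. f j x) sums f i x" by simp
    then show ?thesis by blast
  next
    case False
    then have "(\<lambda>i. f i x) = (\<lambda>i. 0)" using out by (auto simp: fun_eq_iff)
    then have "(\<lambda>i. f i x) sums 0" by simp
    then show ?thesis by blast
  qed
  have tail: "norm ((\<Sum>i<n. f' i x d) - g' x d) \<le> 66 * (1/2)^n * norm d" for n x d
  proof -
    have "g' x d - (\<Sum>i<n. f' i x d) = (\<Sum>i. f' (i + n) x d)"
      unfolding g'_def by (rule suminf_minus_initial_segment[OF sf', symmetric])
    then have "norm ((\<Sum>i<n. f' i x d) - g' x d) = norm (\<Sum>i. f' (i + n) x d)"
      by (metis norm_minus_commute)
    also have "\<dots> \<le> (\<Sum>i. 33 * (1/2)^(i+n) * norm d)"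
    proof (rule norm_suminf_le)
      show "norm (f' (i + n) x d) \<le> 33 * (1/2)^(i+n) * norm d" for i by (rule f'b)
      show "summable (\<lambda>i. 33 * (1/2)^(i+n) * norm d)"
        using summ[of "norm d"] by (subst (asm) summable_iff_shift[of _ n, symmetric])
    qed
    also have "(\<Sum>i. 33 * (1/2)^(i+n) * norm d) = (\<Sum>i. (33 * (1/2)^n * norm d) * (1/2)^i)"
      by (simp add: power_add mult_ac)
    also have "\<dots> = (33 * (1/2)^n * norm d) * (\<Sum>i. (1/2)^i)"
      by (rule suminf_mult) simp
    also have "(\<Sum>i. (1/2::real)^i) = 2" by (subst suminf_geometric) auto
    finally show ?thesis by simp
  qed
  obtain g where g: "\<And>x. (\<lambda>i. f i x) sums g x" "\<And>x. (g has_derivative g' x) (at x)"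
  proof -
    obtain l where l: "(\<lambda>i. f i 0) sums l" using fsums by blast
    have "\<exists>g. \<forall>x\<in>UNIV. (\<lambda>i. f i x) sums g x \<and> (g has_derivative g' x) (at x within UNIV)"
    proof (rule has_derivative_series[where S = UNIV and f = f and f' = f' and g' = g' and x = 0 and l = l])
      show "(f n has_derivative f' n x) (at x within UNIV)" for n x by (rule fder)
      fix e :: real assume "e > 0"
      have "(\<lambda>n. 66 * (1/2)^n :: real) \<longlonglongrightarrow> 66 * 0"
        by (intro tendsto_intros LIMSEQ_realpow_zero) auto
      then have "\<forall>\<^sub>F n in sequentially. 66 * (1/2)^n < e"
        using \<open>e > 0\<close> by (intro order_tendstoD(2)) auto
      then show "\<forall>\<^sub>F n in sequentially. \<forall>x\<in>UNIV. \<forall>h. norm ((\<Sum>i<n. f' i x h) - g' x h) \<le> e * norm h"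
      proof eventually_elim
        case (elim n)
        show ?case
        proof (intro ballI allI)
          fix x h :: 'a
          have "66 * (1/2)^n * norm h \<le> e * norm h" using elim by (intro mult_right_mono) auto
          with tail[where n = n and x = x and d = h] show "norm ((\<Sum>i<n. f' i x h) - g' x h) \<le> e * norm h" by linarith
        qed
      qed
    qed (use l in auto)
    then show ?thesis using that by auto
  qed
  have gcont: "continuous_on UNIV (\<lambda>x. g' x d)" for d
  proof -
    have "continuous_on UNIV (\<lambda>x. f' i x d)" for i
    proof -
      have "continuous_on UNIV \<phi>" using \<phi>(1) has_derivative_continuous_on by blast
      moreover have cs: "continuous_on UNIV (s i)" unfolding s_def by (intro continuous_intros)
      ultimately have 1: "continuous_on UNIV (\<lambda>x. \<phi> (s i x))" by (rule continuous_on_compose2) auto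
      have 2: "continuous_on UNIV (\<lambda>x. \<phi>' (s i x) (d /\<^sub>R \<rho> i))"
        using \<phi>(2) cs by (rule continuous_on_compose2) auto
      show ?thesis unfolding f'_def
        by (intro continuous_intros 1 2 bounded_linear.continuous_on[OF bl])
    qed
    then have c: "continuous_on UNIV (\<lambda>x. \<Sum>i<n. f' i x d)" for n by (intro continuous_intros)
    have "uniform_limit UNIV (\<lambda>n x. \<Sum>i<n. f' i x d) (\<lambda>x. g' x d) sequentially"
      unfolding g'_def
      by (rule Weierstrass_m_test[OF _ summ[of "norm d"]]) (use f'b in auto)
    then show ?thesis using c by (intro uniform_limit_theorem[of _ "\<lambda>n x. \<Sum>i<n. f' i x d" sequentially]) auto
  qed
  have gin: "g x = f i x" if "x \<in> ball (a i) (\<rho> i)" for i x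
  proof -
    have "(\<lambda>j. if j = i then f j x else 0) sums f i x" by (rule sums_single)
    moreover have "(\<lambda>j. if j = i then f j x else 0) = (\<lambda>j. f j x)" using single(1)[OF that] by (auto simp: fun_eq_iff)
    ultimately have "(\<lambda>j. f j x) sums f i x" by simp
    with g(1)[of x] show ?thesis by (rule sums_unique2)
  qed
  show ?thesis
  proof (intro exI[of _ g] exI[of _ g'] conjI allI impI g gcont)
    fix i x assume x: "norm (x - a i) \<le> \<rho> i / 2"
    then have "x \<in> ball (a i) (\<rho> i)" using \<rho>[of i] by (simp add: dist_norm norm_minus_commute)
    then have "g x = f i x" by (rule gin)
    moreover have "norm (s i x) \<le> 1/2" using x \<rho>[of i] by (simp add: ns field_simps)
    ultimately show "g x = c i + M i (x - a i)" by (simp add: f_def \<phi>(5))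
  next
    fix x assume x: "x \<notin> (\<Union>i. ball (a i) (\<rho> i))"
    then have "(\<lambda>i. f i x) = (\<lambda>i. 0)" using out by (auto simp: fun_eq_iff)
    then have "(\<lambda>i. f i x) sums 0" by simp
    with g(1)[of x] show "g x = 0" by (rule sums_unique2)
  next
    fix x d assume x: "x \<notin> (\<Union>i. ball (a i) (\<rho> i))"
    then have "(\<lambda>i. f' i x d) = (\<lambda>i. 0)" using out by (auto simp: fun_eq_iff)
    then show "g' x d = 0" by (simp add: g'_def)
  qed
qed

section \<open>Smooth perturbations that destroy subregularity\<close>

lemma C1_perturbation_of_linear:
  fixes A :: "real^'n \<Rightarrow> real^'m" and g :: "real^'n \<Rightarrow> real^'m"
  assumes lin: "linear A" and K: "\<And>d. norm (A d) \<le> K * norm d"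
    and g: "\<And>x. (g has_derivative g' x) (at x)" and cont: "\<And>d. continuous_on UNIV (\<lambda>x. g' x d)"
    and zero: "g xbar = 0" "\<And>d. g' xbar d = 0"
  shows "(\<lambda>x. A (x - xbar) + g x) \<in> F_C1 xbar"
    and "lip_modulus (\<lambda>x. A (x - xbar) + g x) xbar \<le> ereal K"
proof -
  let ?h = "\<lambda>x. A (x - xbar) + g x"
  have bl: "bounded_linear A" using lin by (rule linear_conv_bounded_linear[THEN iffD1])
  have der: "(?h has_derivative (\<lambda>d. A d + g' x d)) (at x)" for x
    by (auto intro!: derivative_eq_intros bounded_linear.has_derivative[OF bl] g)
  have lh: "linear (\<lambda>d. A d + g' x d)" for x
    using has_derivative_bounded_linear[OF der[of x]] bounded_linear.linear by blast
  define J where "J x = matrix (\<lambda>d. A d + g' x d)" for x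
  have J: "J x *v d = A d + g' x d" for x d
    unfolding J_def using matrix_works[OF lh[unfolded linear_matrix_vector_mul_eq[symmetric]]] by simp
  have "continuous_on UNIV J"
    unfolding J_def matrix_def by (intro continuous_on_vec_lambda continuous_intros cont)
  moreover have "(\<lambda>d. A d + g' x d) = (*v) (J x)" for x by (simp add: fun_eq_iff J)
  ultimately have "C1_around ?h xbar"
    unfolding C1_around_def using der by (intro exI[of _ UNIV] exI[of _ J]) simp
  then show "?h \<in> F_C1 xbar" using zero linear_0[OF lin] by (simp add: F_C1_def)
  have "lip_modulus ?h xbar \<le> ereal K + ereal e" if "e > 0" for e
  proof -
    have "((\<lambda>x. \<Sum>b\<in>Basis. norm (g' x b)) \<longlongrightarrow> (\<Sum>b\<in>Basis. norm (g' xbar b))) (at xbar)"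
      using cont by (intro tendsto_intros) (simp add: continuous_on_eq_continuous_at continuous_at)
    then have "\<forall>\<^sub>F x in at xbar. (\<Sum>b\<in>Basis. norm (g' x b)) < e"
      using \<open>e > 0\<close> by (intro order_tendstoD(2)) (auto simp: zero)
    then obtain r where r: "r > 0" "\<And>x. x \<noteq> xbar \<Longrightarrow> dist x xbar < r \<Longrightarrow> (\<Sum>b\<in>Basis. norm (g' x b)) < e"
      unfolding eventually_at by auto
    have small: "norm (g' x d) \<le> e * norm d" if "x \<in> ball xbar r" for x d
    proof -
      have lg: "linear (g' x)" using has_derivative_bounded_linear[OF g] bounded_linear.linear by blast
      have le: "(\<Sum>b\<in>Basis. norm (g' x b)) \<le> e"
        using r(2)[of x] that \<open>e > 0\<close> by (cases "x = xbar") (auto simp: zero dist_commute less_imp_le)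
      have "g' x d = g' x (\<Sum>b\<in>Basis. (d \<bullet> b) *\<^sub>R b)" by (simp add: euclidean_representation)
      also have "\<dots> = (\<Sum>b\<in>Basis. (d \<bullet> b) *\<^sub>R g' x b)"
        by (simp add: linear_sum[OF lg] linear_scale[OF lg])
      also have "norm \<dots> \<le> (\<Sum>b\<in>Basis. norm d * norm (g' x b))"
        by (rule sum_norm_le) (auto intro!: mult_right_mono Basis_le_norm)
      also have "\<dots> = norm d * (\<Sum>b\<in>Basis. norm (g' x b))" by (simp add: sum_distrib_left)
      also have "\<dots> \<le> norm d * e" using le by (intro mult_left_mono) auto
      finally show ?thesis by (simp add: mult.commute)
    qed
    have "lip_modulus ?h xbar \<le> ereal (K + e)"
    proof (rule lip_modulus_leI[OF r(1)])
      fix x x' assume x: "x \<in> ball xbar r" "x' \<in> ball xbar r"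
      show "norm (?h x - ?h x') \<le> (K + e) * norm (x - x')"
      proof (rule differentiable_bound[OF convex_ball _ _ x])
        fix z assume z: "z \<in> ball xbar r"
        show "(?h has_derivative (\<lambda>d. A d + g' z d)) (at z within ball xbar r)"
          using der by (rule has_derivative_at_withinI)
        show "onorm (\<lambda>d. A d + g' z d) \<le> K + e"
        proof (rule onorm_le)
          fix d show "norm (A d + g' z d) \<le> (K + e) * norm d"
            using K[of d] small[OF z, of d] norm_triangle_ineq[of "A d" "g' z d"]
            by (simp add: algebra_simps)
        qed
      qed
    qed
    then show ?thesis by simp
  qed
  then show "lip_modulus ?h xbar \<le> ereal K" using ereal_le_epsilon2 by blast
qed

text \<open>
  Suppose the graph point \<open>(a, b)\<close> has the regular normal \<open>(p, - q)\<close> and a perturbation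
  equals \<open>ybar - b + e *\<^sub>R q + B (s - a)\<close> at \<open>s\<close>, where the adjoint of \<open>B\<close> maps \<open>q\<close> to
  \<open>- p\<close>. A solution \<open>s\<close> of the perturbed inclusion near \<open>a\<close> would be a graph point at which
  the normal has the positive value \<open>e * (q \<bullet> q)\<close>, although this value must be of smaller
  order than the distance to \<open>(a, b)\<close>. So solutions stay at a distance that exceeds \<open>e\<close> by
  any prescribed factor \<open>2 * N\<close>, once \<open>e\<close> is small.
\<close>

lemma normal_excludes_ball:
  fixes F :: "'a::euclidean_space \<Rightarrow> 'b::euclidean_space set"
  assumes nc: "(p, - q) \<in> normal_cone (gph F) (a, b)" and q: "3/4 \<le> norm q" "norm q \<le> 5/4"
    and B: "\<And>d. q \<bullet> B d = - (p \<bullet> d)" "\<And>d. norm (B d) \<le> C * norm d" and "C \<ge> 0" "N > 0" "\<eta> > 0"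
  shows "\<exists>e>0. e \<le> \<eta> \<and> (\<forall>s. norm (s - a) < 2 * N * e \<longrightarrow> b - e *\<^sub>R q - B (s - a) \<notin> F s)"
proof -
  \<comment> \<open>If \<open>norm (s - a) < 2 * N * e\<close>, the graph point belonging to \<open>s\<close> lies within \<open>E * e\<close> of
    \<open>(a, b)\<close>.\<close>
  define E where "E = (C + 1) * (2 * N) + 2"
  have E: "E > 0" unfolding E_def using \<open>C \<ge> 0\<close> \<open>N > 0\<close> by (intro add_nonneg_pos) auto
  obtain \<delta> where \<delta>: "\<delta> > 0" "\<And>z'. z' \<in> gph F \<Longrightarrow> norm (z' - (a, b)) \<le> \<delta> \<Longrightarrow>
      (p, - q) \<bullet> (z' - (a, b)) \<le> (1 / (4 * E)) * norm (z' - (a, b))"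
    using normal_cone_Frechet_ineq[OF nc, of "1 / (4 * E)"] E by auto
  define e where "e = min \<eta> (\<delta> / E)"
  have e: "e > 0" "e \<le> \<eta>" "E * e \<le> \<delta>" using \<delta>(1) E \<open>\<eta> > 0\<close> by (auto simp: e_def min_def field_simps)
  have "b - e *\<^sub>R q - B (s - a) \<notin> F s" if s: "norm (s - a) < 2 * N * e" for s
  proof
    assume "b - e *\<^sub>R q - B (s - a) \<in> F s"
    then have z: "(s, b - e *\<^sub>R q - B (s - a)) \<in> gph F" by (simp add: gph_def)
    have diff: "(s, b - e *\<^sub>R q - B (s - a)) - (a, b) = (s - a, - (e *\<^sub>R q + B (s - a)))" by simp
    have "norm (s - a, - (e *\<^sub>R q + B (s - a))) \<le> norm (s - a) + norm (e *\<^sub>R q + B (s - a))"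
      using norm_Pair_le[of "s - a" "- (e *\<^sub>R q + B (s - a))"] by (metis norm_minus_cancel)
    also have "\<dots> \<le> norm (s - a) + (norm (e *\<^sub>R q) + norm (B (s - a)))"
      by (intro add_left_mono norm_triangle_ineq)
    also have "\<dots> \<le> norm (s - a) + (2 * e + C * norm (s - a))"
    proof -
      have "e * norm q \<le> e * 2" using q(2) e(1) by (intro mult_left_mono) auto
      moreover have "norm (e *\<^sub>R q) = e * norm q" using e(1) by simp
      ultimately show ?thesis using B(2)[of "s - a"] by linarith
    qed
    also have "\<dots> = (C + 1) * norm (s - a) + 2 * e" by (simp add: algebra_simps)
    also have "\<dots> \<le> (C + 1) * (2 * N * e) + 2 * e"
      using s \<open>C \<ge> 0\<close> by (intro add_right_mono mult_left_mono) auto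
    also have "\<dots> = E * e" by (simp add: E_def algebra_simps)
    finally have n: "norm ((s, b - e *\<^sub>R q - B (s - a)) - (a, b)) \<le> E * e" unfolding diff .
    have "(p, - q) \<bullet> ((s, b - e *\<^sub>R q - B (s - a)) - (a, b)) = e * (q \<bullet> q)"
      unfolding diff by (simp add: inner_add_right inner_diff_right B(1))
    then have "e * (q \<bullet> q) \<le> (1 / (4 * E)) * (E * e)"
      using \<delta>(2)[OF z order_trans[OF n e(3)]] n E mult_left_mono[OF n, of "1 / (4 * E)"] by simp
    also have "\<dots> = e * (1/4)" using E by simp
    finally have "q \<bullet> q \<le> 1/4" using e(1) by simp
    moreover have "q \<bullet> q \<ge> (3/4)\<^sup>2" unfolding dot_square_norm using q by (intro power_mono) auto
    ultimately show False by (simp add: power2_eq_square)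
  qed
  with e show ?thesis by blast
qed

text \<open>
  Along a sparse subsequence of the points that define the directional normal, \<open>h\<close> is the
  affine map required by \<open>normal_excludes_ball\<close>, with factors \<open>N\<close> tending to infinity. The
  condition \<open>A u = - v\<close> makes the corrections of the values small relative to the distance
  to the reference point, and the condition on the adjoint makes the corrections of the
  derivative tend to zero; this is what the interpolation lemma demands.
\<close>

lemma C1_perturbation_destroys_subregularity:
  fixes F :: "real^'n \<Rightarrow> (real^'m) set" and A :: "real^'n \<Rightarrow> real^'m"
  assumes gph: "(xbar, ybar) \<in> gph F"
    and dn: "(ustar, - vstar) \<in> dir_normal_cone (gph F) (xbar, ybar) (u, v)"
    and unit: "norm u = 1" "norm vstar = 1"
    and lin: "linear A" and K: "\<And>d. norm (A d) \<le> K * norm d"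
    and Au: "A u = - v" and Av: "\<And>d. vstar \<bullet> A d = - (ustar \<bullet> d)"
  shows "\<exists>h\<in>F_C1 xbar. lip_modulus h xbar \<le> ereal K \<and>
     \<not> metrically_subregular (\<lambda>x. {y + h x | y. y \<in> F x}) xbar ybar"
proof -
  have bl: "bounded_linear A" using lin by (rule linear_conv_bounded_linear[THEN iffD1])
  have K0: "K \<ge> 0" using order_trans[OF norm_ge_zero K[of u]] unit by simp
  obtain t ws zs where t: "t \<longlonglongrightarrow> (0::real)" "\<And>i::nat. t i > 0" and ws: "ws \<longlonglongrightarrow> (u, v)"
    and zs: "zs \<longlonglongrightarrow> (ustar, - vstar)" "\<And>i. zs i \<in> normal_cone (gph F) ((xbar, ybar) + t i *\<^sub>R ws i)"
    using dn unfolding dir_normal_cone_def by blast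
  define U V P Q where "U n = fst (ws n)" and "V n = snd (ws n)" and "P n = fst (zs n)" and "Q n = - snd (zs n)" for n
  have U: "U \<longlonglongrightarrow> u" and V: "V \<longlonglongrightarrow> v" and P: "P \<longlonglongrightarrow> ustar" and Q: "Q \<longlonglongrightarrow> vstar"
    using tendsto_fst[OF ws] tendsto_snd[OF ws] tendsto_fst[OF zs(1)] tendsto_minus[OF tendsto_snd[OF zs(1)]]
    by (simp_all add: U_def[abs_def] V_def[abs_def] P_def[abs_def] Q_def[abs_def])
  define X where "X n = xbar + t n *\<^sub>R U n" for n
  define Y where "Y n = ybar + t n *\<^sub>R V n" for n
  have nc: "(P n, - Q n) \<in> normal_cone (gph F) (X n, Y n)" for n
    using zs(2)[of n] by (simp add: P_def Q_def X_def Y_def U_def V_def plus_prod_def)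
  have XY: "Y n \<in> F (X n)" for n
    using nc[of n] by (auto simp: normal_cone_def gph_def split: if_splits)
  \<comment> \<open>These bound the corrections that \<open>A\<close> needs at the \<open>n\<close>th point: \<open>m n\<close> that of the
    derivative, and \<open>t n * \<sigma> n\<close> that of the value.\<close>
  define m where "m n = (norm (P n - ustar) + K * norm (Q n - vstar)) / norm (Q n)" for n
  define \<sigma> where "\<sigma> n = norm (V n + A (U n))" for n
  have mlim: "m \<longlonglongrightarrow> 0"
  proof -
    have "m \<longlonglongrightarrow> (norm (ustar - ustar) + K * norm (vstar - vstar)) / norm vstar"
      unfolding m_def[abs_def] by (intro tendsto_intros P Q) (use unit in auto)
    then show ?thesis by simp
  qed
  have \<sigma>lim: "\<sigma> \<longlonglongrightarrow> 0"
  proof -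
    have "\<sigma> \<longlonglongrightarrow> norm (v + A u)"
      unfolding \<sigma>_def[abs_def] by (intro tendsto_intros V bounded_linear.tendsto[OF bl U])
    then show ?thesis by (simp add: Au)
  qed
  define good where "good i n \<longleftrightarrow> 3/4 < norm (U n) \<and> norm (U n) < 5/4 \<and> 3/4 < norm (Q n) \<and> norm (Q n) < 5/4 \<and>
     m n < (1/2)^i \<and> \<sigma> n < (1/2)^i / 8 \<and> t n < inverse (real (Suc i))" for i n :: nat
  have good_ev: "\<forall>\<^sub>F n in sequentially. good i n" for i
  proof -
    have Un: "(\<lambda>n. norm (U n)) \<longlonglongrightarrow> 1" and Qn: "(\<lambda>n. norm (Q n)) \<longlonglongrightarrow> 1"
      using tendsto_norm[OF U] tendsto_norm[OF Q] unit by auto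
    show ?thesis unfolding good_def
      by (intro eventually_conj order_tendstoD(1)[OF Un] order_tendstoD(2)[OF Un] order_tendstoD(1)[OF Qn]
          order_tendstoD(2)[OF Qn] order_tendstoD(2)[OF mlim] order_tendstoD(2)[OF \<sigma>lim] order_tendstoD(2)[OF t(1)]) auto
  qed
  \<comment> \<open>The ratio 8 of consecutive distances makes the balls of radius \<open>\<tau> i / 4\<close> disjoint.\<close>
  have "\<exists>f. \<forall>i. good i (f i) \<and> t (f (Suc i)) < t (f i) / 8"
  proof (rule dependent_nat_choice)
    show "\<exists>n. good 0 n" using eventually_happens'[OF sequentially_bot good_ev] .
    fix n i
    have "\<forall>\<^sub>F n' in sequentially. t n' < t n / 8" using t(2)[of n] by (intro order_tendstoD(2)[OF t(1)]) simp
    then have "\<forall>\<^sub>F n' in sequentially. good (Suc i) n' \<and> t n' < t n / 8" using good_ev by (rule eventually_conj[rotated])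
    then show "\<exists>n'. good (Suc i) n' \<and> t n' < t n / 8"
      by (rule eventually_happens'[OF sequentially_bot])
  qed
  then obtain f where f: "\<And>i. good i (f i)" "\<And>i. t (f (Suc i)) < t (f i) / 8" by blast
  have tdec: "t (f j) \<le> t (f i)" if "i \<le> j" for i j
  proof (rule lift_Suc_antimono_le[of "\<lambda>i. t (f i)", OF _ that])
    show "t (f (Suc i)) \<le> t (f i)" for i using f(2)[of i] t(2)[of "f i"] by linarith
  qed
  have t8: "t (f j) < t (f i) / 8" if "i < j" for i j
    using tdec[of "Suc i" j] f(2)[of i] that by simp
  define a p q \<tau> where "a i = X (f i)" and "p i = P (f i)" and "q i = Q (f i)" and "\<tau> i = t (f i)" for i
  define b where "b i = Y (f i)" for i
  define \<rho> where "\<rho> i = \<tau> i / 4" for i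
  have \<tau>0: "\<tau> i > 0" for i using t(2) by (simp add: \<tau>_def)
  have q: "3/4 \<le> norm (q i)" "norm (q i) \<le> 5/4" for i using f(1)[of i] by (auto simp: good_def q_def)
  have q0: "q i \<bullet> q i > 0" "q i \<noteq> 0" for i using q(1)[of i] by auto
  \<comment> \<open>The rank-one correction for which the adjoint of \<open>A + M i\<close> maps \<open>q i\<close> exactly to
    \<open>- p i\<close>.\<close>
  define M where "M i d = ((- (p i \<bullet> d) - q i \<bullet> A d) / (q i \<bullet> q i)) *\<^sub>R q i" for i d
  have Mlin: "linear (M i)" for i
  proof (rule linearI)
    fix x y
    have "(- (p i \<bullet> (x + y)) - q i \<bullet> A (x + y)) / (q i \<bullet> q i)
      = (- (p i \<bullet> x) - q i \<bullet> A x) / (q i \<bullet> q i) + (- (p i \<bullet> y) - q i \<bullet> A y) / (q i \<bullet> q i)"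
      by (simp add: linear_add[OF lin] inner_add_right flip: add_divide_distrib)
    then show "M i (x + y) = M i x + M i y" unfolding M_def by (simp only: scaleR_left_distrib)
  next
    fix r x
    have "(- (p i \<bullet> (r *\<^sub>R x)) - q i \<bullet> A (r *\<^sub>R x)) / (q i \<bullet> q i) = r * ((- (p i \<bullet> x) - q i \<bullet> A x) / (q i \<bullet> q i))"
      by (simp add: linear_scale[OF lin] right_diff_distrib)
    then show "M i (r *\<^sub>R x) = r *\<^sub>R M i x" unfolding M_def by (simp only: scaleR_scaleR)
  qed
  have Mb: "norm (M i d) \<le> (1/2)^i * norm d" for i d
  proof -
    have "- (p i \<bullet> d) - q i \<bullet> A d = - ((p i - ustar) \<bullet> d) - (q i - vstar) \<bullet> A d"
      by (simp add: inner_diff_left Av)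
    also have "\<bar>\<dots>\<bar> \<le> norm (p i - ustar) * norm d + norm (q i - vstar) * norm (A d)"
      using Cauchy_Schwarz_ineq2[of "p i - ustar" d] Cauchy_Schwarz_ineq2[of "q i - vstar" "A d"] by linarith
    also have "\<dots> \<le> norm (p i - ustar) * norm d + norm (q i - vstar) * (K * norm d)"
      by (intro add_left_mono mult_left_mono K) auto
    also have "\<dots> = (norm (p i - ustar) + K * norm (q i - vstar)) * norm d" by (simp add: algebra_simps)
    also have "\<dots> = m (f i) * norm (q i) * norm d" using q0[of i] by (simp add: m_def p_def q_def)
    finally have 1: "\<bar>- (p i \<bullet> d) - q i \<bullet> A d\<bar> \<le> m (f i) * norm (q i) * norm d" .
    have "norm (M i d) = \<bar>- (p i \<bullet> d) - q i \<bullet> A d\<bar> / norm (q i)"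
      using q0[of i] unfolding M_def by (simp add: dot_square_norm power2_eq_square)
    also have "\<dots> \<le> m (f i) * norm d" using 1 q0[of i] by (simp add: field_simps)
    also have "\<dots> \<le> (1/2)^i * norm d" using f(1)[of i] by (intro mult_right_mono) (auto simp: good_def)
    finally show ?thesis .
  qed
  have Bq: "q i \<bullet> (A d + M i d) = - (p i \<bullet> d)" for i d
    using q0[of i] by (simp add: M_def inner_add_right)
  have Bn: "norm (A d + M i d) \<le> (K + 1) * norm d" for i d
  proof -
    have "(1/2)^i * norm d \<le> 1 * norm d" by (intro mult_right_mono power_le_one) auto
    then show ?thesis using K[of d] Mb[of i d] norm_triangle_ineq[of "A d" "M i d"] by (simp add: algebra_simps)
  qed
  define N where "N i = real (Suc i)" for i
  \<comment> \<open>The first bound keeps \<open>2 * N i * e i\<close> inside the flat part of the bump, the second one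
    keeps the shift by \<open>e i\<close> compatible with the decay of the values.\<close>
  define \<eta> where "\<eta> i = min (\<rho> i / (4 * N i)) (\<tau> i * (1/2)^i / 10)" for i
  have \<eta>: "\<eta> i > 0" for i using \<tau>0[of i] by (simp add: \<eta>_def \<rho>_def N_def)
  have "\<exists>e>0. e \<le> \<eta> i \<and> (\<forall>s. norm (s - a i) < 2 * N i * e \<longrightarrow> b i - e *\<^sub>R q i - (A (s - a i) + M i (s - a i)) \<notin> F s)" for i
    by (rule normal_excludes_ball[OF _ q Bq Bn _ _ \<eta>])
       (use K0 nc[of "f i"] in \<open>auto simp: p_def q_def a_def b_def N_def\<close>)
  then obtain e where e: "\<And>i. e i > 0" "\<And>i. e i \<le> \<eta> i"
    "\<And>i s. norm (s - a i) < 2 * N i * e i \<Longrightarrow> b i - e i *\<^sub>R q i - (A (s - a i) + M i (s - a i)) \<notin> F s"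
    by metis
  define c where "c i = ybar - b i + e i *\<^sub>R q i - A (a i - xbar)" for i
  have ax: "a i - xbar = \<tau> i *\<^sub>R U (f i)" for i by (simp add: a_def X_def \<tau>_def)
  have ab: "3/4 * \<tau> i \<le> norm (a i - xbar)" "norm (a i - xbar) \<le> 5/4 * \<tau> i" for i
    using f(1)[of i] \<tau>0[of i] unfolding ax by (auto simp: good_def)
  have cb: "norm (c i) \<le> \<rho> i * (1/2)^i" for i
  proof -
    have "c i = e i *\<^sub>R q i - \<tau> i *\<^sub>R (V (f i) + A (U (f i)))"
      unfolding c_def ax by (simp add: linear_scale[OF lin] b_def Y_def \<tau>_def algebra_simps)
    then have "norm (c i) \<le> norm (e i *\<^sub>R q i) + norm (\<tau> i *\<^sub>R (V (f i) + A (U (f i))))"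
      using norm_triangle_ineq4 by metis
    also have "\<dots> = e i * norm (q i) + \<tau> i * \<sigma> (f i)"
      using e(1)[of i] \<tau>0[of i] by (simp add: \<sigma>_def)
    also have "\<dots> \<le> (\<tau> i * (1/2)^i / 10) * (5/4) + \<tau> i * ((1/2)^i / 8)"
    proof (intro add_mono mult_mono)
      show "e i \<le> \<tau> i * (1/2)^i / 10" using e(2)[of i] by (simp add: \<eta>_def)
      show "\<sigma> (f i) \<le> (1/2)^i / 8" using f(1)[of i] by (simp add: good_def)
    qed (use q[of i] \<tau>0[of i] in \<open>auto simp: \<sigma>_def\<close>)
    also have "\<dots> = \<rho> i * (1/2)^i" by (simp add: \<rho>_def)
    finally show ?thesis .
  qed
  have disj1: "ball (a i) (\<rho> i) \<inter> ball (a j) (\<rho> j) = {}" if "i < j" for i j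
  proof -
    have tj: "\<tau> j < \<tau> i / 8" using t8[OF that] by (simp add: \<tau>_def)
    have "dist (a i) xbar \<le> dist (a i) (a j) + dist (a j) xbar" by (rule dist_triangle)
    then have "\<rho> i + \<rho> j \<le> dist (a i) (a j)"
      using ab(1)[of i] ab(2)[of j] tj \<tau>0[of i] unfolding dist_norm \<rho>_def by linarith
    then show ?thesis by (rule disjoint_ballI)
  qed
  have disj: "ball (a i) (\<rho> i) \<inter> ball (a j) (\<rho> j) = {}" if "i \<noteq> j" for i j
    using disj1[of i j] disj1[of j i] that by (cases "i < j") auto
  have \<rho>0: "\<rho> i > 0" for i using \<tau>0[of i] by (simp add: \<rho>_def)
  obtain g g' where g: "\<And>x. (g has_derivative g' x) (at x)" "\<And>d. continuous_on UNIV (\<lambda>x. g' x d)"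
     "\<And>i x. norm (x - a i) \<le> \<rho> i / 2 \<Longrightarrow> g x = c i + M i (x - a i)"
     "\<And>x. x \<notin> (\<Union>i. ball (a i) (\<rho> i)) \<Longrightarrow> g x = 0" "\<And>x d. x \<notin> (\<Union>i. ball (a i) (\<rho> i)) \<Longrightarrow> g' x d = 0"
    using C1_interpolation[of \<rho> a c M, OF \<rho>0 disj cb Mlin Mb] by blast
  have xout: "xbar \<notin> (\<Union>i. ball (a i) (\<rho> i))"
  proof
    assume "xbar \<in> (\<Union>i. ball (a i) (\<rho> i))"
    then obtain i where "norm (a i - xbar) < \<rho> i" by (auto simp: dist_norm)
    with ab(1)[of i] \<tau>0[of i] show False by (simp add: \<rho>_def)
  qed
  define h where "h x = A (x - xbar) + g x" for x
  have hC: "h \<in> F_C1 xbar" "lip_modulus h xbar \<le> ereal K"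
    using C1_perturbation_of_linear[OF lin K g(1,2) g(4)[OF xout] g(5)[OF xout]]
    by (simp_all add: h_def[abs_def])
  have hnear: "h s = ybar - b i + e i *\<^sub>R q i + (A (s - a i) + M i (s - a i))"
    if "norm (s - a i) \<le> \<rho> i / 2" for s i
  proof -
    have "A (s - xbar) = A (s - a i) + A (a i - xbar)" by (simp flip: linear_add[OF lin])
    then show ?thesis unfolding h_def g(3)[OF that] c_def by simp
  qed
  have h0: "h xbar = 0" using hC(1) by (simp add: F_C1_def)
  let ?G = "\<lambda>x. {y + h x | y. y \<in> F x}"
  have "(xbar, ybar) \<in> gph ?G" using gph h0 by (auto simp: gph_def)
  moreover have "\<exists>x y D. dist x xbar < r \<and> y \<in> ?G x \<and> \<kappa> * dist y ybar < D \<and> (\<forall>s. ybar \<in> ?G s \<longrightarrow> D \<le> dist x s)"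
    if "\<kappa> > 0" "r > 0" for \<kappa> r :: real
  proof -
    obtain k1 :: nat where k1: "\<kappa> < real k1" using reals_Archimedean2 by blast
    obtain k2 :: nat where k2: "inverse (real (Suc k2)) < r / 2" using reals_Archimedean \<open>r > 0\<close> half_gt_zero by blast
    define i where "i = max k1 k2"
    have Ni: "\<kappa> < N i" using k1 by (simp add: N_def i_def)
    have N0: "N i > 0" by (simp add: N_def)
    have "\<tau> i < inverse (real (Suc i))" using f(1)[of i] by (simp add: good_def \<tau>_def)
    also have "\<dots> \<le> inverse (real (Suc k2))" by (simp add: i_def)
    finally have \<tau>r: "\<tau> i < r / 2" using k2 by simp
    show ?thesis
    proof (intro exI conjI allI impI)
      show "dist (a i) xbar < r" using ab(2)[of i] \<tau>r \<open>r > 0\<close> by (simp add: dist_norm)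
      have "h (a i) = ybar - b i + e i *\<^sub>R q i"
        using hnear[of "a i" i] \<rho>0[of i] linear_0[OF lin] linear_0[OF Mlin] by simp
      then show "ybar + e i *\<^sub>R q i \<in> ?G (a i)"
        using XY[of "f i"] by (auto simp: a_def b_def intro!: exI[of _ "Y (f i)"])
      have "\<kappa> * (e i * norm (q i)) < N i * (e i * norm (q i))"
        using Ni e(1)[of i] q0[of i] by (intro mult_strict_right_mono) auto
      also have "\<dots> \<le> N i * (e i * 2)" using N0 e(1)[of i] q(2)[of i] by (intro mult_left_mono) auto
      finally show "\<kappa> * dist (ybar + e i *\<^sub>R q i) ybar < 2 * N i * e i"
        using e(1)[of i] by (simp add: dist_norm mult_ac)
      fix s assume "ybar \<in> ?G s"
      then obtain y where y: "y \<in> F s" "ybar = y + h s" by blast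
      show "2 * N i * e i \<le> dist (a i) s"
      proof (rule ccontr)
        assume "\<not> ?thesis"
        then have lt: "norm (s - a i) < 2 * N i * e i" by (simp add: dist_norm norm_minus_commute)
        have "e i \<le> \<rho> i / (4 * N i)" using e(2)[of i] by (simp add: \<eta>_def)
        then have "2 * N i * e i \<le> \<rho> i / 2" using N0 by (simp add: field_simps)
        then have hs: "h s = ybar - b i + e i *\<^sub>R q i + (A (s - a i) + M i (s - a i))"
          using lt by (intro hnear) simp
        have "y = ybar - h s" using y(2) by simp
        then have "y = b i - e i *\<^sub>R q i - (A (s - a i) + M i (s - a i))"
          unfolding hs by (simp add: diff_diff_eq2)
        with e(3)[OF lt] y(1) show False by simp
      qed
    qed
  qed
  ultimately have "\<not> metrically_subregular ?G xbar ybar"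
    using not_metrically_subregular_iff by blast
  with hC show ?thesis by blast
qed

section \<open>Semismoothness as convergence of derivatives along directions\<close>

lemma derivative_hullD:
  assumes "derivative_hull k \<epsilon> x D"
    and "\<And>z D'. dist z x \<le> \<epsilon> \<Longrightarrow> (k has_derivative D') (at z) \<Longrightarrow> norm (D' d - l) \<le> \<delta>"
  shows "norm (D d - l) \<le> \<delta>"
  using assms unfolding derivative_hull_def by blast

lemma derivative_hull_mono:
  "derivative_hull k \<epsilon> x D \<Longrightarrow> \<epsilon> \<le> \<epsilon>' \<Longrightarrow> derivative_hull k \<epsilon>' x D"
  unfolding derivative_hull_def by (meson order_trans)

lemma derivative_hull_norm_le:
  assumes "L-lipschitz_on UNIV k" "derivative_hull k \<epsilon> x D"
  shows "norm (D d) \<le> L * norm d"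
  using derivative_hullD[OF assms(2), of d 0 "L * norm d"] norm_derivative_le_Lipschitz[OF assms(1)] by simp

text \<open>
  What semismoothness says about the points of differentiability alone, that is, without
  convex hulls and limits of derivatives.
\<close>

definition radial_derivative_limit ::
    "('a::real_normed_vector \<Rightarrow> 'b::real_normed_vector) \<Rightarrow> 'a \<Rightarrow> 'a \<Rightarrow> 'b \<Rightarrow> bool" where
  "radial_derivative_limit k xbar u l \<longleftrightarrow> (\<forall>\<delta>>0. \<exists>\<tau>>0. \<forall>t u' D.
     0 < t \<and> t < \<tau> \<and> norm (u' - u) < \<tau> \<and> (k has_derivative D) (at (xbar + t *\<^sub>R u')) \<longrightarrow> norm (D u' - l) \<le> \<delta>)"

lemma semismooth_at_imp_radial_derivative_limit:
  fixes h :: "real^'n \<Rightarrow> real^'m"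
  assumes "semismooth_at h xbar"
  shows "\<exists>l. radial_derivative_limit h xbar u l"
proof -
  from assms have "\<exists>l. \<forall>t us V. t \<longlonglongrightarrow> (0::real) \<and> us \<longlonglongrightarrow> u \<and>
        (\<forall>k::nat. t k > 0 \<and> V k \<in> clarke_jacobian h (xbar + t k *\<^sub>R us k)) \<longrightarrow> (\<lambda>k. V k *v us k) \<longlonglongrightarrow> l"
    unfolding semismooth_at_def by (elim conjE allE[of _ u])
  then obtain l where l: "\<forall>t us V. t \<longlonglongrightarrow> (0::real) \<and> us \<longlonglongrightarrow> u \<and>
        (\<forall>k::nat. t k > 0 \<and> V k \<in> clarke_jacobian h (xbar + t k *\<^sub>R us k)) \<longrightarrow> (\<lambda>k. V k *v us k) \<longlonglongrightarrow> l" ..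
  have "radial_derivative_limit h xbar u l"
  proof (rule ccontr)
    assume "\<not> radial_derivative_limit h xbar u l"
    then obtain \<delta> where \<delta>: "\<delta> > 0" and bad: "\<not> (\<exists>\<tau>>0. \<forall>t u' D. 0 < t \<and> t < \<tau> \<and> norm (u' - u) < \<tau> \<and>
        (h has_derivative D) (at (xbar + t *\<^sub>R u')) \<longrightarrow> norm (D u' - l) \<le> \<delta>)"
      unfolding radial_derivative_limit_def not_all not_imp by (elim exE conjE)
    define Bad where "Bad n z \<longleftrightarrow> (case z of (t, u', D) \<Rightarrow> 0 < t \<and> t < inverse (real (Suc n)) \<and>
        norm (u' - u) < inverse (real (Suc n)) \<and>
        (h has_derivative D) (at (xbar + t *\<^sub>R u')) \<and> \<not> norm (D u' - l) \<le> \<delta>)" for n z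
    have "\<exists>z. Bad n z" for n
    proof (rule ccontr)
      assume no: "\<nexists>z. Bad n z"
      have "\<exists>\<tau>>0. \<forall>t u' D. 0 < t \<and> t < \<tau> \<and> norm (u' - u) < \<tau> \<and>
        (h has_derivative D) (at (xbar + t *\<^sub>R u')) \<longrightarrow> norm (D u' - l) \<le> \<delta>"
      proof (intro exI[of _ "inverse (real (Suc n))"] conjI allI impI)
        fix t u' D assume "0 < t \<and> t < inverse (real (Suc n)) \<and> norm (u' - u) < inverse (real (Suc n)) \<and>
          (h has_derivative D) (at (xbar + t *\<^sub>R u'))"
        moreover have "\<not> Bad n (t, u', D)" using no by blast
        ultimately show "norm (D u' - l) \<le> \<delta>" by (simp add: Bad_def)
      qed simp
      with bad show False by contradiction
    qed
    then have "\<forall>n. \<exists>z. Bad n z" by blast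
    then obtain z where z: "\<forall>n. Bad n (z n)" by (rule choice[THEN exE])
    define t us D where "t n = fst (z n)" and "us n = fst (snd (z n))" and "D n = snd (snd (z n))" for n
    have s: "0 < t n" "t n < inverse (real (Suc n))" "norm (us n - u) < inverse (real (Suc n))"
        "(h has_derivative D n) (at (xbar + t n *\<^sub>R us n))" "\<not> norm (D n (us n) - l) \<le> \<delta>" for n
      using z[rule_format, of n] by (simp_all add: Bad_def t_def us_def D_def case_prod_beta)
    have Dl: "matrix (D n) *v d = D n d" for n d
      using has_derivative_bounded_linear[OF s(4)[of n]] bounded_linear.linear
      by (intro matrix_works) (auto simp: linear_matrix_vector_mul_eq)
    have t0: "t \<longlonglongrightarrow> 0"
      by (rule Lim_null_comparison[OF _ LIMSEQ_inverse_real_of_nat])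
         (use s(1,2) in \<open>auto simp: abs_of_pos less_imp_le\<close>)
    have "(\<lambda>n. us n - u) \<longlonglongrightarrow> 0"
      by (rule Lim_null_comparison[OF _ LIMSEQ_inverse_real_of_nat])
         (use s(3) in \<open>auto simp: less_imp_le\<close>)
    then have u0: "us \<longlonglongrightarrow> u" by (rule LIM_zero_cancel)
    have "matrix (D n) \<in> clarke_jacobian h (xbar + t n *\<^sub>R us n)" for n
    proof -
      have "(h has_derivative (\<lambda>d. matrix (D n) *v d)) (at (xbar + t n *\<^sub>R us n))"
        using s(4)[of n] unfolding Dl .
      then show ?thesis unfolding clarke_jacobian_def
        by (intro hull_inc CollectI exI[of _ "\<lambda>_. xbar + t n *\<^sub>R us n"] exI[of _ "\<lambda>_. matrix (D n)"]) auto
    qed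
    then have "(\<lambda>n. matrix (D n) *v us n) \<longlonglongrightarrow> l"
      using s(1) t0 u0 l[rule_format, of t us "\<lambda>n. matrix (D n)"] by simp
    then have "(\<lambda>n. D n (us n)) \<longlonglongrightarrow> l" by (simp add: Dl)
    then have "\<forall>\<^sub>F n in sequentially. dist (D n (us n)) l < \<delta>" using \<delta> by (rule tendstoD)
    then obtain n where "dist (D n (us n)) l < \<delta>" using eventually_happens'[OF sequentially_bot] by blast
    with s(5)[of n] show False by (simp add: dist_norm)
  qed
  then show ?thesis ..
qed

text \<open>
  The estimate extends from derivatives to averages of derivatives over balls whose radius
  is small relative to \<open>t\<close>, because the direction changes little within such a ball.
\<close>

lemma radial_derivative_limit_hull:
  assumes lip: "L-lipschitz_on UNIV k" and rl: "radial_derivative_limit k xbar u l" and "\<delta> > 0"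
  shows "\<exists>\<tau>>0. \<forall>t u' \<epsilon> D. 0 < t \<and> t < \<tau> \<and> norm (u' - u) < \<tau> \<and> \<epsilon> \<le> \<tau> * t \<and>
      derivative_hull k \<epsilon> (xbar + t *\<^sub>R u') D \<longrightarrow> norm (D u' - l) \<le> \<delta>"
proof -
  have L0: "L \<ge> 0" using lip lipschitz_on_nonneg by blast
  have "\<delta> / 2 > 0" using \<open>\<delta> > 0\<close> by simp
  then have "\<exists>\<tau>>0. \<forall>t u' D. 0 < t \<and> t < \<tau> \<and> norm (u' - u) < \<tau> \<and>
     (k has_derivative D) (at (xbar + t *\<^sub>R u')) \<longrightarrow> norm (D u' - l) \<le> \<delta> / 2"
    using rl unfolding radial_derivative_limit_def by (elim allE[of _ "\<delta> / 2"]) (rule mp)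
  then obtain \<tau> where \<tau>: "\<tau> > 0" and \<tau>bound: "\<forall>t u' D. 0 < t \<and> t < \<tau> \<and> norm (u' - u) < \<tau> \<and>
     (k has_derivative D) (at (xbar + t *\<^sub>R u')) \<longrightarrow> norm (D u' - l) \<le> \<delta> / 2"
    by (elim exE conjE)
  define \<tau>' where "\<tau>' = min (\<tau> / 2) (\<delta> / (2 * (L + 1)))"
  have \<tau>': "\<tau>' > 0" "\<tau>' \<le> \<tau> / 2" "\<tau>' \<le> \<delta> / (2 * (L + 1))"
  proof -
    show "\<tau>' > 0" unfolding \<tau>'_def using \<tau> \<open>\<delta> > 0\<close> L0 by simp
    show "\<tau>' \<le> \<tau> / 2" unfolding \<tau>'_def by (rule min.cobounded1)
    show "\<tau>' \<le> \<delta> / (2 * (L + 1))" unfolding \<tau>'_def by (rule min.cobounded2)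
  qed
  have "L * \<tau>' \<le> (L + 1) * \<tau>'" using \<tau>' by (simp add: mult_right_mono)
  also have "\<dots> \<le> \<delta> / 2" using \<tau>'(3) L0 by (simp add: field_simps)
  finally have L\<tau>: "L * \<tau>' \<le> \<delta> / 2" .
  have main: "norm (D u' - l) \<le> \<delta>"
    if A: "0 < t" "t < \<tau>'" "norm (u' - u) < \<tau>'" "\<epsilon> \<le> \<tau>' * t" "derivative_hull k \<epsilon> (xbar + t *\<^sub>R u') D" for t u' \<epsilon> D
  proof (rule derivative_hullD[OF A(5)])
    fix z D' assume z: "dist z (xbar + t *\<^sub>R u') \<le> \<epsilon>" and D': "(k has_derivative D') (at z)"
    define u2 where "u2 = (z - xbar) /\<^sub>R t"
    have zu: "z = xbar + t *\<^sub>R u2" using A(1) by (simp add: u2_def)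
    have "t * norm (u2 - u') = norm (t *\<^sub>R (u2 - u'))" using A(1) by simp
    also have "\<dots> = dist z (xbar + t *\<^sub>R u')" by (simp add: zu dist_norm scaleR_diff_right)
    also have "\<dots> \<le> t * \<tau>'" using z A(4) by (simp add: mult.commute)
    finally have u2: "norm (u2 - u') \<le> \<tau>'" using A(1) by simp
    have "norm (u2 - u) < \<tau>"
      using u2 A(3) \<tau>'(2) norm_triangle_ineq[of "u2 - u'" "u' - u"] by simp
    then have 1: "norm (D' u2 - l) \<le> \<delta> / 2"
      using \<tau>bound[rule_format, of t u2 D'] A \<tau>' D' by (simp add: zu)
    have "norm (D' (u' - u2)) \<le> L * norm (u' - u2)" by (rule norm_derivative_le_Lipschitz[OF lip D'])
    also have "\<dots> \<le> L * \<tau>'" using u2 L0 by (intro mult_left_mono) (auto simp: norm_minus_commute)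
    finally have 2: "norm (D' (u' - u2)) \<le> \<delta> / 2" using L\<tau> by simp
    have eq: "D' u' - l = D' (u' - u2) + (D' u2 - l)"
      using has_derivative_bounded_linear[OF D'] by (simp add: linear_simps)
    then show "norm (D' u' - l) \<le> \<delta>"
      unfolding eq using 1 2 norm_triangle_ineq[of "D' (u' - u2)" "D' u2 - l"] by linarith
  qed
  show ?thesis
  proof (intro exI[of _ \<tau>'] conjI allI impI \<tau>'(1), elim conjE)
    fix t u' \<epsilon> D
    assume "0 < t" "t < \<tau>'" "norm (u' - u) < \<tau>'" "\<epsilon> \<le> \<tau>' * t" "derivative_hull k \<epsilon> (xbar + t *\<^sub>R u') D"
    then show "norm (D u' - l) \<le> \<delta>" by (rule main)
  qed
qed

text \<open>
  Away from the reference point an average \<open>g\<close> of \<open>k\<close> obeys the mean value inequality with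
  derivative close to \<open>l\<close>. On the initial piece of the segment, a small fraction of it, the
  Lipschitz bound suffices.
\<close>

lemma radial_derivative_limit_imp_directional:
  fixes k :: "'a::euclidean_space \<Rightarrow> 'b::euclidean_space"
  assumes lip: "L-lipschitz_on UNIV k" and rl: "radial_derivative_limit k xbar u l" and "norm u = 1" and "e > 0"
  shows "\<exists>\<tau>>0. \<forall>t. 0 < t \<and> t < \<tau> \<longrightarrow> norm (k (xbar + t *\<^sub>R u) - k xbar - t *\<^sub>R l) \<le> e * t"
proof -
  have L0: "L \<ge> 0" using lip lipschitz_on_nonneg by blast
  define \<delta> where "\<delta> = min 1 (e / (3 * L + 1 + norm l))"
  have den: "3 * L + 1 + norm l > 0" using L0 norm_ge_zero[of l] by linarith
  then have \<delta>: "\<delta> > 0" "\<delta> \<le> 1" using \<open>e > 0\<close> by (auto simp: \<delta>_def)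
  have \<delta>e: "(3 * L + 1 + norm l) * \<delta> \<le> e"
  proof -
    have "\<delta> \<le> e / (3 * L + 1 + norm l)" by (simp add: \<delta>_def)
    then show ?thesis using den by (simp add: pos_le_divide_eq mult.commute)
  qed
  obtain \<tau> where \<tau>: "\<tau> > 0" and \<tau>bound: "\<forall>t u' \<epsilon> D. 0 < t \<and> t < \<tau> \<and> norm (u' - u) < \<tau> \<and> \<epsilon> \<le> \<tau> * t \<and>
      derivative_hull k \<epsilon> (xbar + t *\<^sub>R u') D \<longrightarrow> norm (D u' - l) \<le> \<delta>"
    using radial_derivative_limit_hull[OF lip rl \<delta>(1)] by (elim exE conjE)
  have kl: "norm (k x - k y) \<le> L * norm (x - y)" for x y
    using lipschitz_onD[OF lip, of x y] by (simp add: dist_norm)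
  have "norm (k (xbar + t *\<^sub>R u) - k xbar - t *\<^sub>R l) \<le> e * t" if t: "0 < t" "t < \<tau>" for t
  proof -
    \<comment> \<open>The radius is small relative to every point of the segment beyond \<open>\<delta> * t\<close>.\<close>
    define \<epsilon> where "\<epsilon> = min \<tau> 1 * (\<delta> * t)"
    have \<epsilon>: "\<epsilon> > 0" "\<epsilon> \<le> \<delta> * t" "\<epsilon> \<le> \<tau> * (\<delta> * t)"
      using \<tau> \<delta> t by (auto simp: \<epsilon>_def mult_left_le_one_le intro!: mult_right_mono)
    have \<delta>t: "\<delta> * t > 0" "\<delta> * t \<le> t" using \<delta> t by auto
    obtain g where g: "\<And>x. norm (g x - k x) \<le> L * \<epsilon>"
      "\<And>x. \<exists>D. (g has_derivative D) (at x) \<and> derivative_hull k \<epsilon> x D"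
      using average_differentiable[OF lip \<epsilon>(1)] by blast
    obtain D where D: "\<And>x. (g has_derivative D x) (at x)" "\<And>x. derivative_hull k \<epsilon> x (D x)"
      using g(2) by metis
    define \<psi> where "\<psi> s = g (xbar + s *\<^sub>R u) - s *\<^sub>R l" for s
    have "norm (\<psi> t - \<psi> (\<delta> * t)) \<le> \<delta> * norm (t - \<delta> * t)"
    proof (rule differentiable_bound[of "{\<delta> * t..t}" \<psi> "\<lambda>s r. D (xbar + s *\<^sub>R u) (r *\<^sub>R u) - r *\<^sub>R l"])
      fix s assume s: "s \<in> {\<delta> * t..t}"
      have "((\<lambda>s. xbar + s *\<^sub>R u) has_derivative (\<lambda>r. r *\<^sub>R u)) (at s)" by (auto intro!: derivative_eq_intros)
      from has_derivative_compose[OF this D(1)]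
      have "(\<psi> has_derivative (\<lambda>r. D (xbar + s *\<^sub>R u) (r *\<^sub>R u) - r *\<^sub>R l)) (at s)"
        unfolding \<psi>_def[abs_def] by (auto intro!: derivative_eq_intros)
      then show "(\<psi> has_derivative (\<lambda>r. D (xbar + s *\<^sub>R u) (r *\<^sub>R u) - r *\<^sub>R l)) (at s within {\<delta> * t..t})"
        by (rule has_derivative_at_withinI)
      show "onorm (\<lambda>r. D (xbar + s *\<^sub>R u) (r *\<^sub>R u) - r *\<^sub>R l) \<le> \<delta>"
      proof (cases "s < \<tau>")
        case True
        have s0: "s > 0" using s \<delta>t by auto
        have "\<tau> * (\<delta> * t) \<le> \<tau> * s" using s \<tau> by (intro mult_left_mono) auto
        then have "\<epsilon> \<le> \<tau> * s" using \<epsilon>(3) by linarith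
        then have "norm (D (xbar + s *\<^sub>R u) u - l) \<le> \<delta>"
          using \<tau>bound[rule_format, of s u \<epsilon>] s0 True \<tau> D(2) by simp
        then have "\<bar>r\<bar> * norm (D (xbar + s *\<^sub>R u) u - l) \<le> \<delta> * \<bar>r\<bar>" for r
          by (subst mult.commute) (simp add: mult_right_mono)
        moreover have "D (xbar + s *\<^sub>R u) (r *\<^sub>R u) - r *\<^sub>R l = r *\<^sub>R (D (xbar + s *\<^sub>R u) u - l)" for r
          using has_derivative_bounded_linear[OF D(1)[of "xbar + s *\<^sub>R u"]] by (simp add: linear_simps scaleR_diff_right)
        ultimately show ?thesis
          by (intro onorm_le) simp
      qed (use s t in auto)
    qed (use \<delta>t in auto)
    also have "\<dots> \<le> \<delta> * t" using \<delta>t \<delta> by (intro mult_left_mono) auto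
    finally have 1: "norm (g (xbar + t *\<^sub>R u) - g (xbar + (\<delta> * t) *\<^sub>R u) - (t - \<delta> * t) *\<^sub>R l) \<le> \<delta> * t"
      by (simp add: \<psi>_def algebra_simps)
    have L\<epsilon>: "L * \<epsilon> \<le> L * (\<delta> * t)" using \<epsilon>(2) L0 by (rule mult_left_mono)
    have 2: "norm (k (xbar + t *\<^sub>R u) - g (xbar + t *\<^sub>R u)) \<le> L * (\<delta> * t)"
      using g(1)[of "xbar + t *\<^sub>R u"] L\<epsilon> by (metis norm_minus_commute order_trans)
    have 3: "norm (g (xbar + (\<delta> * t) *\<^sub>R u) - k (xbar + (\<delta> * t) *\<^sub>R u)) \<le> L * (\<delta> * t)"
      using g(1) L\<epsilon> order_trans by blast
    have 4: "norm (k (xbar + (\<delta> * t) *\<^sub>R u) - k xbar) \<le> L * (\<delta> * t)"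
      using kl[of "xbar + (\<delta> * t) *\<^sub>R u" xbar] \<open>norm u = 1\<close> \<delta>t by simp
    have 5: "norm ((\<delta> * t) *\<^sub>R l) = (\<delta> * t) * norm l" using \<delta>t by simp
    have "k (xbar + t *\<^sub>R u) - k xbar - t *\<^sub>R l =
       (k (xbar + t *\<^sub>R u) - g (xbar + t *\<^sub>R u))
       + (g (xbar + t *\<^sub>R u) - g (xbar + (\<delta> * t) *\<^sub>R u) - (t - \<delta> * t) *\<^sub>R l)
       + (g (xbar + (\<delta> * t) *\<^sub>R u) - k (xbar + (\<delta> * t) *\<^sub>R u))
       + (k (xbar + (\<delta> * t) *\<^sub>R u) - k xbar) - (\<delta> * t) *\<^sub>R l"
      by (simp add: scaleR_left_diff_distrib)
    also have "norm \<dots> \<le> L * (\<delta> * t) + \<delta> * t + L * (\<delta> * t) + L * (\<delta> * t) + (\<delta> * t) * norm l"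
      unfolding 5[symmetric]
      by (intro order_trans[OF norm_triangle_ineq4] add_mono order_trans[OF norm_triangle_ineq] 1 2 3 4 order_refl)
    also have "\<dots> = ((3 * L + 1 + norm l) * \<delta>) * t" by (simp add: algebra_simps)
    also have "\<dots> \<le> e * t" using \<delta>e t by (intro mult_right_mono) auto
    finally show ?thesis .
  qed
  with \<tau> show ?thesis by blast
qed

section \<open>Regular normals where subregularity fails\<close>

text \<open>
  A minimiser of \<open>norm (y + g x - ybar) + c * (norm (x - x0))\<^sup>2\<close> over the graph, with \<open>g\<close> an
  average of \<open>k\<close>. The small residual at the start keeps it within \<open>D / 2\<close> of \<open>x0\<close>. There are
  no solutions there, so the norm is differentiable at the residual and the negative
  gradient is a regular normal of the graph.
\<close>

lemma variational_normal:
  fixes F :: "'a::euclidean_space \<Rightarrow> 'b::euclidean_space set" and k :: "'a \<Rightarrow> 'b"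
  assumes lip: "L-lipschitz_on UNIV k" and cl: "closed (gph F)" and y0: "y0 \<in> F x0"
    and "D > 0" "\<kappa> > 0" and res: "\<kappa> * norm (y0 + k x0 - ybar) < D"
    and nosol: "\<And>s. norm (s - x0) \<le> D / 2 \<Longrightarrow> ybar - k s \<notin> F s" and "\<epsilon>0 > 0"
  shows "\<exists>x y A w p. norm (x - x0) < D / 2 \<and> norm (y + k x - ybar) \<le> 2 * D / \<kappa> \<and>
     linear A \<and> derivative_hull k \<epsilon>0 x A \<and> norm w = 1 \<and> (p, - w) \<in> normal_cone (gph F) (x, y) \<and>
     (\<forall>d. \<bar>p \<bullet> d + w \<bullet> A d\<bar> \<le> 4 / \<kappa> * norm d)"
proof -
  have L0: "L \<ge> 0" using lip lipschitz_on_nonneg by blast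
  have kl: "norm (k x - k y) \<le> L * norm (x - y)" for x y
    using lipschitz_onD[OF lip, of x y] by (simp add: dist_norm)
  have kc: "continuous_on UNIV k" using lip lipschitz_on_continuous_on by blast
  define q where "q = D / \<kappa>"
  have q: "q > 0" using assms by (simp add: q_def)
  define p0 where "p0 = norm (y0 + k x0 - ybar)"
  have p0: "0 \<le> p0" "p0 < q" using res \<open>\<kappa> > 0\<close> by (auto simp: p0_def q_def field_simps)
  \<comment> \<open>The bound \<open>R\<close> makes the domain compact without being active at the minimiser.\<close>
  define R where "R = 3 * q + norm (k x0) + L * D"
  define C where "C = gph F \<inter> (cball x0 (D/2) \<times> cball ybar R)"
  have C: "compact C" unfolding C_def by (intro closed_Int_compact cl compact_Times compact_cball)
  have R0: "norm (k x0) + 2 * q < R" "norm (k x0) + L * D + 2 * q < R"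
    using q L0 \<open>D > 0\<close> by (auto simp: R_def add_pos_nonneg)
  have C0: "(x0, y0) \<in> C"
  proof -
    have "norm (y0 - ybar) \<le> p0 + norm (k x0)"
      using norm_triangle_ineq4[of "y0 + k x0 - ybar" "k x0"] by (simp add: p0_def)
    then have "dist ybar y0 \<le> R" using p0 R0 q by (simp add: dist_norm norm_minus_commute)
    then show ?thesis using y0 \<open>D > 0\<close> by (simp add: C_def gph_def)
  qed
  have kf: "continuous_on X (\<lambda>z. k (fst z))" for X :: "('a \<times> 'b) set"
    by (rule continuous_on_compose2[OF kc]) (auto intro!: continuous_intros)
  have "continuous_on C (\<lambda>z. norm (snd z + k (fst z) - ybar))"
    by (intro continuous_intros kf)
  then obtain z1 where z1: "z1 \<in> C" "\<And>z. z \<in> C \<Longrightarrow> norm (snd z1 + k (fst z1) - ybar) \<le> norm (snd z + k (fst z) - ybar)"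
    using continuous_attains_inf[OF C] C0 by blast
  \<comment> \<open>The residual of \<open>k\<close> is bounded away from zero on \<open>C\<close>; averages closer to \<open>k\<close> than this
    bound have no zero residual either.\<close>
  define m where "m = norm (snd z1 + k (fst z1) - ybar)"
  have m: "m > 0"
  proof -
    have "ybar - k (fst z1) \<notin> F (fst z1)"
      using z1(1) by (intro nosol) (auto simp: C_def dist_norm norm_minus_commute)
    moreover have "snd z1 \<in> F (fst z1)" using z1(1) by (auto simp: C_def gph_def)
    ultimately have "snd z1 \<noteq> ybar - k (fst z1)" by auto
    then show ?thesis by (simp add: m_def eq_diff_eq)
  qed
  define \<zeta> where "\<zeta> = min (m / 2) ((q - p0) / 2)"
  have \<zeta>: "\<zeta> > 0" "\<zeta> < m" "p0 + \<zeta> < q" using m p0 by (auto simp: \<zeta>_def min_def field_simps)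
  define \<epsilon> where "\<epsilon> = min \<epsilon>0 (\<zeta> / (L + 1))"
  have \<epsilon>: "\<epsilon> > 0" "\<epsilon> \<le> \<epsilon>0" using \<zeta> L0 \<open>\<epsilon>0 > 0\<close> by (auto simp: \<epsilon>_def)
  have "L * \<epsilon> \<le> (L + 1) * \<epsilon>" using \<epsilon> by (simp add: mult_right_mono)
  also have "\<dots> \<le> (L + 1) * (\<zeta> / (L + 1))" using L0 by (intro mult_left_mono) (auto simp: \<epsilon>_def)
  also have "\<dots> = \<zeta>" using L0 by simp
  finally have L\<epsilon>: "L * \<epsilon> \<le> \<zeta>" .
  obtain g where g: "\<And>x. norm (g x - k x) \<le> L * \<epsilon>"
      "\<And>x. \<exists>D. (g has_derivative D) (at x) \<and> derivative_hull k \<epsilon> x D"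
    using average_differentiable[OF lip \<epsilon>(1)] by blast
  have gk: "norm (g x - k x) \<le> \<zeta>" for x using g(1)[of x] L\<epsilon> by simp
  have gc: "continuous_on UNIV g"
    using g(2) by (meson continuous_at_imp_continuous_on has_derivative_continuous)
  have gf: "continuous_on X (\<lambda>z. g (fst z))" for X :: "('a \<times> 'b) set"
    by (rule continuous_on_compose2[OF gc]) (auto intro!: continuous_intros)
  \<comment> \<open>With this weight the penalty alone reaches \<open>D / \<kappa>\<close> at distance \<open>D / 2\<close>, while its
    gradient there is only \<open>4 / \<kappa>\<close>.\<close>
  define c where "c = 4 / (D * \<kappa>)"
  have c: "c > 0" using assms by (simp add: c_def)
  define f where "f z = norm (snd z + g (fst z) - ybar) + c * (norm (fst z - x0))\<^sup>2" for z :: "'a \<times> 'b"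
  have "continuous_on C f" unfolding f_def by (intro continuous_intros gf)
  then obtain z2 where z2: "z2 \<in> C" "\<And>z. z \<in> C \<Longrightarrow> f z2 \<le> f z"
    using continuous_attains_inf[OF C] C0 by blast
  obtain x y where xy: "z2 = (x, y)" by (cases z2)
  define r where "r = y + g x - ybar"
  have "f (x, y) \<le> f (x0, y0)" using z2(2)[OF C0] by (simp add: xy)
  also have "f (x0, y0) = norm ((y0 + k x0 - ybar) + (g x0 - k x0))" by (simp add: f_def algebra_simps)
  also have "\<dots> \<le> p0 + \<zeta>" unfolding p0_def by (intro order_trans[OF norm_triangle_ineq] add_left_mono gk)
  finally have fq: "norm r + c * (norm (x - x0))\<^sup>2 < q" using \<zeta>(3) by (simp add: f_def r_def)
  have rq: "norm r < q" 
  proof -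
    have "0 \<le> c * (norm (x - x0))\<^sup>2" using c by simp
    then show ?thesis using fq by linarith
  qed
  have "c * (norm (x - x0))\<^sup>2 < q" using fq norm_ge_zero[of r] by linarith
  also have "q = c * (D / 2)\<^sup>2" using assms by (simp add: q_def c_def power2_eq_square)
  finally have "(norm (x - x0))\<^sup>2 < (D / 2)\<^sup>2" unfolding mult_less_cancel_left_pos[OF c] .
  then have xD: "norm (x - x0) < D / 2" by (rule power2_less_imp_less) (use \<open>D > 0\<close> in simp)
  have ky: "norm (y + k x - ybar) \<le> norm r + \<zeta>"
  proof -
    have "norm (y + k x - ybar) = norm (r - (g x - k x))" by (simp add: r_def algebra_simps)
    then show ?thesis using norm_triangle_ineq4[of r "g x - k x"] gk[of x] by simp
  qed
  have \<zeta>q: "\<zeta> < q" using \<zeta>(3) p0 by simp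
  have "m \<le> norm (y + k x - ybar)" using z1(2)[OF z2(1)] by (simp add: m_def xy)
  then have r0: "norm r > 0" using ky \<zeta>(2) by linarith
  have yR: "norm (y - ybar) < R"
  proof -
    have "norm (y - ybar) \<le> norm (y + k x - ybar) + norm (k x)"
      using norm_triangle_ineq4[of "y + k x - ybar" "k x"] by simp
    also have "norm (k x) \<le> norm (k x0) + L * norm (x - x0)"
      using kl[of x x0] norm_triangle_sub[of "k x" "k x0"] by linarith
    also have "L * norm (x - x0) \<le> L * D" using xD L0 \<open>D > 0\<close> by (intro mult_left_mono) auto
    finally show ?thesis using ky rq \<zeta>q R0 by linarith
  qed
  obtain A where A: "(g has_derivative A) (at x)" "derivative_hull k \<epsilon> x A" using g(2) by blast
  have lA: "linear A" using has_derivative_bounded_linear[OF A(1)] bounded_linear.linear by blast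
  define w where "w = sgn r"
  have w: "norm w = 1" using r0 by (simp add: w_def norm_sgn)
  define pp where "pp = adjoint A w + (2 * c) *\<^sub>R (x - x0)"
  have fder: "(f has_derivative (\<lambda>d. (pp, w) \<bullet> d)) (at (x, y))"
  proof -
    have 1: "((\<lambda>z. snd z + g (fst z) - ybar) has_derivative (\<lambda>d. snd d + A (fst d))) (at (x, y))"
    proof -
      have "((\<lambda>z. g (fst z)) has_derivative (\<lambda>d. A (fst d))) (at (x, y))"
        using has_derivative_compose[of fst fst "(x, y)" UNIV g A] A(1) by (simp add: has_derivative_fst)
      then show ?thesis by (auto intro!: derivative_eq_intros)
    qed
    have 2: "((\<lambda>z. norm (snd z + g (fst z) - ybar)) has_derivative (\<lambda>d. (snd d + A (fst d)) \<bullet> w)) (at (x, y))"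
      using has_derivative_compose[OF 1, of norm "\<lambda>h. h \<bullet> w"] has_derivative_norm[of r] r0
      by (simp add: r_def w_def)
    have 3: "((\<lambda>z. (norm (fst z - x0))\<^sup>2) has_derivative (\<lambda>d. 2 * ((x - x0) \<bullet> fst d))) (at (x, y))"
    proof -
      have "((\<lambda>z. fst z - x0) has_derivative fst) (at (x, y))" by (auto intro!: derivative_eq_intros)
      from has_derivative_compose[OF this, of "\<lambda>x. (norm x)\<^sup>2"] has_derivative_sqnorm_at[of "x - x0"]
      show ?thesis by simp
    qed
    have "(f has_derivative (\<lambda>d. (snd d + A (fst d)) \<bullet> w + c * (2 * ((x - x0) \<bullet> fst d)))) (at (x, y))"
      unfolding f_def[abs_def] by (intro has_derivative_add 2 has_derivative_mult_right 3)
    moreover have "(snd d + A (fst d)) \<bullet> w + c * (2 * ((x - x0) \<bullet> fst d)) = (pp, w) \<bullet> d" for d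
      using adjoint_works[OF lA, of "fst d" w]
      by (cases d) (simp add: pp_def inner_add_left inner_commute[of "adjoint A w"] inner_commute[of w])
    ultimately show ?thesis by simp
  qed
  have "- (pp, w) \<in> normal_cone (gph F) (x, y)"
  proof (rule normal_cone_local_minimum[OF fder])
    show "(x, y) \<in> gph F" using z2(1) by (simp add: C_def xy)
    show "min (D / 2 - norm (x - x0)) (R - norm (y - ybar)) > 0" using xD yR by simp
    fix z assume z: "z \<in> gph F" "dist z (x, y) < min (D / 2 - norm (x - x0)) (R - norm (y - ybar))"
    have "dist (fst z) x < D / 2 - norm (x - x0)" "dist (snd z) y < R - norm (y - ybar)"
      using z(2) dist_fst_le[of z "(x, y)"] dist_snd_le[of z "(x, y)"] by auto
    then have "norm (fst z - x0) \<le> D / 2" "norm (snd z - ybar) \<le> R"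
      using norm_triangle_ineq[of "fst z - x" "x - x0"] norm_triangle_ineq[of "snd z - y" "y - ybar"]
      by (auto simp: dist_norm)
    then have "z \<in> C" using z(1) by (cases z) (auto simp: C_def dist_norm norm_minus_commute)
    then show "f (x, y) \<le> f z" using z2(2) by (simp add: xy)
  qed
  then have nc: "(- pp, - w) \<in> normal_cone (gph F) (x, y)" by simp
  have pb: "\<bar>- pp \<bullet> d + w \<bullet> A d\<bar> \<le> 4 / \<kappa> * norm d" for d
  proof -
    have "- pp \<bullet> d + w \<bullet> A d = - ((2 * c) * ((x - x0) \<bullet> d))"
      using adjoint_works[OF lA, of d w] by (simp add: pp_def inner_add_left inner_diff_left inner_commute[of "adjoint A w"] inner_commute[of w])
    then have "\<bar>- pp \<bullet> d + w \<bullet> A d\<bar> = (2 * c) * \<bar>(x - x0) \<bullet> d\<bar>" using c by (simp add: abs_mult)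
    also have "\<dots> \<le> (2 * c) * (norm (x - x0) * norm d)"
      using c by (intro mult_left_mono Cauchy_Schwarz_ineq2) auto
    also have "\<dots> \<le> (2 * c) * (D / 2 * norm d)"
      using c xD by (intro mult_left_mono mult_right_mono) auto
    also have "\<dots> = 4 / \<kappa> * norm d" using assms by (simp add: c_def)
    finally show ?thesis .
  qed
  have "norm (y + k x - ybar) \<le> 2 * D / \<kappa>" using ky rq \<zeta>q by (simp add: q_def)
  with xD lA derivative_hull_mono[OF A(2) \<epsilon>(2)] w nc pb show ?thesis
    by (intro exI[of _ x] exI[of _ y] exI[of _ A] exI[of _ w] exI[of _ "- pp"]) simp
qed

text \<open>
  Composition with the nearest-point projection onto the ball keeps the Lipschitz constant.
\<close>

lemma Lipschitz_extension_from_cball: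
  fixes h :: "'a::euclidean_space \<Rightarrow> 'b::real_normed_vector"
  assumes "r > 0" and lip: "\<And>x y. x \<in> cball c r \<Longrightarrow> y \<in> cball c r \<Longrightarrow> norm (h x - h y) \<le> L * norm (x - y)"
    and "L \<ge> 0"
  shows "\<exists>k. L-lipschitz_on UNIV k \<and> (\<forall>x\<in>cball c r. k x = h x)"
proof (intro exI conjI ballI)
  let ?S = "cball c r"
  have ne: "?S \<noteq> {}" using \<open>r > 0\<close> by simp
  show "L-lipschitz_on UNIV (\<lambda>x. h (closest_point ?S x))"
  proof (rule lipschitz_onI)
    fix x y
    have "dist (h (closest_point ?S x)) (h (closest_point ?S y)) \<le> L * dist (closest_point ?S x) (closest_point ?S y)"
      using lip[OF closest_point_in_set[OF closed_cball ne] closest_point_in_set[OF closed_cball ne], of x y]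
      by (simp add: dist_norm)
    also have "\<dots> \<le> L * dist x y"
      using \<open>L \<ge> 0\<close> by (intro mult_left_mono closest_point_lipschitz convex_cball closed_cball ne)
    finally show "dist (h (closest_point ?S x)) (h (closest_point ?S y)) \<le> L * dist x y" .
  qed fact
  show "h (closest_point ?S x) = h x" if "x \<in> ?S" for x using that by (simp add: closest_point_self)
qed

lemma radial_derivative_limit_local:
  assumes rl: "radial_derivative_limit h xbar u l" and "r > 0"
    and eq: "\<And>x. x \<in> ball xbar r \<Longrightarrow> k x = h x"
  shows "radial_derivative_limit k xbar u l"
  unfolding radial_derivative_limit_def
proof (intro allI impI)
  fix \<delta> :: real assume "\<delta> > 0"
  then have "\<exists>\<tau>>0. \<forall>t u' D. 0 < t \<and> t < \<tau> \<and> norm (u' - u) < \<tau> \<and>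
     (h has_derivative D) (at (xbar + t *\<^sub>R u')) \<longrightarrow> norm (D u' - l) \<le> \<delta>"
    using rl unfolding radial_derivative_limit_def by (elim allE[of _ \<delta>]) (rule mp)
  then obtain \<tau> where \<tau>: "\<tau> > 0" and \<tau>bound: "\<forall>t u' D. 0 < t \<and> t < \<tau> \<and> norm (u' - u) < \<tau> \<and>
     (h has_derivative D) (at (xbar + t *\<^sub>R u')) \<longrightarrow> norm (D u' - l) \<le> \<delta>"
    by (elim exE conjE)
  define \<sigma> where "\<sigma> = min (min \<tau> 1) (r / (norm u + 1))"
  have nu: "norm u + 1 > 0" using norm_ge_zero[of u] by linarith
  have \<sigma>: "\<sigma> > 0" "\<sigma> \<le> \<tau>" "\<sigma> \<le> 1" "\<sigma> \<le> r / (norm u + 1)"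
    unfolding \<sigma>_def using \<tau> \<open>r > 0\<close> nu by simp_all
  show "\<exists>\<tau>>0. \<forall>t u' D. 0 < t \<and> t < \<tau> \<and> norm (u' - u) < \<tau> \<and>
     (k has_derivative D) (at (xbar + t *\<^sub>R u')) \<longrightarrow> norm (D u' - l) \<le> \<delta>"
  proof (intro exI[of _ \<sigma>] conjI allI impI \<sigma>(1), elim conjE)
    fix t u' D
    assume A: "0 < t" "t < \<sigma>" "norm (u' - u) < \<sigma>" and D: "(k has_derivative D) (at (xbar + t *\<^sub>R u'))"
    have "norm u' \<le> norm u + 1" using A(3) \<sigma>(3) norm_triangle_sub[of u' u] by simp
    then have "t * norm u' \<le> t * (norm u + 1)" using A(1) by simp
    also have "\<dots> < r" using A(2) \<sigma>(4) nu by (simp add: pos_less_divide_eq[symmetric] del: pos_less_divide_eq)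
    finally have "xbar + t *\<^sub>R u' \<in> ball xbar r" using A(1) by (simp add: dist_norm)
    then have "(h has_derivative D) (at (xbar + t *\<^sub>R u'))"
      by (rule has_derivative_transform_within_open[OF D open_ball]) (rule eq)
    then show "norm (D u' - l) \<le> \<delta>"
      using \<tau>bound A \<sigma>(2) by (meson less_le_trans)
  qed
qed

text \<open>
  The data produced from one violation of subregularity with constant \<open>N\<close>. All errors are
  measured relative to the distance \<open>t\<close> from the reference point.
\<close>

definition approximate_normal ::
    "('a::euclidean_space \<Rightarrow> 'b::euclidean_space set) \<Rightarrow> ('a \<Rightarrow> 'b) \<Rightarrow> 'a \<Rightarrow> 'b \<Rightarrow> real \<Rightarrow>
      'a \<times> 'b \<times> ('a \<Rightarrow> 'b) \<times> 'b \<times> 'a \<times> real \<Rightarrow> bool" where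
  "approximate_normal F k xbar ybar N = (\<lambda>(x, y, A, w, p, t).
     0 < t \<and> t = norm (x - xbar) \<and> t < 2 / N \<and> norm (y + k x - ybar) \<le> 4 / N * t \<and>
     linear A \<and> derivative_hull k (2 / N * t) x A \<and> norm w = 1 \<and> (p, - w) \<in> normal_cone (gph F) (x, y) \<and>
     (\<forall>d. \<bar>p \<bullet> d + w \<bullet> A d\<bar> \<le> 4 / N * norm d))"

lemma not_subregular_approximate_normals:
  fixes F :: "real^'n \<Rightarrow> (real^'m) set" and h k :: "real^'n \<Rightarrow> real^'m"
  assumes cl: "closed (gph F)" and gph: "(xbar, ybar) \<in> gph F" and h0: "h xbar = 0"
    and nsub: "\<not> metrically_subregular (\<lambda>x. {y + h x | y. y \<in> F x}) xbar ybar"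
    and lip: "L-lipschitz_on UNIV k" and "r > 0" and kh: "\<And>x. x \<in> cball xbar r \<Longrightarrow> k x = h x" and "N > 0"
  shows "\<exists>x y A w p t. approximate_normal F k xbar ybar N (x, y, A, w, p, t)"
proof -
  let ?G = "\<lambda>x. {y + h x | y. y \<in> F x}"
  have G: "(xbar, ybar) \<in> gph ?G" using gph h0 by (auto simp: gph_def)
  \<comment> \<open>The reference point solves the inclusion, hence \<open>D\<close> is at most \<open>dist x0 xbar\<close> and the
    ball of radius \<open>D / 2\<close> about \<open>x0\<close> stays where \<open>k\<close> and \<open>h\<close> agree.\<close>
  define s where "s = min (r / 4) (1 / N)"
  have s: "s > 0" "s \<le> r / 4" "s \<le> 1 / N" using \<open>r > 0\<close> \<open>N > 0\<close> by (auto simp: s_def)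
  obtain x0 y D where x0: "dist x0 xbar < s" and y: "y \<in> ?G x0" and D: "N * dist y ybar < D"
    and far: "\<And>z. ybar \<in> ?G z \<Longrightarrow> D \<le> dist x0 z"
    using nsub[unfolded not_metrically_subregular_iff[OF G]] \<open>N > 0\<close> s(1) by meson
  obtain y0 where y0: "y0 \<in> F x0" "y = y0 + h x0" using y by blast
  have "0 \<le> N * dist y ybar" using \<open>N > 0\<close> by simp
  then have D0: "D > 0" using D by linarith
  have Dx: "D \<le> dist x0 xbar" using G by (intro far) (simp add: gph_def)
  have x0r: "x0 \<in> cball xbar r" using x0 s \<open>r > 0\<close> by (simp add: dist_commute)
  have "\<exists>x y A w p. norm (x - x0) < D / 2 \<and> norm (y + k x - ybar) \<le> 2 * D / N \<and>
     linear A \<and> derivative_hull k (D / N) x A \<and> norm w = 1 \<and> (p, - w) \<in> normal_cone (gph F) (x, y) \<and>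
     (\<forall>d. \<bar>p \<bullet> d + w \<bullet> A d\<bar> \<le> 4 / N * norm d)"
  proof (rule variational_normal[OF lip cl y0(1) D0 \<open>N > 0\<close>])
    show "N * norm (y0 + k x0 - ybar) < D" using D y0 kh[OF x0r] by (simp add: dist_norm)
    show "D / N > 0" using D0 \<open>N > 0\<close> by simp
    fix z assume z: "norm (z - x0) \<le> D / 2"
    have "dist z xbar \<le> norm (z - x0) + dist x0 xbar"
      using dist_triangle[of z xbar x0] by (simp add: dist_norm)
    then have "z \<in> cball xbar r" using z Dx x0 s \<open>r > 0\<close> by (simp add: dist_commute)
    then have kz: "k z = h z" by (rule kh)
    show "ybar - k z \<notin> F z"
    proof
      assume "ybar - k z \<in> F z"
      then have "ybar \<in> ?G z" by (auto simp: kz intro!: exI[of _ "ybar - h z"])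
      from far[OF this] show False using z D0 by (simp add: dist_norm norm_minus_commute)
    qed
  qed
  then obtain x y A w p where *: "norm (x - x0) < D / 2" "norm (y + k x - ybar) \<le> 2 * D / N"
     "linear A" "derivative_hull k (D / N) x A" "norm w = 1" "(p, - w) \<in> normal_cone (gph F) (x, y)"
     "\<forall>d. \<bar>p \<bullet> d + w \<bullet> A d\<bar> \<le> 4 / N * norm d"
    by (elim exE conjE)
  define t where "t = norm (x - xbar)"
  have "norm (x0 - xbar) \<le> norm (x - x0) + t"
    using norm_triangle_ineq[of "x0 - x" "x - xbar"] by (simp add: t_def norm_minus_commute)
  then have tD: "D \<le> 2 * t" "0 < t" using *(1) Dx D0 by (auto simp: dist_norm)
  have "t \<le> norm (x - x0) + norm (x0 - xbar)"
    using norm_triangle_ineq[of "x - x0" "x0 - xbar"] by (simp add: t_def)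
  then have "t < 2 * s" using *(1) Dx x0 s(1) unfolding dist_norm by linarith
  also have "\<dots> \<le> 2 / N" using s(3) by simp
  finally have tN: "t < 2 / N" .
  have DN: "D / N \<le> 2 / N * t" using tD \<open>N > 0\<close> by (simp add: field_simps)
  have "2 * D / N \<le> 4 / N * t" using DN by simp
  then have "norm (y + k x - ybar) \<le> 4 / N * t" using *(2) by linarith
  with * tD(2) tN derivative_hull_mono[OF *(4) DN] show ?thesis
    by (intro exI[of _ x] exI[of _ y] exI[of _ A] exI[of _ w] exI[of _ p] exI[of _ t])
       (simp add: approximate_normal_def t_def)
qed

lemma norm_matrix_le_entries:
  fixes J :: "real^'n^'m"
  assumes "\<And>i j. \<bar>J $ i $ j\<bar> \<le> B"
  shows "norm J \<le> real CARD('m) * (real CARD('n) * B)"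
proof -
  have "norm J \<le> (\<Sum>i\<in>UNIV. norm (J $ i))"
    unfolding norm_vec_def by (rule L2_set_le_sum) simp
  also have "\<dots> \<le> (\<Sum>i\<in>(UNIV::'m set). real CARD('n) * B)"
  proof (rule sum_mono)
    fix i
    have "norm (J $ i) \<le> (\<Sum>j\<in>UNIV. \<bar>J $ i $ j\<bar>)" by (rule norm_le_l1_cart)
    also have "\<dots> \<le> (\<Sum>j\<in>(UNIV::'n set). B)" by (rule sum_mono) (rule assms)
    finally show "norm (J $ i) \<le> real CARD('n) * B" by simp
  qed
  finally show ?thesis by simp
qed

text \<open>
  All the data for increasing \<open>N\<close> are bounded, and a convergent subsequence yields the
  normal and the map \<open>A\<close>. Both \<open>A u\<close> and \<open>- v\<close> are identified as the limit \<open>l\<close> supplied by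
  semismoothness, the former through averages of derivatives and the latter through
  difference quotients.
\<close>

lemma semismooth_not_subregular_imp_critical_direction:
  fixes F :: "real^'n \<Rightarrow> (real^'m) set" and h :: "real^'n \<Rightarrow> real^'m"
  assumes cl: "closed (gph F)" and gph: "(xbar, ybar) \<in> gph F" and h0: "h xbar = 0"
    and ss: "semismooth_at h xbar" and lipL: "lip_modulus h xbar < ereal L"
    and nsub: "\<not> metrically_subregular (\<lambda>x. {y + h x | y. y \<in> F x}) xbar ybar"
  shows "\<exists>u v ustar vstar A. (ustar, - vstar) \<in> dir_normal_cone (gph F) (xbar, ybar) (u, v) \<and>
     norm u = 1 \<and> norm vstar = 1 \<and> linear A \<and> (\<forall>d. norm (A d) \<le> L * norm d) \<and> A u = - v \<and>
     (\<forall>d. vstar \<bullet> A d = - (ustar \<bullet> d))"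
proof -
  obtain r0 where r0: "r0 > 0" "\<forall>x\<in>ball xbar r0. \<forall>x'\<in>ball xbar r0. norm (h x - h x') \<le> L * norm (x - x')"
    using lip_modulus_lessD[OF lipL] by blast
  define r where "r = r0 / 2"
  have r: "r > 0" "cball xbar r \<subseteq> ball xbar r0" using r0(1) by (auto simp: r_def)
  have L0: "L \<ge> 0"
  proof -
    obtain e :: "real^'n" where e: "norm e = 1" using vector_choose_size[of 1] by auto
    have "xbar + r *\<^sub>R e \<in> ball xbar r0" "xbar \<in> ball xbar r0"
      using e r(1) r0(1) by (auto simp: dist_norm r_def)
    then have "norm (h (xbar + r *\<^sub>R e) - h xbar) \<le> L * norm (xbar + r *\<^sub>R e - xbar)" using r0(2) by blast
    then have "0 \<le> L * norm (xbar + r *\<^sub>R e - xbar)" by (rule order_trans[OF norm_ge_zero])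
    then have "0 \<le> L * r" using e r(1) by simp
    then show ?thesis using r(1) by (simp add: zero_le_mult_iff)
  qed
  \<comment> \<open>A global Lipschitz map lets the averages be formed without regard to the
    neighbourhood.\<close>
  obtain k where lip: "L-lipschitz_on UNIV k" and kh: "\<And>x. x \<in> cball xbar r \<Longrightarrow> k x = h x"
    using Lipschitz_extension_from_cball[OF r(1), of xbar h L] r0(2) r(2) L0 by (metis subsetD)
  have k0: "k xbar = 0" using kh[of xbar] r(1) h0 by simp
  have kl: "norm (k x - k y) \<le> L * norm (x - y)" for x y
    using lipschitz_onD[OF lip, of x y] by (simp add: dist_norm)
  define N where "N i = real (Suc i)" for i
  have "\<forall>i. \<exists>z. approximate_normal F k xbar ybar (N i) z"
    using not_subregular_approximate_normals[where h = h and k = k, OF cl gph h0 nsub lip r(1) kh]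
    unfolding N_def by (metis of_nat_0_less_iff zero_less_Suc)
  then obtain z where z: "\<forall>i. approximate_normal F k xbar ybar (N i) (z i)"
    by (rule choice[THEN exE])
  define X Y A W P t where "X i = fst (z i)" and "Y i = fst (snd (z i))" and "A i = fst (snd (snd (z i)))"
    and "W i = fst (snd (snd (snd (z i))))" and "P i = fst (snd (snd (snd (snd (z i)))))"
    and "t i = snd (snd (snd (snd (snd (z i)))))" for i
  have zz: "0 < t i" "t i = norm (X i - xbar)" "t i < 2 / N i" "norm (Y i + k (X i) - ybar) \<le> 4 / N i * t i"
     "linear (A i)" "derivative_hull k (2 / N i * t i) (X i) (A i)" "norm (W i) = 1"
     "(P i, - W i) \<in> normal_cone (gph F) (X i, Y i)" "\<forall>d. \<bar>P i \<bullet> d + W i \<bullet> A i d\<bar> \<le> 4 / N i * norm d" for i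
    by (insert z[rule_format, of i, unfolded approximate_normal_def case_prod_beta, folded X_def Y_def A_def W_def P_def t_def],
        (elim conjE, assumption)+)
  define J where "J i = matrix (A i)" for i
  have J: "J i *v d = A i d" for i d
    unfolding J_def using zz(5)[of i] by (intro matrix_works) (simp add: linear_matrix_vector_mul_eq)
  have AL: "norm (A i d) \<le> L * norm d" for i d using derivative_hull_norm_le[OF lip zz(6)] .
  define U V where "U i = (X i - xbar) /\<^sub>R t i" and "V i = (Y i - ybar) /\<^sub>R t i" for i
  have X: "X i = xbar + t i *\<^sub>R U i" and Y: "Y i = ybar + t i *\<^sub>R V i" for i
    using zz(1)[of i] by (simp_all add: U_def V_def)
  have U1: "norm (U i) = 1" for i using zz(1,2)[of i] by (simp add: U_def)
  have N4: "4 / N i \<le> 4" "N i > 0" for i by (simp_all add: N_def field_simps)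
  have VK: "norm (V i + k (X i) /\<^sub>R t i) \<le> 4 / N i" for i
  proof -
    have "V i + k (X i) /\<^sub>R t i = (Y i + k (X i) - ybar) /\<^sub>R t i"
      by (simp add: V_def scaleR_right_distrib scaleR_diff_right)
    then have "norm (V i + k (X i) /\<^sub>R t i) = norm (Y i + k (X i) - ybar) / t i"
      using zz(1)[of i] by (simp add: divide_inverse mult.commute)
    then show ?thesis using zz(1,4)[of i] by (simp add: pos_divide_le_eq)
  qed
  have Vb: "norm (V i) \<le> L + 4" for i
  proof -
    have "norm (k (X i)) \<le> L * t i" using kl[of "X i" xbar] zz(2)[of i] k0 by simp
    then have "norm (k (X i) /\<^sub>R t i) \<le> L" using zz(1)[of i] by (simp add: field_simps)
    then show ?thesis
      using VK[of i] N4[of i] norm_triangle_ineq4[of "V i + k (X i) /\<^sub>R t i" "k (X i) /\<^sub>R t i"] by simp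
  qed
  have Pb: "norm (P i) \<le> L + 4" for i
  proof (cases "P i = 0")
    case False
    have "P i \<bullet> P i \<le> \<bar>P i \<bullet> P i + W i \<bullet> A i (P i)\<bar> + \<bar>W i \<bullet> A i (P i)\<bar>" by linarith
    also have "\<dots> \<le> 4 / N i * norm (P i) + norm (W i) * norm (A i (P i))"
      using zz(9) Cauchy_Schwarz_ineq2[of "W i" "A i (P i)"] by (intro add_mono) auto
    also have "\<dots> \<le> 4 * norm (P i) + L * norm (P i)"
      using AL[of i "P i"] N4[of i] zz(7)[of i] by (intro add_mono mult_right_mono) auto
    finally have "norm (P i) * norm (P i) \<le> (L + 4) * norm (P i)"
      by (simp add: dot_square_norm power2_eq_square algebra_simps)
    then show ?thesis using False by simp
  qed (use L0 in simp)
  have Jb: "norm (J i) \<le> real CARD('m) * (real CARD('n) * L)" for i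
  proof (rule norm_matrix_le_entries)
    fix a b
    have "J i $ a $ b = A i (axis b 1) $ a" by (simp add: J_def matrix_def)
    then have "\<bar>J i $ a $ b\<bar> \<le> norm (A i (axis b 1))" using component_le_norm_cart by metis
    also have "\<dots> \<le> L" using AL[of i "axis b 1"] by (simp add: norm_axis_1)
    finally show "\<bar>J i $ a $ b\<bar> \<le> L" .
  qed
  define Z where "Z i = (U i, V i, P i, W i, J i)" for i
  have "bounded (range Z)"
  proof -
    have "range Z \<subseteq> cball 0 1 \<times> cball 0 (L + 4) \<times> cball 0 (L + 4) \<times> cball 0 1 \<times> cball 0 (real CARD('m) * (real CARD('n) * L))"
      using U1 Vb Pb zz(7) Jb by (auto simp: Z_def)
    then show ?thesis by (rule bounded_subset[rotated]) (intro bounded_Times bounded_cball)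
  qed
  then obtain \<zeta> \<rho> where \<rho>: "strict_mono (\<rho> :: nat \<Rightarrow> nat)" "(Z \<circ> \<rho>) \<longlonglongrightarrow> \<zeta>"
    using bounded_imp_convergent_subsequence by blast
  obtain u v p w J0 where \<zeta>: "\<zeta> = (u, v, p, w, J0)" by (cases \<zeta>)
  have lims: "(\<lambda>i. U (\<rho> i)) \<longlonglongrightarrow> u" "(\<lambda>i. V (\<rho> i)) \<longlonglongrightarrow> v" "(\<lambda>i. P (\<rho> i)) \<longlonglongrightarrow> p"
    "(\<lambda>i. W (\<rho> i)) \<longlonglongrightarrow> w" "(\<lambda>i. J (\<rho> i)) \<longlonglongrightarrow> J0"
    using tendsto_fst[OF \<rho>(2)] tendsto_fst[OF tendsto_snd[OF \<rho>(2)]] tendsto_fst[OF tendsto_snd[OF tendsto_snd[OF \<rho>(2)]]]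
      tendsto_fst[OF tendsto_snd[OF tendsto_snd[OF tendsto_snd[OF \<rho>(2)]]]]
      tendsto_snd[OF tendsto_snd[OF tendsto_snd[OF tendsto_snd[OF \<rho>(2)]]]]
    by (simp_all add: Z_def \<zeta> comp_def)
  have Ninv: "(\<lambda>i. c / N (\<rho> i)) \<longlonglongrightarrow> 0" for c
  proof -
    have "(\<lambda>i. c * inverse (real (Suc i))) \<longlonglongrightarrow> c * 0" by (intro tendsto_intros LIMSEQ_inverse_real_of_nat)
    then have "(\<lambda>i. c / N i) \<longlonglongrightarrow> 0" by (simp add: N_def divide_inverse)
    from LIMSEQ_subseq_LIMSEQ[OF this \<rho>(1)] show ?thesis by (simp add: comp_def)
  qed
  have tlim: "(\<lambda>i. t (\<rho> i)) \<longlonglongrightarrow> 0"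
    by (rule Lim_null_comparison[OF _ Ninv[of 2]])
       (use zz(1,3) in \<open>auto intro!: always_eventually simp: abs_of_pos less_imp_le\<close>)
  interpret mv: bounded_bilinear "\<lambda>(A :: real^'n^'m) v. A *v v" by (rule bounded_bilinear_matrix_vector_mult)
  have u1: "norm u = 1" using tendsto_norm[OF lims(1)] U1 by (simp add: LIMSEQ_const_iff)
  have w1: "norm w = 1" using tendsto_norm[OF lims(4)] zz(7) by (simp add: LIMSEQ_const_iff)
  have Jlim: "(\<lambda>i. A (\<rho> i) d) \<longlonglongrightarrow> J0 *v d" for d
    using mv.tendsto[OF lims(5) tendsto_const[of d]] by (simp add: J)
  have J0L: "norm (J0 *v d) \<le> L * norm d" for d
    using AL by (intro LIMSEQ_le_const2[OF tendsto_norm[OF Jlim[of d]]]) auto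
  have pd: "w \<bullet> (J0 *v d) = - (p \<bullet> d)" for d
  proof -
    have "(\<lambda>i. P (\<rho> i) \<bullet> d + W (\<rho> i) \<bullet> A (\<rho> i) d) \<longlonglongrightarrow> p \<bullet> d + w \<bullet> (J0 *v d)"
      by (intro tendsto_intros lims Jlim)
    moreover have "(\<lambda>i. P (\<rho> i) \<bullet> d + W (\<rho> i) \<bullet> A (\<rho> i) d) \<longlonglongrightarrow> 0"
    proof (rule Lim_null_comparison)
      show "\<forall>\<^sub>F i in sequentially. norm (P (\<rho> i) \<bullet> d + W (\<rho> i) \<bullet> A (\<rho> i) d) \<le> 4 / N (\<rho> i) * norm d"
        using zz(9) by (intro always_eventually) simp
      show "(\<lambda>i. 4 / N (\<rho> i) * norm d) \<longlonglongrightarrow> 0" by (rule tendsto_mult_left_zero[OF Ninv])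
    qed
    ultimately have "p \<bullet> d + w \<bullet> (J0 *v d) = 0" by (rule LIMSEQ_unique)
    then show ?thesis by simp
  qed
  have dn: "(p, - w) \<in> dir_normal_cone (gph F) (xbar, ybar) (u, v)"
    unfolding dir_normal_cone_def
  proof (intro CollectI exI conjI allI)
    show "(\<lambda>i. t (\<rho> i)) \<longlonglongrightarrow> 0" by (rule tlim)
    show "(\<lambda>i. (U (\<rho> i), V (\<rho> i))) \<longlonglongrightarrow> (u, v)" by (intro tendsto_Pair lims)
    show "(\<lambda>i. (P (\<rho> i), - W (\<rho> i))) \<longlonglongrightarrow> (p, - w)" by (intro tendsto_Pair tendsto_minus lims)
    fix i show "0 < t (\<rho> i)" by (rule zz)
    show "(P (\<rho> i), - W (\<rho> i)) \<in> normal_cone (gph F) ((xbar, ybar) + t (\<rho> i) *\<^sub>R (U (\<rho> i), V (\<rho> i)))"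
      using zz(8)[of "\<rho> i"] X[of "\<rho> i"] Y[of "\<rho> i"] by simp
  qed
  obtain l where "radial_derivative_limit h xbar u l"
    using semismooth_at_imp_radial_derivative_limit[OF ss] by blast
  then have rl: "radial_derivative_limit k xbar u l"
    by (rule radial_derivative_limit_local[OF _ r(1)]) (use kh in simp)
  have "(\<lambda>i. J (\<rho> i) *v U (\<rho> i)) \<longlonglongrightarrow> l"
  proof (rule tendstoI)
    fix e :: real assume "e > 0"
    then obtain \<tau> where \<tau>: "\<tau> > 0" and \<tau>b: "\<forall>t u' \<epsilon> D. 0 < t \<and> t < \<tau> \<and> norm (u' - u) < \<tau> \<and> \<epsilon> \<le> \<tau> * t \<and>
      derivative_hull k \<epsilon> (xbar + t *\<^sub>R u') D \<longrightarrow> norm (D u' - l) \<le> e / 2"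
      using radial_derivative_limit_hull[OF lip rl, of "e / 2"] by (auto elim!: exE conjE)
    have "\<forall>\<^sub>F i in sequentially. t (\<rho> i) < \<tau>" using \<tau> by (rule order_tendstoD(2)[OF tlim])
    moreover have "\<forall>\<^sub>F i in sequentially. dist (U (\<rho> i)) u < \<tau>" using tendstoD[OF lims(1) \<tau>] .
    moreover have "\<forall>\<^sub>F i in sequentially. 2 / N (\<rho> i) < \<tau>" using \<tau> by (rule order_tendstoD(2)[OF Ninv])
    ultimately show "\<forall>\<^sub>F i in sequentially. dist (J (\<rho> i) *v U (\<rho> i)) l < e"
    proof eventually_elim
      case (elim i)
      have "2 / N (\<rho> i) * t (\<rho> i) \<le> \<tau> * t (\<rho> i)" using elim(3) zz(1) by (intro mult_right_mono less_imp_le)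
      then have "norm (A (\<rho> i) (U (\<rho> i)) - l) \<le> e / 2"
        using \<tau>b[rule_format, of "t (\<rho> i)" "U (\<rho> i)" "2 / N (\<rho> i) * t (\<rho> i)" "A (\<rho> i)"] elim zz(1,6)[of "\<rho> i"]
        by (simp add: dist_norm X[symmetric])
      then show ?case using \<open>e > 0\<close> by (simp add: J dist_norm)
    qed
  qed
  with mv.tendsto[OF lims(5,1)] have J0u: "J0 *v u = l" by (rule LIMSEQ_unique)
  have "(\<lambda>i. k (X (\<rho> i)) /\<^sub>R t (\<rho> i)) \<longlonglongrightarrow> l"
  proof (rule tendstoI)
    fix e :: real assume "e > 0"
    then obtain \<tau> where \<tau>: "\<tau> > 0" "\<forall>t. 0 < t \<and> t < \<tau> \<longrightarrow> norm (k (xbar + t *\<^sub>R u) - k xbar - t *\<^sub>R l) \<le> e / 2 * t"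
      using radial_derivative_limit_imp_directional[OF lip rl u1, of "e / 2"] by auto
    have "(\<lambda>i. L * norm (U (\<rho> i) - u)) \<longlonglongrightarrow> L * norm (u - u)" by (intro tendsto_intros lims)
    then have "\<forall>\<^sub>F i in sequentially. L * norm (U (\<rho> i) - u) < e / 2"
      using \<open>e > 0\<close> by (intro order_tendstoD(2)) auto
    moreover have "\<forall>\<^sub>F i in sequentially. t (\<rho> i) < \<tau>" using \<tau>(1) by (rule order_tendstoD(2)[OF tlim])
    ultimately show "\<forall>\<^sub>F i in sequentially. dist (k (X (\<rho> i)) /\<^sub>R t (\<rho> i)) l < e"
    proof eventually_elim
      case (elim i)
      let ?t = "t (\<rho> i)" and ?U = "U (\<rho> i)"
      have t0: "?t > 0" by (rule zz)
      have 1: "norm (k (xbar + ?t *\<^sub>R u) - ?t *\<^sub>R l) \<le> e / 2 * ?t" using \<tau>(2) t0 elim k0 by simp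
      have "norm (k (X (\<rho> i)) - k (xbar + ?t *\<^sub>R u)) \<le> L * norm (X (\<rho> i) - (xbar + ?t *\<^sub>R u))" by (rule kl)
      also have "X (\<rho> i) - (xbar + ?t *\<^sub>R u) = ?t *\<^sub>R (?U - u)" by (subst X) (simp add: scaleR_diff_right)
      also have "L * norm (?t *\<^sub>R (?U - u)) = (L * norm (?U - u)) * ?t" using t0 by simp
      also have "\<dots> < e / 2 * ?t" using elim(1) t0 by (rule mult_strict_right_mono)
      finally have 2: "norm (k (X (\<rho> i)) - k (xbar + ?t *\<^sub>R u)) < e / 2 * ?t" .
      have "norm (k (X (\<rho> i)) - ?t *\<^sub>R l) < e * ?t"
        using 1 2 norm_triangle_ineq[of "k (X (\<rho> i)) - k (xbar + ?t *\<^sub>R u)" "k (xbar + ?t *\<^sub>R u) - ?t *\<^sub>R l"] by simp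
      moreover have "k (X (\<rho> i)) /\<^sub>R ?t - l = (k (X (\<rho> i)) - ?t *\<^sub>R l) /\<^sub>R ?t" using t0 by (simp add: scaleR_diff_right)
      then have "dist (k (X (\<rho> i)) /\<^sub>R ?t) l = norm (k (X (\<rho> i)) - ?t *\<^sub>R l) / ?t"
        using t0 by (simp add: dist_norm divide_inverse mult.commute)
      ultimately show ?case using t0 by (simp add: pos_divide_less_eq)
    qed
  qed
  then have "(\<lambda>i. V (\<rho> i) + k (X (\<rho> i)) /\<^sub>R t (\<rho> i)) \<longlonglongrightarrow> v + l" by (intro tendsto_add lims)
  moreover have "(\<lambda>i. V (\<rho> i) + k (X (\<rho> i)) /\<^sub>R t (\<rho> i)) \<longlonglongrightarrow> 0"
    by (rule Lim_null_comparison[OF _ Ninv[of 4]]) (use VK in auto)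
  ultimately have "v + l = 0" by (rule LIMSEQ_unique)
  then have "J0 *v u = - v" using J0u by (simp add: add_eq_0_iff)
  with dn u1 w1 J0L pd show ?thesis
    by (intro exI[of _ u] exI[of _ v] exI[of _ p] exI[of _ w] exI[of _ "\<lambda>d. J0 *v d"]) simp
qed

section \<open>Comparison of the radii\<close>

lemma F_C1_subset_F_ss: "F_C1 xbar \<subseteq> F_ss xbar"
  unfolding F_C1_def F_ss_def using C1_around_imp_semismooth_at by blast

lemma F_ss_subset_F_Lip: "F_ss xbar \<subseteq> F_Lip xbar"
  unfolding F_ss_def F_Lip_def semismooth_at_def by blast

lemma rad_SR_antimono: "P xbar \<subseteq> Q xbar \<Longrightarrow> rad_SR Q F xbar ybar \<le> rad_SR P F xbar ybar"
  unfolding rad_SR_def by (rule Inf_superset_mono) blast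

text \<open>
  The operator is \<open>- (v u\<^sup>T + vstar ustar\<^sup>T - \<alpha> vstar u\<^sup>T)\<close> with \<open>\<alpha> = ustar \<bullet> u\<close>:
  prescribing the image of \<open>u\<close> and the adjoint image of \<open>vstar\<close> fixes the first column and
  the first row in suitable orthonormal bases, and all other entries are zero.
\<close>

lemma critical_direction_operator:
  fixes u ustar :: "'a::euclidean_space" and v vstar :: "'b::euclidean_space"
  assumes eq: "ustar \<bullet> u = vstar \<bullet> v" and unit: "norm u = 1" "norm vstar = 1"
  shows "\<exists>A. linear A \<and> A u = - v \<and> (\<forall>d. vstar \<bullet> A d = - (ustar \<bullet> d)) \<and>
    (\<forall>d. norm (A d) \<le> sqrt ((norm ustar)\<^sup>2 + (norm v)\<^sup>2 - (ustar \<bullet> u)\<^sup>2) * norm d)"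
proof -
  define \<alpha> where "\<alpha> = ustar \<bullet> u"
  have uu: "u \<bullet> u = 1" and ww: "vstar \<bullet> vstar = 1" using unit by (simp_all add: dot_square_norm)
  have wv: "vstar \<bullet> v = \<alpha>" using eq by (simp add: \<alpha>_def)
  define a where "a = v - \<alpha> *\<^sub>R vstar"
  define A where "A d = - ((u \<bullet> d) *\<^sub>R a + (ustar \<bullet> d) *\<^sub>R vstar)" for d
  have orth: "vstar \<bullet> a = 0" "a \<bullet> vstar = 0"
    using wv by (simp_all add: a_def inner_diff_right inner_diff_left ww inner_commute[of v vstar])
  have "linear A"
    unfolding A_def by (rule linearI) (simp_all add: inner_add_right scaleR_left_distrib scaleR_right_distrib algebra_simps)
  moreover have "A u = - v" by (simp add: A_def a_def uu \<alpha>_def[symmetric])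
  moreover have "vstar \<bullet> A d = - (ustar \<bullet> d)" for d
    by (simp add: A_def inner_add_right inner_diff_right ww orth)
  moreover have "norm (A d) \<le> sqrt ((norm ustar)\<^sup>2 + (norm v)\<^sup>2 - (ustar \<bullet> u)\<^sup>2) * norm d" for d
  proof -
    have vp: "a \<bullet> a = (norm v)\<^sup>2 - \<alpha>\<^sup>2"
      unfolding a_def using wv ww by (simp add: inner_diff_left inner_diff_right inner_commute[of v vstar] dot_square_norm[of v] power2_eq_square)
    have "\<bar>u \<bullet> d\<bar> \<le> norm d" using Cauchy_Schwarz_ineq2[of u d] unit by simp
    then have p: "(u \<bullet> d)\<^sup>2 \<le> (norm d)\<^sup>2" using power_mono[of "\<bar>u \<bullet> d\<bar>" "norm d" 2] by simp
    have q: "(ustar \<bullet> d)\<^sup>2 \<le> (norm ustar)\<^sup>2 * (norm d)\<^sup>2"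
      using power_mono[OF Cauchy_Schwarz_ineq2[of ustar d], of 2] by (simp add: power_mult_distrib)
    have v0: "0 \<le> (norm v)\<^sup>2 - \<alpha>\<^sup>2" unfolding vp[symmetric] by simp
    have "(norm (A d))\<^sup>2 = A d \<bullet> A d" by (simp add: dot_square_norm)
    also have "\<dots> = (u \<bullet> d)\<^sup>2 * (a \<bullet> a) + (ustar \<bullet> d)\<^sup>2"
      unfolding A_def inner_minus_left inner_minus_right minus_minus
      by (simp add: inner_add_left inner_add_right ww orth power2_eq_square)
    also have "\<dots> \<le> (norm d)\<^sup>2 * ((norm v)\<^sup>2 - \<alpha>\<^sup>2) + (norm ustar)\<^sup>2 * (norm d)\<^sup>2"
      unfolding vp by (intro add_mono mult_right_mono p q v0)
    also have "\<dots> = ((norm ustar)\<^sup>2 + (norm v)\<^sup>2 - \<alpha>\<^sup>2) * (norm d)\<^sup>2" by (simp add: algebra_simps)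
    finally have "norm (A d) \<le> sqrt (((norm ustar)\<^sup>2 + (norm v)\<^sup>2 - \<alpha>\<^sup>2) * (norm d)\<^sup>2)"
      by (rule real_le_rsqrt)
    then show ?thesis by (simp add: real_sqrt_mult \<alpha>_def)
  qed
  ultimately show ?thesis by blast
qed

lemma rad_SR_C1_le_operator_bound:
  fixes F :: "real^'n \<Rightarrow> (real^'m) set" and A :: "real^'n \<Rightarrow> real^'m"
  assumes "(xbar, ybar) \<in> gph F"
    and "(ustar, - vstar) \<in> dir_normal_cone (gph F) (xbar, ybar) (u, v)"
    and "norm u = 1" "norm vstar = 1" "linear A" "\<And>d. norm (A d) \<le> K * norm d"
    and "A u = - v" "\<And>d. vstar \<bullet> A d = - (ustar \<bullet> d)"
  shows "rad_SR F_C1 F xbar ybar \<le> ereal K"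
proof -
  obtain h where h: "h \<in> F_C1 xbar" "lip_modulus h xbar \<le> ereal K"
     "\<not> metrically_subregular (\<lambda>x. {y + h x | y. y \<in> F x}) xbar ybar"
    using C1_perturbation_destroys_subregularity[OF assms] by blast
  have "rad_SR F_C1 F xbar ybar \<le> lip_modulus h xbar"
    unfolding rad_SR_def using h by (intro Inf_lower) blast
  with h(2) show ?thesis by simp
qed

text \<open>
  Both \<open>v\<close> and \<open>ustar\<close> are images of unit vectors, up to sign, under \<open>A\<close> and its adjoint.
\<close>

lemma rg_circ_le_operator_bound:
  fixes F :: "real^'n \<Rightarrow> (real^'m) set" and A :: "real^'n \<Rightarrow> real^'m"
  assumes dn: "(ustar, - vstar) \<in> dir_normal_cone (gph F) (xbar, ybar) (u, v)"
    and unit: "norm u = 1" "norm vstar = 1" and K: "\<And>d. norm (A d) \<le> K * norm d"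
    and Au: "A u = - v" and Av: "\<And>d. vstar \<bullet> A d = - (ustar \<bullet> d)"
  shows "rg_circ F xbar ybar \<le> ereal (sqrt 2 * K)"
proof -
  have K0: "K \<ge> 0" using order_trans[OF norm_ge_zero K[of u]] unit by simp
  have v: "norm v \<le> K" using K[of u] Au unit by simp
  have us: "norm ustar \<le> K"
  proof (cases "ustar = 0")
    case False
    have "(norm ustar)\<^sup>2 = \<bar>vstar \<bullet> A ustar\<bar>" unfolding Av by (simp add: dot_square_norm)
    also have "\<dots> \<le> norm vstar * norm (A ustar)" by (rule Cauchy_Schwarz_ineq2)
    also have "\<dots> \<le> K * norm ustar" using K[of ustar] unit by simp
    finally show ?thesis using False by (simp add: power2_eq_square)
  qed (use K0 in simp)
  have "(norm ustar)\<^sup>2 + (norm v)\<^sup>2 - (ustar \<bullet> u)\<^sup>2 \<le> K\<^sup>2 + K\<^sup>2"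
    using power_mono[OF us norm_ge_zero, of 2] power_mono[OF v norm_ge_zero, of 2] zero_le_power2[of "ustar \<bullet> u"] by linarith
  then have "sqrt ((norm ustar)\<^sup>2 + (norm v)\<^sup>2 - (ustar \<bullet> u)\<^sup>2) \<le> sqrt (2 * K\<^sup>2)" by simp
  also have "\<dots> = sqrt 2 * K" using K0 by (simp add: real_sqrt_mult)
  finally have le: "sqrt ((norm ustar)\<^sup>2 + (norm v)\<^sup>2 - (ustar \<bullet> u)\<^sup>2) \<le> sqrt 2 * K" .
  have "ustar \<bullet> u = vstar \<bullet> v" using Av[of u] Au by simp
  then have "rg_circ F xbar ybar \<le> ereal (sqrt ((norm ustar)\<^sup>2 + (norm v)\<^sup>2 - (ustar \<bullet> u)\<^sup>2))"
    unfolding rg_circ_def primal_dual_deriv_def using dn unit by (intro Inf_lower) blast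
  with le show ?thesis by (meson ereal_less_eq(3) order_trans)
qed

theorem corollary13:
  fixes F :: "real^'n \<Rightarrow> (real^'m) set" and xbar :: "real^'n" and ybar :: "real^'m"
  assumes "closed (gph F)"
    and "(xbar, ybar) \<in> gph F"
  shows "rad_SR F_Lip F xbar ybar \<le> rg_circ F xbar ybar \<and>
         ereal (1 / sqrt 2) * rg_circ F xbar ybar \<le> rad_SR F_ss F xbar ybar \<and>
         rad_SR F_ss F xbar ybar = rad_SR F_C1 F xbar ybar \<and>
         rad_SR F_C1 F xbar ybar \<le> rg_circ F xbar ybar"
proof -
  have upper: "rad_SR F_C1 F xbar ybar \<le> rg_circ F xbar ybar"
    unfolding rg_circ_def
  proof (rule Inf_greatest)
    fix c assume "c \<in> {ereal (sqrt ((norm ustar)\<^sup>2 + (norm v)\<^sup>2 - (ustar \<bullet> u)\<^sup>2)) | ustar v u vstar.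
            (ustar, v) \<in> primal_dual_deriv F xbar ybar u vstar \<and>
            ustar \<bullet> u = vstar \<bullet> v \<and> norm u = 1 \<and> norm vstar = 1}"
    then obtain ustar v u vstar where c: "c = ereal (sqrt ((norm ustar)\<^sup>2 + (norm v)\<^sup>2 - (ustar \<bullet> u)\<^sup>2))"
      and dn: "(ustar, - vstar) \<in> dir_normal_cone (gph F) (xbar, ybar) (u, v)"
      and eq: "ustar \<bullet> u = vstar \<bullet> v" and unit: "norm u = 1" "norm vstar = 1"
      unfolding primal_dual_deriv_def by blast
    obtain A where "linear A" "A u = - v" "\<And>d. vstar \<bullet> A d = - (ustar \<bullet> d)"
      "\<And>d. norm (A d) \<le> sqrt ((norm ustar)\<^sup>2 + (norm v)\<^sup>2 - (ustar \<bullet> u)\<^sup>2) * norm d"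
      using critical_direction_operator[OF eq unit] by blast
    then show "rad_SR F_C1 F xbar ybar \<le> c"
      unfolding c by (intro rad_SR_C1_le_operator_bound[OF assms(2) dn unit])
  qed
  \<comment> \<open>A lower bound for the norms of all fitting maps is a lower bound for the semismooth
    radius.\<close>
  have below: "x \<le> rad_SR F_ss F xbar ybar"
    if le: "\<And>ustar vstar u v A K. (ustar, - vstar) \<in> dir_normal_cone (gph F) (xbar, ybar) (u, v) \<Longrightarrow>
      norm u = 1 \<Longrightarrow> norm vstar = 1 \<Longrightarrow> linear A \<Longrightarrow> (\<And>d. norm (A d) \<le> K * norm d) \<Longrightarrow> A u = - v \<Longrightarrow>
      (\<And>d. vstar \<bullet> A d = - (ustar \<bullet> d)) \<Longrightarrow> x \<le> ereal K" for x
    unfolding rad_SR_def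
  proof (rule Inf_greatest)
    fix c assume "c \<in> {lip_modulus h xbar | h.
            h \<in> F_ss xbar \<and> \<not> metrically_subregular (\<lambda>x. {y + h x | y. y \<in> F x}) xbar ybar}"
    then obtain h where c: "c = lip_modulus h xbar" and h: "h xbar = 0" "semismooth_at h xbar"
      and nsub: "\<not> metrically_subregular (\<lambda>x. {y + h x | y. y \<in> F x}) xbar ybar"
      unfolding F_ss_def by blast
    show "x \<le> c"
    proof (rule ccontr)
      assume "\<not> x \<le> c"
      then have "c < x" by simp
      then obtain L :: real where L: "c < ereal L" "ereal L < x" using ereal_dense2 by blast
      obtain u v ustar vstar A where "(ustar, - vstar) \<in> dir_normal_cone (gph F) (xbar, ybar) (u, v)"
        "norm u = 1" "norm vstar = 1" "linear A" "\<And>d. norm (A d) \<le> L * norm d" "A u = - v"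
        "\<And>d. vstar \<bullet> A d = - (ustar \<bullet> d)"
        using semismooth_not_subregular_imp_critical_direction[OF assms h L(1)[unfolded c] nsub] by blast
      then have "x \<le> ereal L" by (rule le)
      with L(2) show False by simp
    qed
  qed
  have ss_C1: "rad_SR F_ss F xbar ybar = rad_SR F_C1 F xbar ybar"
  proof (rule antisym)
    show "rad_SR F_ss F xbar ybar \<le> rad_SR F_C1 F xbar ybar" by (rule rad_SR_antimono) (rule F_C1_subset_F_ss)
    show "rad_SR F_C1 F xbar ybar \<le> rad_SR F_ss F xbar ybar"
      by (rule below) (rule rad_SR_C1_le_operator_bound[OF assms(2)])
  qed
  have lower: "ereal (1 / sqrt 2) * rg_circ F xbar ybar \<le> rad_SR F_ss F xbar ybar"
  proof (rule below)
    fix ustar vstar u v A K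
    assume "(ustar, - vstar) \<in> dir_normal_cone (gph F) (xbar, ybar) (u, v)" "norm u = 1" "norm vstar = 1"
      "linear A" "\<And>d. norm (A d) \<le> K * norm d" "A u = - v" "\<And>d. vstar \<bullet> A d = - (ustar \<bullet> d)"
    then have "rg_circ F xbar ybar \<le> ereal (sqrt 2 * K)" by (intro rg_circ_le_operator_bound)
    then have "ereal (1 / sqrt 2) * rg_circ F xbar ybar \<le> ereal (1 / sqrt 2) * ereal (sqrt 2 * K)"
      by (intro ereal_mult_left_mono) auto
    then show "ereal (1 / sqrt 2) * rg_circ F xbar ybar \<le> ereal K" by simp
  qed
  have "rad_SR F_Lip F xbar ybar \<le> rad_SR F_C1 F xbar ybar"
    by (rule rad_SR_antimono) (use F_C1_subset_F_ss F_ss_subset_F_Lip in blast)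
  with upper lower ss_C1 show ?thesis by (meson order_trans)
qed

end
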